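(* Let $a<b$ be real numbers and let $\mathbb{I}=[a,b]$ and $\mathbb{T}$ be the interval $[a,b]$ with end points identified. (1) For any choice of natural numbers $s_d$ ($d\in\mathbb{N}$), the problem $\{H^{s_d}_{\rm mix}(\mathbb{I}^d)\hookrightarrow L_2(\mathbb{I}^d)\}$ is not polynomially tractable. (2) For natural numbers $s_d$ ($d\in\mathbb{N}$), the problem $\{H^{s_d}_{\rm mix}(\mathbb{T}^d)\hookrightarrow L_2(\mathbb{T}^d)\}$ is strongly polynomially tractable if and only if it is polynomially tractable, if and only if one of the following holds: $b-a<2\pi$ and $s_d$ grows at least logarithmically in $d$; or $b-a=2\pi$ and $s_d$ grows at least polynomially in $d$.
   Context: $\mathbb{N}=\{1,2,\dots\}$. For $s\in\mathbb{N}$, $H^s(\mathbb{I})=\{f\in L_2(\mathbb{I}) : f^{(l)}\in L_2(\mathbb{I}),\ 1\le l\le s\}$ (weak derivatives) with scalar product $\langle f,g\rangle_s=\sum_{l=0}^s\int_a^b f^{(l)}(x)\overline{g^{(l)}(x)}\,dx$, and $H^s(\mathbb{T})=\{f\in H^s(\mathbb{I}) : f^{(l)}(a)=f^{(l)}(b)\text{ for }l=0,\dots,s-1\}$ is its closed subspace of periodic functions, with the same scalar product. $H^s_{\rm mix}(\mathbb{I}^d)$ and $H^s_{\rm mix}(\mathbb{T}^d)$ are the $d$th Hilbert space tensor powers of $H^s(\mathbb{I})$ and $H^s(\mathbb{T})$, realized as spaces of functions on $[a,b]^d$; their scalar product is $\langle f,g\rangle_s=\sum_{\alpha\in\{0,\dots,s\}^d}\int_{[a,b]^d}D^\alpha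 f\,\overline{D^\alpha g}\,dx$. $L_2(\mathbb{I}^d)=L_2(\mathbb{T}^d)=L_2([a,b]^d)$ with the usual scalar product. For a compact operator $T:X\to Y$ between Hilbert spaces, $a_n(T)=\inf\{\|T-A\| : A:X\to Y\text{ bounded linear},\ \operatorname{rank}(A)<n\}$. For a sequence of compact operators $S_d$ between Hilbert spaces (here $S_d$ is the respective embedding in dimension $d$), the information complexity is $n(\varepsilon,d)=\#\{n\in\mathbb{N} : a_n(S_d)\ge\varepsilon\}$. This is the minimal number of continuous linear functionals needed to approximate $S_d$ on the unit ball with worst case error less than $\varepsilon$. The problem $\{S_d\}$ is polynomially tractable if there are nonnegative $C,p,q$ with $n(\varepsilon,d)\le C\varepsilon^{-q}d^p$ for all $d\in\mathbb{N}$ and $\varepsilon>0$, and strongly polynomially tractable if this holds with $p=0$. "$s_d$ grows at least logarithmically in $d$" means that there are $c>0$ and $d_0$ with $s_d\ge c\log d$ for all $d\ge d_0$; "$s_d$ grows at least polynomially in $d$" means that there are $c,p>0$ and $d_0$ with $s_d\ge c\,d^p$ for all $d\ge d_0$. *)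

theory Defs
  imports "HOL-Analysis.Analysis"
begin

text \<open>
  A (pre-)Hilbert space of complex functions is a set of functions, closed under pointwise linear
  combinations, with a positive semidefinite scalar product. Functions at distance 0 represent
  the same vector, so all notions below (linearity, rank) are to be read modulo distance 0; for
  the spaces defined here this is equality almost everywhere.
\<close>

record 'a hspace =
  vecs :: "('a \<Rightarrow> complex) set"
  sprod :: "('a \<Rightarrow> complex) \<Rightarrow> ('a \<Rightarrow> complex) \<Rightarrow> complex"

definition hnorm :: "'a hspace \<Rightarrow> ('a \<Rightarrow> complex) \<Rightarrow> real" where
  "hnorm X f = sqrt (Re (sprod X f f))"

definition hdist :: "'a hspace \<Rightarrow> ('a \<Rightarrow> complex) \<Rightarrow> ('a \<Rightarrow> complex) \<Rightarrow> real" where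
  "hdist X f g = hnorm X (\<lambda>x. f x - g x)"

type_synonym ('a, 'b) operator = "('a \<Rightarrow> complex) \<Rightarrow> ('b \<Rightarrow> complex)"

text \<open>Linearity and boundedness together make \<open>A\<close> respect the identification in \<open>X\<close>.\<close>

definition bounded_linear_op :: "'a hspace \<Rightarrow> 'b hspace \<Rightarrow> ('a, 'b) operator \<Rightarrow> bool" where
  "bounded_linear_op X Y A \<longleftrightarrow>
     (\<forall>f\<in>vecs X. A f \<in> vecs Y) \<and>
     (\<forall>f\<in>vecs X. \<forall>g\<in>vecs X. hdist Y (A (\<lambda>x. f x + g x)) (\<lambda>y. A f y + A g y) = 0) \<and>
     (\<forall>f\<in>vecs X. \<forall>c. hdist Y (A (\<lambda>x. c * f x)) (\<lambda>y. c * A f y) = 0) \<and>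
     (\<exists>K. \<forall>f\<in>vecs X. hnorm Y (A f) \<le> K * hnorm X f)"

definition op_norm :: "'a hspace \<Rightarrow> 'b hspace \<Rightarrow> ('a, 'b) operator \<Rightarrow> real" where
  "op_norm X Y A = (SUP f\<in>{f \<in> vecs X. hnorm X f \<le> 1}. hnorm Y (A f))"

text \<open>The dimension of the range, as the least number of vectors spanning it.\<close>

definition op_rank :: "'a hspace \<Rightarrow> 'b hspace \<Rightarrow> ('a, 'b) operator \<Rightarrow> enat" where
  "op_rank X Y A = Inf {enat m | m. \<exists>g :: nat \<Rightarrow> 'b \<Rightarrow> complex.
     (\<forall>j<m. g j \<in> A ` vecs X) \<and>
     (\<forall>f\<in>vecs X. \<exists>c :: nat \<Rightarrow> complex. hdist Y (A f) (\<lambda>y. \<Sum>j<m. c j * g j y) = 0)}"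

definition approx_number :: "'a hspace \<Rightarrow> 'b hspace \<Rightarrow> ('a, 'b) operator \<Rightarrow> nat \<Rightarrow> real" where
  "approx_number X Y T n = Inf {op_norm X Y (\<lambda>f y. T f y - A f y) | A.
     bounded_linear_op X Y A \<and> op_rank X Y A < enat n}"

definition info_complexity :: "'a hspace \<Rightarrow> 'b hspace \<Rightarrow> ('a, 'b) operator \<Rightarrow> real \<Rightarrow> enat" where
  "info_complexity X Y T \<epsilon> =
     (let N = {n. n \<ge> 1 \<and> approx_number X Y T n \<ge> \<epsilon>} in if finite N then enat (card N) else \<infinity>)"

definition tractable_with ::
  "real \<Rightarrow> real \<Rightarrow> real \<Rightarrow> (nat \<Rightarrow> 'a hspace) \<Rightarrow> (nat \<Rightarrow> 'b hspace) \<Rightarrow> (nat \<Rightarrow> ('a, 'b) operator) \<Rightarrow> bool"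
where
  "tractable_with C p q X Y S \<longleftrightarrow>
     (\<forall>d\<ge>1. \<forall>\<epsilon>>0. ereal_of_enat (info_complexity (X d) (Y d) (S d) \<epsilon>)
        \<le> ereal (C * \<epsilon> powr (- q) * real d powr p))"

definition polynomially_tractable ::
  "(nat \<Rightarrow> 'a hspace) \<Rightarrow> (nat \<Rightarrow> 'b hspace) \<Rightarrow> (nat \<Rightarrow> ('a, 'b) operator) \<Rightarrow> bool" where
  "polynomially_tractable X Y S \<longleftrightarrow> (\<exists>C\<ge>0. \<exists>p\<ge>0. \<exists>q\<ge>0. tractable_with C p q X Y S)"

definition strongly_polynomially_tractable ::
  "(nat \<Rightarrow> 'a hspace) \<Rightarrow> (nat \<Rightarrow> 'b hspace) \<Rightarrow> (nat \<Rightarrow> ('a, 'b) operator) \<Rightarrow> bool" where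
  "strongly_polynomially_tractable X Y S \<longleftrightarrow> (\<exists>C\<ge>0. \<exists>q\<ge>0. tractable_with C 0 q X Y S)"

definition L2_space :: "'a measure \<Rightarrow> 'a hspace" where
  "L2_space M = \<lparr>
     vecs = {f \<in> borel_measurable M. integrable M (\<lambda>x. (cmod (f x))\<^sup>2)},
     sprod = (\<lambda>f g. \<integral>x. f x * cnj (g x) \<partial>M)\<rparr>"

definition interval_measure_on :: "real \<Rightarrow> real \<Rightarrow> real measure" where
  "interval_measure_on a b = restrict_space lborel {a..b}"

text \<open>Points of \<open>[a,b]\<^sup>d\<close> are the functions in \<open>{..<d} \<rightarrow>\<^sub>E {a..b}\<close>.\<close>

definition cube_measure :: "real \<Rightarrow> real \<Rightarrow> nat \<Rightarrow> (nat \<Rightarrow> real) measure" where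
  "cube_measure a b d = PiM {..<d} (\<lambda>_. interval_measure_on a b)"

definition L2_cube :: "real \<Rightarrow> real \<Rightarrow> nat \<Rightarrow> (nat \<Rightarrow> real) hspace" where
  "L2_cube a b d = L2_space (cube_measure a b d)"

text \<open>
  A smooth function is handled together with the family of all its derivatives: \<open>\<Phi> 0\<close> is a
  function in \<open>C\<^sub>c\<^sup>\<infinity>((a,b))\<close>, and \<open>\<Phi> l\<close> is its derivative of order \<open>l\<close>.
\<close>

definition test_family :: "real \<Rightarrow> real \<Rightarrow> (nat \<Rightarrow> real \<Rightarrow> complex) \<Rightarrow> bool" where
  "test_family a b \<Phi> \<longleftrightarrow>
     (\<forall>l t. (\<Phi> l has_vector_derivative \<Phi> (Suc l) t) (at t)) \<and>
     (\<exists>u v. a < u \<and> v < b \<and> (\<forall>t. \<Phi> 0 t \<noteq> 0 \<longrightarrow> t \<in> {u..v}))"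

definition has_weak_deriv ::
  "real \<Rightarrow> real \<Rightarrow> nat \<Rightarrow> (real \<Rightarrow> complex) \<Rightarrow> (real \<Rightarrow> complex) \<Rightarrow> bool" where
  "has_weak_deriv a b l f g \<longleftrightarrow> g \<in> vecs (L2_space (interval_measure_on a b)) \<and>
     (\<forall>\<Phi>. test_family a b \<Phi> \<longrightarrow>
        (\<integral>t. f t * \<Phi> l t \<partial>interval_measure_on a b)
        = (-1) ^ l * (\<integral>t. g t * \<Phi> 0 t \<partial>interval_measure_on a b))"

text \<open>A representative of the weak derivative, which is unique almost everywhere if it exists.\<close>

definition weak_deriv :: "real \<Rightarrow> real \<Rightarrow> nat \<Rightarrow> (real \<Rightarrow> complex) \<Rightarrow> real \<Rightarrow> complex" where
  "weak_deriv a b l f = (SOME g. has_weak_deriv a b l f g)"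

definition sobolev_interval :: "real \<Rightarrow> real \<Rightarrow> nat \<Rightarrow> real hspace" where
  "sobolev_interval a b s = \<lparr>
     vecs = {f \<in> vecs (L2_space (interval_measure_on a b)). \<forall>l\<in>{1..s}. \<exists>g. has_weak_deriv a b l f g},
     sprod = (\<lambda>f g. \<Sum>l\<le>s. sprod (L2_space (interval_measure_on a b))
                                (weak_deriv a b l f) (weak_deriv a b l g))\<rparr>"

text \<open>
  The boundary values \<open>f\<^sup>(\<^sup>l\<^sup>)(a)\<close>, \<open>f\<^sup>(\<^sup>l\<^sup>)(b)\<close> for \<open>l < s\<close> are those of the
  continuous representative of the weak derivative.
\<close>

definition sobolev_torus :: "real \<Rightarrow> real \<Rightarrow> nat \<Rightarrow> real hspace" where
  "sobolev_torus a b s = \<lparr>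
     vecs = {f \<in> vecs (sobolev_interval a b s).
       \<forall>l<s. \<exists>g. continuous_on {a..b} g \<and> has_weak_deriv a b l f g \<and> g a = g b},
     sprod = sprod (sobolev_interval a b s)\<rparr>"

text \<open>Multi-indices of length \<open>d\<close> are padded with zeros.\<close>

definition multi_indices :: "nat \<Rightarrow> nat \<Rightarrow> (nat \<Rightarrow> nat) set" where
  "multi_indices d s = {\<alpha>. (\<forall>i<d. \<alpha> i \<le> s) \<and> (\<forall>i\<ge>d. \<alpha> i = 0)}"

text \<open>
  As above, in \<open>d\<close> variables: \<open>\<Phi> (\<lambda>_. 0)\<close> is in \<open>C\<^sub>c\<^sup>\<infinity>((a,b)\<^sup>d)\<close>, with partial
  derivatives \<open>\<Phi> \<alpha>\<close>. The product topology on functions induces the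
  Euclidean topology of \<open>\<real>\<^sup>d\<close> on \<open>{..<d} \<rightarrow>\<^sub>E UNIV\<close>.
\<close>

definition mixed_test_family ::
  "real \<Rightarrow> real \<Rightarrow> nat \<Rightarrow> ((nat \<Rightarrow> nat) \<Rightarrow> (nat \<Rightarrow> real) \<Rightarrow> complex) \<Rightarrow> bool" where
  "mixed_test_family a b d \<Phi> \<longleftrightarrow>
     (\<forall>\<alpha>. continuous_on ({..<d} \<rightarrow>\<^sub>E UNIV) (\<Phi> \<alpha>)) \<and>
     (\<forall>\<alpha>. \<forall>x \<in> {..<d} \<rightarrow>\<^sub>E UNIV. \<forall>i<d.
        ((\<lambda>t. \<Phi> \<alpha> (x(i := t))) has_vector_derivative \<Phi> (\<alpha>(i := Suc (\<alpha> i))) x) (at (x i))) \<and>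
     (\<exists>u v. a < u \<and> v < b \<and>
        (\<forall>x \<in> {..<d} \<rightarrow>\<^sub>E UNIV. \<Phi> (\<lambda>_. 0) x \<noteq> 0 \<longrightarrow> (\<forall>i<d. x i \<in> {u..v})))"

definition has_mixed_weak_deriv ::
  "real \<Rightarrow> real \<Rightarrow> nat \<Rightarrow> (nat \<Rightarrow> nat) \<Rightarrow> ((nat \<Rightarrow> real) \<Rightarrow> complex) \<Rightarrow> ((nat \<Rightarrow> real) \<Rightarrow> complex) \<Rightarrow> bool"
where
  "has_mixed_weak_deriv a b d \<alpha> f g \<longleftrightarrow> g \<in> vecs (L2_cube a b d) \<and>
     (\<forall>\<Phi>. mixed_test_family a b d \<Phi> \<longrightarrow>
        (\<integral>x. f x * \<Phi> \<alpha> x \<partial>cube_measure a b d)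
        = (-1) ^ (\<Sum>i<d. \<alpha> i) * (\<integral>x. g x * \<Phi> (\<lambda>_. 0) x \<partial>cube_measure a b d))"

definition mixed_weak_deriv ::
  "real \<Rightarrow> real \<Rightarrow> nat \<Rightarrow> (nat \<Rightarrow> nat) \<Rightarrow> ((nat \<Rightarrow> real) \<Rightarrow> complex) \<Rightarrow> (nat \<Rightarrow> real) \<Rightarrow> complex" where
  "mixed_weak_deriv a b d \<alpha> f = (SOME g. has_mixed_weak_deriv a b d \<alpha> f g)"

text \<open>
  The complete ambient space in which the tensor powers are formed. Its scalar product satisfies
  \<open>\<langle>f\<^sub>1 \<otimes> \<dots> \<otimes> f\<^sub>d, g\<^sub>1 \<otimes> \<dots> \<otimes> g\<^sub>d\<rangle> = \<langle>f\<^sub>1, g\<^sub>1\<rangle> \<cdots> \<langle>f\<^sub>d, g\<^sub>d\<rangle>\<close> for \<open>f\<^sub>i\<close>, \<open>g\<^sub>i\<close> in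
  \<open>sobolev_interval a b s\<close>.
\<close>

definition mixed_sobolev :: "real \<Rightarrow> real \<Rightarrow> nat \<Rightarrow> nat \<Rightarrow> (nat \<Rightarrow> real) hspace" where
  "mixed_sobolev a b s d = \<lparr>
     vecs = {f \<in> vecs (L2_cube a b d). \<forall>\<alpha>\<in>multi_indices d s. \<exists>g. has_mixed_weak_deriv a b d \<alpha> f g},
     sprod = (\<lambda>f g. \<Sum>\<alpha>\<in>multi_indices d s.
       sprod (L2_cube a b d) (mixed_weak_deriv a b d \<alpha> f) (mixed_weak_deriv a b d \<alpha> g))\<rparr>"

definition algebraic_tensor_power ::
  "nat \<Rightarrow> (real \<Rightarrow> complex) set \<Rightarrow> ((nat \<Rightarrow> real) \<Rightarrow> complex) set" where
  "algebraic_tensor_power d V = {(\<lambda>x. \<Sum>j<m. c j * (\<Prod>i<d. u j i (x i))) | (m :: nat) c u.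
     \<forall>j<m. \<forall>i<d. u j i \<in> V}"

text \<open>
  The Hilbert space tensor power of a subspace \<open>H\<close> of \<open>sobolev_interval a b s\<close>: the completion
  of the algebraic one, as its closure in \<open>mixed_sobolev a b s d\<close>.
\<close>

definition tensor_power :: "real \<Rightarrow> real \<Rightarrow> nat \<Rightarrow> nat \<Rightarrow> real hspace \<Rightarrow> (nat \<Rightarrow> real) hspace" where
  "tensor_power a b s d H = \<lparr>
     vecs = {f \<in> vecs (mixed_sobolev a b s d). \<forall>e>0. \<exists>g \<in> algebraic_tensor_power d (vecs H).
               hdist (mixed_sobolev a b s d) f g < e},
     sprod = sprod (mixed_sobolev a b s d)\<rparr>"

definition Hmix_interval :: "real \<Rightarrow> real \<Rightarrow> nat \<Rightarrow> nat \<Rightarrow> (nat \<Rightarrow> real) hspace" where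
  "Hmix_interval a b s d = tensor_power a b s d (sobolev_interval a b s)"

definition Hmix_torus :: "real \<Rightarrow> real \<Rightarrow> nat \<Rightarrow> nat \<Rightarrow> (nat \<Rightarrow> real) hspace" where
  "Hmix_torus a b s d = tensor_power a b s d (sobolev_torus a b s)"

definition grows_at_least_logarithmically :: "(nat \<Rightarrow> nat) \<Rightarrow> bool" where
  "grows_at_least_logarithmically s \<longleftrightarrow> (\<exists>c>0. \<exists>d0\<ge>1. \<forall>d\<ge>d0. real (s d) \<ge> c * ln (real d))"

definition grows_at_least_polynomially :: "(nat \<Rightarrow> nat) \<Rightarrow> bool" where
  "grows_at_least_polynomially s \<longleftrightarrow> (\<exists>c>0. \<exists>p>0. \<exists>d0\<ge>1. \<forall>d\<ge>d0. real (s d) \<ge> c * real d powr p)"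

end

theory Submission
  imports Defs
begin

text \<open>
  On the torus the functions \<open>e\<^sub>k(x) = \<Prod>\<^sub>i exp(\<i> \<omega> k\<^sub>i x\<^sub>i)\<close> with \<open>\<omega> = 2\<pi> / (b - a)\<close> are orthogonal both
  in \<open>L\<^sub>2\<close> and in the mixed Sobolev space, and the ratio of the squared norms is the product of the weights
  \<open>w(k\<^sub>i) = \<Sum>\<^sub>l\<^sub>\<le>\<^sub>s (\<omega> k\<^sub>i)\<^sup>2\<^sup>l\<close>. Projecting onto the \<open>e\<^sub>k\<close> of small weight and counting them by Markov's
  inequality gives \<open>n(\<epsilon>, d) \<le> (2/\<epsilon>)\<^sup>q (\<Sum>\<^sub>k w(k)\<^sup>-\<^sup>q\<^sup>/\<^sup>2)\<^sup>d\<close>. If \<open>w(k)\<^sup>-\<^sup>q\<^sup>/\<^sup>2 \<le> D / (d k\<^sup>2)\<close> for all \<open>k \<noteq> 0\<close>, the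
  last factor is bounded by \<open>exp(4 D)\<close>; such a \<open>q\<close> exists under either growth condition.

  Conversely, suppose that \<open>f\<close> is orthogonal to 1 in both spaces and that the ratio of its squared norms is
  \<open>A\<close>. The products with factor \<open>f\<close> in exactly \<open>m\<close> coordinates and 1 elsewhere span a space of dimension
  \<open>d choose m\<close> on which the ratio of the squared norms is \<open>A\<^sup>m\<close>, hence \<open>n(A\<^sup>-\<^sup>m\<^sup>/\<^sup>2, d) \<ge> d choose m\<close>. For fixed
  \<open>m > p\<close>, polynomial tractability forces a power of \<open>A\<close> to dominate \<open>d\<close>. On the interval, a linear function
  \<open>f\<close> has \<open>A\<close> independent of \<open>s\<close>; on the torus, \<open>f = exp(\<i> \<omega> x)\<close> has \<open>A = \<Sum>\<^sub>l\<^sub>\<le>\<^sub>s \<omega>\<^sup>2\<^sup>l\<close>.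
\<close>

section \<open>Smooth functions with compact support\<close>

text \<open>The weights enter the upper bound through the fact that the L2 coefficient of D^\<alpha>
  f at e_k is (i \<omega> k)^\<alpha> times that of f: Bessel's inequality for D^\<alpha> f, summed
  over \<alpha>, bounds the weighted squares of the coefficients of f. Two obstacles shape its
  proof. The derivatives are weak and e_k is no test function, so integration by parts needs cutoffs
  whose derivatives concentrate at the end points; the boundary contributions cancel because the
  continuous representatives are periodic. And the space is a closure of algebraic tensors, so the
  identity is proved for products and carried over by continuity. That the e_k miss no part of f
  follows from Stone-Weierstrass on the circle. The two growth conditions differ because the
  smallest nontrivial weight is w(1): for \<omega> > 1 its top term is already exponential in s,
  whereas for \<omega> = 1 all its terms are 1 and it is only s + 1.\<close>

definition smooth_family :: "(nat \<Rightarrow> real \<Rightarrow> complex) \<Rightarrow> bool" where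
  "smooth_family \<Phi> \<longleftrightarrow> (\<forall>l t. (\<Phi> l has_vector_derivative \<Phi> (Suc l) t) (at t))"

lemma smooth_familyD: "smooth_family \<Phi> \<Longrightarrow> (\<Phi> l has_vector_derivative \<Phi> (Suc l) t) (at t)"
  by (simp add: smooth_family_def)

text \<open>Choosing a derivative inside \<open>C\<close> and iterating the choice yields the whole
  tower, so smoothness reduces to exhibiting a class of functions closed under
  differentiation.\<close>

lemma smooth_family_closed:
  assumes step: "\<And>f. f \<in> C \<Longrightarrow> \<exists>f'\<in>C. \<forall>t. (f has_vector_derivative f' t) (at t)" and "f \<in> C"
  shows "\<exists>\<Phi>. smooth_family \<Phi> \<and> \<Phi> 0 = f"
proof -
  obtain D where D: "\<And>f. f \<in> C \<Longrightarrow> D f \<in> C \<and> (\<forall>t. (f has_vector_derivative D f t) (at t))"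
    using step by metis
  have "(D ^^ l) f \<in> C" for l
    by (induction l) (use D \<open>f \<in> C\<close> in auto)
  then have "smooth_family (\<lambda>l. (D ^^ l) f)"
    using D by (auto simp: smooth_family_def)
  then show ?thesis by (intro exI[of _ "\<lambda>l. (D ^^ l) f"]) auto
qed

text \<open>By the Leibniz rule a derivative of a product of derivatives is a sum of two such
  products. Closing under sums gives a class stable under differentiation without any binomial
  coefficients.\<close>

inductive_set product_sums for \<Phi> \<Psi> :: "nat \<Rightarrow> real \<Rightarrow> complex" where
  base: "(\<lambda>t. \<Phi> i t * \<Psi> j t) \<in> product_sums \<Phi> \<Psi>"
| add: "f \<in> product_sums \<Phi> \<Psi> \<Longrightarrow> g \<in> product_sums \<Phi> \<Psi> \<Longrightarrow> (\<lambda>t. f t + g t) \<in> product_sums \<Phi> \<Psi>"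

lemma smooth_family_mult:
  assumes "smooth_family \<Phi>" "smooth_family \<Psi>"
  shows "\<exists>\<Theta>. smooth_family \<Theta> \<and> \<Theta> 0 = (\<lambda>t. \<Phi> 0 t * \<Psi> 0 t)"
proof (rule smooth_family_closed[where C = "product_sums \<Phi> \<Psi>"])
  show "(\<lambda>t. \<Phi> 0 t * \<Psi> 0 t) \<in> product_sums \<Phi> \<Psi>" by (rule product_sums.base)
  fix f assume "f \<in> product_sums \<Phi> \<Psi>"
  then show "\<exists>f'\<in>product_sums \<Phi> \<Psi>. \<forall>t. (f has_vector_derivative f' t) (at t)"
  proof induction
    case (base i j)
    have "(\<lambda>t. \<Phi> i t * \<Psi> (Suc j) t + \<Phi> (Suc i) t * \<Psi> j t) \<in> product_sums \<Phi> \<Psi>"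
      by (intro product_sums.intros)
    moreover have "((\<lambda>t. \<Phi> i t * \<Psi> j t) has_vector_derivative
        \<Phi> i t * \<Psi> (Suc j) t + \<Phi> (Suc i) t * \<Psi> j t) (at t)" for t
      by (intro has_vector_derivative_mult smooth_familyD assms)
    ultimately show ?case
      by (intro bexI[of _ "\<lambda>t. \<Phi> i t * \<Psi> (Suc j) t + \<Phi> (Suc i) t * \<Psi> j t"]) auto
  next
    case (add f g)
    then obtain f' g' where "f' \<in> product_sums \<Phi> \<Psi>" "g' \<in> product_sums \<Phi> \<Psi>"
      "\<And>t. (f has_vector_derivative f' t) (at t)" "\<And>t. (g has_vector_derivative g' t) (at t)"
      by blast
    then show ?case
      by (intro bexI[of _ "\<lambda>t. f' t + g' t"] product_sums.add)
         (auto intro!: has_vector_derivative_add)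
  qed
qed

lemma smooth_family_affine:
  assumes "smooth_family \<Phi>"
  shows "smooth_family (\<lambda>l t. of_real (c ^ l) * \<Phi> l (c * t + e))"
  unfolding smooth_family_def
proof (intro allI)
  fix l t
  have "((\<lambda>t. c * t + e) has_vector_derivative c) (at t)"
    by (auto intro!: derivative_eq_intros)
  then have "((\<Phi> l \<circ> (\<lambda>t. c * t + e)) has_vector_derivative c *\<^sub>R \<Phi> (Suc l) (c * t + e)) (at t)"
    by (rule vector_diff_chain_at) (intro smooth_familyD assms)
  then have "((\<lambda>t. of_real (c ^ l) * (\<Phi> l \<circ> (\<lambda>t. c * t + e)) t) has_vector_derivative
      of_real (c ^ l) * (c *\<^sub>R \<Phi> (Suc l) (c * t + e))) (at t)"
    by (intro has_vector_derivative_mult_right)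
  then show "((\<lambda>t. of_real (c ^ l) * \<Phi> l (c * t + e)) has_vector_derivative
      of_real (c ^ Suc l) * \<Phi> (Suc l) (c * t + e)) (at t)"
    by (simp add: o_def scaleR_conv_of_real mult_ac)
qed

section \<open>Bump functions\<close>

definition flat_exp :: "real \<Rightarrow> real" where
  "flat_exp t = (if t > 0 then exp (- 1 / t) else 0)"

lemma tendsto_poly_div_exp: "((\<lambda>u::real. poly p u / exp u) \<longlongrightarrow> 0) at_top"
proof -
  have "((\<lambda>u::real. \<Sum>i\<le>degree p. coeff p i * (u ^ i / exp u)) \<longlongrightarrow> (\<Sum>i\<le>degree p. coeff p i * 0)) at_top"
    by (intro tendsto_intros tendsto_power_div_exp_0)
  then show ?thesis
    by (simp add: poly_altdef sum_divide_distrib)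
qed

text \<open>The class of functions p(1/t) exp(-1/t), extended by 0, is stable: for t > 0 the
  derivative is (p(1/t) - p'(1/t)) / t^2 times exp(-1/t), which accounts for the factor
  \<open>[:0, 0, 1:]\<close>.\<close>

lemma flat_exp_poly_deriv:
  fixes p :: "real poly"
  defines "h \<equiv> \<lambda>p t. poly p (1 / t) * flat_exp t"
  shows "(h p has_real_derivative h ([:0, 0, 1:] * (p - pderiv p)) t) (at t)"
proof -
  consider "t > 0" | "t < 0" | "t = 0" by linarith
  then show ?thesis
  proof cases
    case 1
    have "((\<lambda>t. poly p (1 / t) * exp (- 1 / t)) has_real_derivative
        poly ([:0, 0, 1:] * (p - pderiv p)) (1 / t) * exp (- 1 / t)) (at t)"
      using 1 by (auto intro!: derivative_eq_intros simp: field_simps power2_eq_square)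
    moreover have "eventually (\<lambda>t. poly p (1 / t) * exp (- 1 / t) = h p t) (nhds t)"
      using eventually_nhds_in_open[of "{0<..}" t] 1
      by (auto elim!: eventually_mono simp: h_def flat_exp_def)
    ultimately show ?thesis
      using 1 by (subst (asm) DERIV_cong_ev[OF refl _ refl]) (auto simp: h_def flat_exp_def)
  next
    case 2
    have "eventually (\<lambda>t. 0 = h p t) (nhds t)"
      using eventually_nhds_in_open[of "{..<0}" t] 2
      by (auto elim!: eventually_mono simp: h_def flat_exp_def)
    then show ?thesis
      using 2 DERIV_cong_ev[of t t "\<lambda>_. 0" "h p" 0 0] by (auto simp: h_def flat_exp_def)
  next
    case 3
    \<comment> \<open>The difference quotient at 0 from the right is u p(u) / exp u with u = 1/t;
      the factor \<open>[:0, 1:]\<close> is the division by t.\<close>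
    have "((\<lambda>u. poly ([:0, 1:] * p) u / exp u) \<longlongrightarrow> 0) at_top"
      by (rule tendsto_poly_div_exp)
    then have "((\<lambda>t. poly ([:0, 1:] * p) (inverse t) / exp (inverse t)) \<longlongrightarrow> 0) (at_right 0)"
      by (rule filterlim_compose) (rule filterlim_inverse_at_top_right)
    moreover have "eventually (\<lambda>t. poly ([:0, 1:] * p) (inverse t) / exp (inverse t)
        = h p t / t) (at_right 0)"
      by (rule eventually_at_right_less[THEN eventually_mono])
         (auto simp: h_def flat_exp_def field_simps exp_minus inverse_eq_divide)
    ultimately have r: "((\<lambda>t. h p t / t) \<longlongrightarrow> 0) (at_right 0)"
      by (rule Lim_transform_eventually)
    have "((\<lambda>t. h p t / t) \<longlongrightarrow> 0) (at_left 0)"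
      by (rule tendsto_eventually, rule eventually_at_leftI[of "-1"])
         (auto simp: h_def flat_exp_def)
    with r have "((\<lambda>t. h p t / t) \<longlongrightarrow> 0) (at 0)"
      by (simp add: filterlim_split_at)
    then show ?thesis
      using 3 by (simp add: has_field_derivative_iff h_def flat_exp_def)
  qed
qed

lemma smooth_flat_exp: "\<exists>\<Phi>. smooth_family \<Phi> \<and> \<Phi> 0 = (\<lambda>t. of_real (flat_exp t))"
proof (rule smooth_family_closed[where C = "range (\<lambda>p t. of_real (poly p (1 / t) * flat_exp t))"])
  show "(\<lambda>t. of_real (flat_exp t)) \<in> range (\<lambda>p t. of_real (poly p (1 / t) * flat_exp t))"
    by (rule range_eqI[of _ _ 1]) simp
  fix f :: "real \<Rightarrow> complex"
  assume "f \<in> range (\<lambda>p t. of_real (poly p (1 / t) * flat_exp t))"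
  then obtain p where "f = (\<lambda>t. of_real (poly p (1 / t) * flat_exp t))" by auto
  then show "\<exists>f'\<in>range (\<lambda>p t. of_real (poly p (1 / t) * flat_exp t)).
      \<forall>t. (f has_vector_derivative f' t) (at t)"
    using has_vector_derivative_of_real[OF flat_exp_poly_deriv[of p]]
    by (intro bexI[of _ "\<lambda>t. of_real (poly ([:0, 0, 1:] * (p - pderiv p)) (1 / t) * flat_exp t)"])
       blast+
qed

text \<open>A smooth rise at u times a smooth fall at v, supported in [u, v]. The factor n steepens
  both flanks, so that the values inside tend to 1 as n grows.\<close>

definition bump :: "nat \<Rightarrow> real \<Rightarrow> real \<Rightarrow> real \<Rightarrow> real" where
  "bump n u v t = flat_exp (real n * (t - u)) * flat_exp (real n * (v - t))"

lemma bump_bounds: "0 \<le> bump n u v t" "bump n u v t \<le> 1"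
proof -
  have "0 \<le> flat_exp t" "flat_exp t \<le> 1" for t by (auto simp: flat_exp_def)
  then show "0 \<le> bump n u v t" "bump n u v t \<le> 1"
    by (auto simp: bump_def intro!: mult_le_one)
qed

lemma bump_eq_0: "t \<le> u \<or> v \<le> t \<Longrightarrow> bump n u v t = 0"
  by (auto simp: bump_def flat_exp_def zero_less_mult_iff)

text \<open>The end points may move with n, which lets the supports stay inside an open interval
  while exhausting it.\<close>

lemma tendsto_bump:
  assumes u: "u \<longlonglongrightarrow> u0" and v: "v \<longlonglongrightarrow> v0" and "u0 < t" "t < v0"
  shows "(\<lambda>n. bump n (u n) (v n) t) \<longlonglongrightarrow> 1"
proof -
  have *: "(\<lambda>n. flat_exp (real n * x n)) \<longlonglongrightarrow> 1" if x: "x \<longlonglongrightarrow> x0" and "x0 > 0" for x x0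
  proof -
    have "filterlim (\<lambda>n. real n * x n) at_top sequentially"
      using filterlim_tendsto_pos_mult_at_top[OF x \<open>x0 > 0\<close> filterlim_real_sequentially]
      by (simp add: mult.commute)
    then have "(\<lambda>n. exp (- 1 * inverse (real n * x n))) \<longlonglongrightarrow> exp (- 1 * 0)"
      by (intro tendsto_intros tendsto_inverse_0_at_top)
    moreover have "eventually (\<lambda>n. exp (- 1 * inverse (real n * x n)) = flat_exp (real n * x n)) sequentially"
      using order_tendstoD(1)[OF x \<open>x0 > 0\<close>] eventually_gt_at_top[of 0]
      by eventually_elim (auto simp: flat_exp_def field_simps)
    ultimately show ?thesis
      by (auto elim: Lim_transform_eventually)
  qed
  have "(\<lambda>n. flat_exp (real n * (t - u n)) * flat_exp (real n * (v n - t))) \<longlonglongrightarrow> 1 * 1"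
    by (intro tendsto_mult *[of _ "t - u0"] *[of _ "v0 - t"] tendsto_intros u v) (use assms in auto)
  then show ?thesis by (simp add: bump_def)
qed

lemma smooth_bump: "\<exists>\<Phi>. smooth_family \<Phi> \<and> \<Phi> 0 = (\<lambda>t. of_real (bump n u v t))"
proof -
  obtain F where F: "smooth_family F" "F 0 = (\<lambda>t. of_real (flat_exp t))"
    using smooth_flat_exp by blast
  from smooth_family_mult[OF smooth_family_affine[OF F(1), of "real n" "- real n * u"]
      smooth_family_affine[OF F(1), of "- real n" "real n * v"]]
  show ?thesis by (simp add: F(2) bump_def algebra_simps)
qed

lemma test_family_iff:
  "test_family a b \<Phi> \<longleftrightarrow> smooth_family \<Phi> \<and> (\<exists>u v. a < u \<and> v < b \<and> (\<forall>t. \<Phi> 0 t \<noteq> 0 \<longrightarrow> t \<in> {u..v}))"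
  by (auto simp: test_family_def smooth_family_def)

lemma smooth_family_continuous: "smooth_family \<Phi> \<Longrightarrow> continuous_on S (\<Phi> l)"
  using smooth_familyD has_vector_derivative_continuous continuous_at_imp_continuous_on by metis

section \<open>Lebesgue measure on the interval and on the cube\<close>

lemma space_interval_measure [simp]: "space (interval_measure_on a b) = {a..b}"
  by (simp add: interval_measure_on_def space_restrict_space)

lemma sets_interval_measure: "sets (interval_measure_on a b) = sets (restrict_space borel {a..b})"
  unfolding interval_measure_on_def by (intro sets_restrict_space_cong) simp

lemma finite_interval_measure: "finite_measure (interval_measure_on a b)"
  by standard (simp add: interval_measure_on_def emeasure_restrict_space space_restrict_space emeasure_lborel_Icc_eq)

interpretation interval: finite_measure "interval_measure_on a b" for a b
  by (rule finite_interval_measure)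

interpretation intervals: product_sigma_finite "\<lambda>_::nat. interval_measure_on a b" for a b
  by standard

lemma space_cube_measure [simp]: "space (cube_measure a b d) = {..<d} \<rightarrow>\<^sub>E {a..b}"
  by (simp add: cube_measure_def space_PiM)

interpretation cube: finite_measure "cube_measure a b d" for a b d
proof
  have "emeasure (cube_measure a b d) ({..<d} \<rightarrow>\<^sub>E {a..b}) = 
      (\<Prod>i<d. emeasure (interval_measure_on a b) {a..b})"
    unfolding cube_measure_def
    by (rule intervals.emeasure_PiM) (auto simp: sets_interval_measure sets_restrict_space)
  also have "\<dots> \<noteq> \<infinity>"
    using interval.emeasure_finite by (simp add: power_eq_top_ennreal)
  finally show "emeasure (cube_measure a b d) (space (cube_measure a b d)) \<noteq> \<infinity>" by simp
qed

text \<open>The exceptional set lies in the cylinder over a null set in coordinate i, and the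
  product measure of that cylinder has a zero factor.\<close>

lemma AE_cube_component:
  assumes "i < d" "AE t in interval_measure_on a b. P t"
  shows "AE x in cube_measure a b d. P (x i)"
proof -
  obtain N where N: "N \<in> null_sets (interval_measure_on a b)"
    and P: "\<And>t. t \<in> space (interval_measure_on a b) - N \<Longrightarrow> P t"
    using AE_E3[OF assms(2)] by metis
  define A where "A j = (if j = i then N else {a..b})" for j
  have sets: "A j \<in> sets (interval_measure_on a b)" for j
    using N sets.top[of "interval_measure_on a b"] by (simp add: A_def null_setsD2)
  have "emeasure (cube_measure a b d) (Pi\<^sub>E {..<d} A) = (\<Prod>j<d. emeasure (interval_measure_on a b) (A j))"
    unfolding cube_measure_def by (rule intervals.emeasure_PiM[OF finite_lessThan sets])
  also have "\<dots> = 0"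
    using assms(1) N by (intro prod_zero bexI[of _ i]) (simp_all add: A_def null_setsD1)
  finally have "Pi\<^sub>E {..<d} A \<in> null_sets (cube_measure a b d)"
    using sets by (intro null_setsI) (simp_all add: cube_measure_def sets_PiM_I_finite)
  moreover have "{x \<in> space (cube_measure a b d). \<not> P (x i)} \<subseteq> Pi\<^sub>E {..<d} A"
  proof
    fix x assume "x \<in> {x \<in> space (cube_measure a b d). \<not> P (x i)}"
    then have x: "x \<in> {..<d} \<rightarrow>\<^sub>E {a..b}" "\<not> P (x i)" by simp_all
    have "x j \<in> {a..b}" if "j < d" for j using PiE_mem[OF x(1), of j] that by simp
    moreover from this have "x i \<in> N" using \<open>i < d\<close> P[of "x i"] x(2) by auto
    ultimately show "x \<in> Pi\<^sub>E {..<d} A"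
      using PiE_arb[OF x(1)] by (intro PiE_I) (simp_all add: A_def)
  qed
  ultimately show ?thesis by (rule AE_I')
qed

lemma measurable_cube_component [measurable]:
  "i < d \<Longrightarrow> (\<lambda>x. x i) \<in> measurable (cube_measure a b d) (interval_measure_on a b)"
  unfolding cube_measure_def by (rule measurable_component_singleton) auto

lemma borel_measurable_interval:
  assumes "f \<in> borel_measurable borel"
  shows "f \<in> borel_measurable (interval_measure_on a b)"
  using assms by (simp add: interval_measure_on_def measurable_restrict_space1)

lemma borel_measurable_cube_prod:
  fixes f :: "nat \<Rightarrow> real \<Rightarrow> complex"
  assumes "\<And>i. i < d \<Longrightarrow> f i \<in> borel_measurable (interval_measure_on a b)"
  shows "(\<lambda>x. \<Prod>i<d. f i (x i)) \<in> borel_measurable (cube_measure a b d)"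
proof (rule borel_measurable_prod)
  fix i assume "i \<in> {..<d}"
  then show "(\<lambda>x. f i (x i)) \<in> borel_measurable (cube_measure a b d)"
    by (intro measurable_compose[OF measurable_cube_component assms]) simp_all
qed

text \<open>(u, v) is intersected with (a, b) and shrunk by 1/(n + 1), which makes every bump
  compactly supported in (a, b). At t = a and t = b the bumps vanish even where the indicator is 1,
  hence the strict inequalities.\<close>

lemma tendsto_bump_indicator:
  assumes "a < t" "t < b"
  shows "(\<lambda>n. bump n (max u a + inverse (Suc n)) (min v b - inverse (Suc n)) t)
          \<longlonglongrightarrow> indicator {u<..<v} t"
proof (cases "u < t \<and> t < v")
  case True
  have "(\<lambda>n. max u a + inverse (real (Suc n))) \<longlonglongrightarrow> max u a + 0"
    "(\<lambda>n. min v b - inverse (real (Suc n))) \<longlonglongrightarrow> min v b - 0"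
    by (intro tendsto_intros LIMSEQ_inverse_real_of_nat)+
  then show ?thesis
    using True assms tendsto_bump[of _ "max u a" _ "min v b" t] by auto
next
  case False
  have "bump n (max u a + inverse (Suc n)) (min v b - inverse (Suc n)) t = 0" for n
  proof (rule bump_eq_0)
    have "0 < inverse (real (Suc n))" by simp
    then show "t \<le> max u a + inverse (real (Suc n)) \<or> min v b - inverse (real (Suc n)) \<le> t"
      using False by (smt (verit))
  qed
  then show ?thesis using False by auto
qed

lemma continuous_on_cube_coordinate: "continuous_on S (\<lambda>x::nat \<Rightarrow> real. x i)"
  by (rule continuous_on_subset[OF continuous_on_product_coordinates]) simp

text \<open>Differentiation in coordinate i touches a single factor. One pair u, v bounds all
  supports, because \<open>mixed_test_family\<close> asks for a common cube.\<close>

lemma mixed_test_family_prod: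
  assumes \<Phi>: "\<And>i. i < d \<Longrightarrow> smooth_family (\<Phi> i)"
    and uv: "a < u" "v < b" "\<And>i t. i < d \<Longrightarrow> \<Phi> i 0 t \<noteq> 0 \<Longrightarrow> t \<in> {u..v}"
  shows "mixed_test_family a b d (\<lambda>\<alpha> x. \<Prod>i<d. \<Phi> i (\<alpha> i) (x i))"
  unfolding mixed_test_family_def
proof (intro conjI allI ballI impI)
  fix \<alpha>
  show "continuous_on ({..<d} \<rightarrow>\<^sub>E UNIV) (\<lambda>x. \<Prod>i<d. \<Phi> i (\<alpha> i) (x i))"
  proof (rule continuous_on_prod)
    fix i assume "i \<in> {..<d}"
    then have "continuous_on UNIV (\<Phi> i (\<alpha> i))" by (intro smooth_family_continuous \<Phi>) simp
    then show "continuous_on ({..<d} \<rightarrow>\<^sub>E UNIV) (\<lambda>x. \<Phi> i (\<alpha> i) (x i))"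
      by (rule continuous_on_compose2[OF _ continuous_on_cube_coordinate]) simp
  qed
next
  fix \<alpha> :: "nat \<Rightarrow> nat" and x :: "nat \<Rightarrow> real" and i assume "i < d"
  then have I: "{..<d} = insert i ({..<d} - {i})" by auto
  have *: "(\<Prod>j<d. \<Phi> j (\<beta> j) (y j)) = \<Phi> i (\<beta> i) (y i) * (\<Prod>j\<in>{..<d} - {i}. \<Phi> j (\<beta> j) (y j))" for \<beta> y
    using \<open>i < d\<close> prod.remove[of "{..<d}" i "\<lambda>j. \<Phi> j (\<beta> j) (y j)"] by simp
  have "((\<lambda>t. \<Phi> i (\<alpha> i) t * (\<Prod>j\<in>{..<d} - {i}. \<Phi> j (\<alpha> j) (x j))) has_vector_derivative
      \<Phi> i (Suc (\<alpha> i)) (x i) * (\<Prod>j\<in>{..<d} - {i}. \<Phi> j (\<alpha> j) (x j))) (at (x i))"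
    by (rule has_vector_derivative_mult_left[OF smooth_familyD[OF \<Phi>[OF \<open>i < d\<close>]]])
  then show "((\<lambda>t. \<Prod>j<d. \<Phi> j (\<alpha> j) ((x(i := t)) j)) has_vector_derivative
      (\<Prod>j<d. \<Phi> j ((\<alpha>(i := Suc (\<alpha> i))) j) (x j))) (at (x i))"
    unfolding *[of \<alpha> "x(i := t)" for t] *[of "\<alpha>(i := Suc (\<alpha> i))" x] by simp
next
  show "\<exists>u v. a < u \<and> v < b \<and> (\<forall>x\<in>{..<d} \<rightarrow>\<^sub>E UNIV. (\<Prod>i<d. \<Phi> i 0 (x i)) \<noteq> 0 \<longrightarrow> (\<forall>i<d. x i \<in> {u..v}))"
  proof -
    have "x i \<in> {u..v}" if *: "(\<Prod>i<d. \<Phi> i 0 (x i)) \<noteq> 0" "i < d" for x :: "nat \<Rightarrow> real" and i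
    proof -
      have "\<Phi> i 0 (x i) \<noteq> 0" using * by auto
      then show "x i \<in> {u..v}" by (rule uv(3)[OF \<open>i < d\<close>])
    qed
    then show ?thesis
      by (intro exI[of _ u] exI[of _ v] conjI uv(1,2)) simp
  qed
qed

section \<open>The fundamental lemma of the calculus of variations\<close>

text \<open>Products of bumps converge to indicators of boxes, and these generate the product
  \<sigma>-algebra.\<close>

lemma sets_cube_measure_boxes:
  "sets (cube_measure a b d) = sigma_sets ({..<d} \<rightarrow>\<^sub>E {a..b})
     {{x \<in> {..<d} \<rightarrow>\<^sub>E {a..b}. \<forall>i<d. x i \<in> {u i<..<v i}} | u v :: nat \<Rightarrow> real. True}"
proof -
  define E where "E = {{a..b} \<inter> {u<..<v} | u v :: real. True}"
  have "sets borel = sigma_sets UNIV (range (\<lambda>(u, v). {u<..<v::real}))"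
    by (subst borel_eq_box) (simp add: sets_measure_of case_prod_unfold box_real)
  moreover have "{a..b} \<in> sets borel" by simp
  ultimately have "(\<inter>) {a..b} ` sets borel = sigma_sets {a..b} ((\<inter>) {a..b} ` range (\<lambda>(u, v). {u<..<v::real}))"
    by (simp only: sigma_sets_Int subset_UNIV)
  then have "sets (interval_measure_on a b) = sigma_sets {a..b} ((\<inter>) {a..b} ` range (\<lambda>(u, v). {u<..<v::real}))"
    unfolding sets_interval_measure sets_restrict_space .
  also have "(\<inter>) {a..b} ` range (\<lambda>(u, v). {u<..<v::real}) = E"
    by (auto simp: E_def)
  finally have "sets (interval_measure_on a b) = sigma_sets {a..b} E" .
  moreover have E_Pow: "E \<subseteq> Pow {a..b}" by (auto simp: E_def)
  ultimately have E: "sets (interval_measure_on a b) = sets (sigma {a..b} E)"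
    by (simp add: sets_measure_of)
  \<comment> \<open>The enlarged interval makes the whole space a member of the generator, which is
    the covering condition for generators of a product \<sigma>-algebra.\<close>
  have "{a..b} \<inter> {a - 1<..<b + 1} = {a..b}" by auto
  then have "{a..b} \<in> E" unfolding E_def by blast
  then have cover: "\<exists>S\<subseteq>E. countable S \<and> {a..b} = \<Union>S"
    by (intro exI[of _ "{{a..b}}"]) simp
  have "sets (cube_measure a b d) = sets (PiM {..<d} (\<lambda>_. sigma {a..b} E))"
    unfolding cube_measure_def by (intro sets_PiM_cong refl E)
  also have "\<dots> = sets (sigma ({..<d} \<rightarrow>\<^sub>E {a..b})
      {{f \<in> {..<d} \<rightarrow>\<^sub>E {a..b}. \<forall>i\<in>j. f i \<in> A i} | A j. j \<in> {{..<d}} \<and> A \<in> Pi j (\<lambda>_. E)})"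
    by (rule sets_PiM_sigma[OF cover E_Pow]) simp_all
  also have "\<dots> = sigma_sets ({..<d} \<rightarrow>\<^sub>E {a..b})
      {{f \<in> {..<d} \<rightarrow>\<^sub>E {a..b}. \<forall>i\<in>j. f i \<in> A i} | A j. j \<in> {{..<d}} \<and> A \<in> Pi j (\<lambda>_. E)}"
    by (rule sets_measure_of) blast
  also have "{{f \<in> {..<d} \<rightarrow>\<^sub>E {a..b}. \<forall>i\<in>j. f i \<in> A i} | A j. j \<in> {{..<d}} \<and> A \<in> Pi j (\<lambda>_. E)} =
     {{x \<in> {..<d} \<rightarrow>\<^sub>E {a..b}. \<forall>i<d. x i \<in> {u i<..<v i}} | u v :: nat \<Rightarrow> real. True}" (is "?L = ?R")
  proof (intro equalityI subsetI)
    fix X assume "X \<in> ?L"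
    then obtain A where X: "X = {f \<in> {..<d} \<rightarrow>\<^sub>E {a..b}. \<forall>i<d. f i \<in> A i}" and "\<forall>i<d. A i \<in> E"
      by auto
    then have "\<forall>i. \<exists>u v. i < d \<longrightarrow> A i = {a..b} \<inter> {u<..<v}" unfolding E_def by blast
    then obtain u v where "\<forall>i. i < d \<longrightarrow> A i = {a..b} \<inter> {u i<..<v i}" by metis
    then have "X = {x \<in> {..<d} \<rightarrow>\<^sub>E {a..b}. \<forall>i<d. x i \<in> {u i<..<v i}}"
      unfolding X by (intro Collect_cong conj_cong refl) (force dest: PiE_mem)
    then show "X \<in> ?R" by blast
  next
    fix X assume "X \<in> ?R"
    then obtain u v where X: "X = {f \<in> {..<d} \<rightarrow>\<^sub>E {a..b}. \<forall>i<d. f i \<in> {u i<..<v i}}" by auto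
    have "X = {f \<in> {..<d} \<rightarrow>\<^sub>E {a..b}. \<forall>i\<in>{..<d}. f i \<in> {a..b} \<inter> {u i<..<v i}}"
      unfolding X by (intro Collect_cong conj_cong refl) (force dest: PiE_mem)
    then show "X \<in> ?L"
      by (intro CollectI exI[of _ "\<lambda>i. {a..b} \<inter> {u i<..<v i}"] exI[of _ "{..<d}"])
         (auto simp: E_def)
  qed
  finally show ?thesis .
qed

text \<open>Dynkin's argument: the boxes are stable under intersection, and the sets over which g
  integrates to 0 are closed under complements and disjoint countable unions. Hence g integrates to
  0 over every measurable set.\<close>

lemma AE_zero_if_boxes_zero:
  fixes g :: "(nat \<Rightarrow> real) \<Rightarrow> complex"
  assumes g: "integrable (cube_measure a b d) g"
    and box: "\<And>u v. (\<integral>x. (\<Prod>i<d. indicator {u i<..<v i} (x i)) * g x \<partial>cube_measure a b d) = 0"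
  shows "AE x in cube_measure a b d. g x = 0"
proof (rule cube.density_zero[OF g])
  let ?Q = "cube_measure a b d"
  let ?P = "{{x \<in> {..<d} \<rightarrow>\<^sub>E {a..b}. \<forall>i<d. x i \<in> {u i<..<v i}} | u v :: nat \<Rightarrow> real. True}"
  have ind: "indicat_real {x \<in> {..<d} \<rightarrow>\<^sub>E {a..b}. \<forall>i<d. x i \<in> {u i<..<v i}} x *\<^sub>R g x =
      (\<Prod>i<d. indicator {u i<..<v i} (x i)) * g x" if x: "x \<in> space ?Q" for u v x
  proof (cases "\<forall>i<d. x i \<in> {u i<..<v i}")
    case True
    then have "(\<Prod>i<d. indicator {u i<..<v i} (x i)) = (1::complex)"
      by (intro prod.neutral) simp
    moreover have "indicat_real {x \<in> {..<d} \<rightarrow>\<^sub>E {a..b}. \<forall>i<d. x i \<in> {u i<..<v i}} x = 1"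
      using True x unfolding space_cube_measure by (intro indicator_simps(1)) blast
    ultimately show ?thesis by simp
  next
    case False
    then obtain i where i: "i < d" "x i \<notin> {u i<..<v i}" by blast
    then have "(\<Prod>i<d. indicator {u i<..<v i} (x i)) = (0::complex)"
      by (intro prod_zero bexI[of _ i]) simp_all
    moreover have "indicat_real {x \<in> {..<d} \<rightarrow>\<^sub>E {a..b}. \<forall>i<d. x i \<in> {u i<..<v i}} x = 0"
      using i by (intro indicator_simps(2)) blast
    ultimately show ?thesis by simp
  qed
  have box': "set_lebesgue_integral ?Q A g = 0" if A_in: "A \<in> ?P" for A
  proof -
    obtain u v where A: "A = {x \<in> {..<d} \<rightarrow>\<^sub>E {a..b}. \<forall>i<d. x i \<in> {u i<..<v i}}"
      using A_in by blast
    show ?thesis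
      unfolding set_lebesgue_integral_def A
      using box[of u v] by (simp only: Bochner_Integration.integral_cong[OF refl ind])
  qed
  have P: "?P \<subseteq> Pow ({..<d} \<rightarrow>\<^sub>E {a..b})" by auto
  have ISt: "Int_stable ?P"
  proof (rule Int_stableI)
    fix A B assume "A \<in> ?P" "B \<in> ?P"
    then obtain u v u' v' where A: "A = {x \<in> {..<d} \<rightarrow>\<^sub>E {a..b}. \<forall>i<d. x i \<in> {u i<..<v i}}"
      and B: "B = {x \<in> {..<d} \<rightarrow>\<^sub>E {a..b}. \<forall>i<d. x i \<in> {u' i<..<v' i}}" by blast
    have "A \<inter> B = {x \<in> {..<d} \<rightarrow>\<^sub>E {a..b}. \<forall>i<d. x i \<in> {max (u i) (u' i)<..<min (v i) (v' i)}}"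
      unfolding A B by auto
    then show "A \<inter> B \<in> ?P"
      by (intro CollectI exI[of _ "\<lambda>i. max (u i) (u' i)"] exI[of _ "\<lambda>i. min (v i) (v' i)"] conjI TrueI)
  qed
  have "x i \<in> {a - 1<..<b + 1}" if "x \<in> {..<d} \<rightarrow>\<^sub>E {a..b}" "i < d" for x i
    using PiE_mem[OF that(1), of i] that(2) by simp
  then have "{..<d} \<rightarrow>\<^sub>E {a..b} = {x \<in> {..<d} \<rightarrow>\<^sub>E {a..b}. \<forall>i<d. x i \<in> {a - 1<..<b + 1}}"
    by blast
  then have top: "{..<d} \<rightarrow>\<^sub>E {a..b} \<in> ?P"
    by (intro CollectI exI[of _ "\<lambda>_. a - 1"] exI[of _ "\<lambda>_. b + 1"] conjI TrueI)
  have int: "set_integrable ?Q A g" if "A \<in> sets ?Q" for A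
    using g that by (simp add: set_integrable_def integrable_mult_indicator)
  fix A assume "A \<in> sets ?Q"
  then show "set_lebesgue_integral ?Q A g = 0"
    unfolding sets_cube_measure_boxes
  proof (induction rule: sigma_sets_induct_disjoint[OF ISt P, consumes 1, case_names basic empty compl union])
    case (basic A) then show ?case by (rule box')
  next
    case empty then show ?case by (simp add: set_lebesgue_integral_def)
  next
    case (compl A)
    then have A: "A \<in> sets ?Q" by (simp only: sets_cube_measure_boxes)
    \<comment> \<open>The whole cube is itself a box, so the integral over a complement is minus the
      integral over the set.\<close>
    have "0 = set_lebesgue_integral ?Q ((({..<d} \<rightarrow>\<^sub>E {a..b}) - A) \<union> A) g"
      using box'[OF top] sets.sets_into_space[OF A] by (simp only: Un_Diff_cancel2 Un_absorb2 space_cube_measure)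
    also have "\<dots> = set_lebesgue_integral ?Q (({..<d} \<rightarrow>\<^sub>E {a..b}) - A) g + set_lebesgue_integral ?Q A g"
      using sets.compl_sets[OF A] A by (intro set_integral_Un int) (simp_all only: space_cube_measure, blast)
    finally show ?case using compl by simp
  next
    case (union A)
    then have A: "A n \<in> sets ?Q" for n by (simp only: sets_cube_measure_boxes) blast
    have "set_lebesgue_integral ?Q (\<Union>n. A n) g = (\<Sum>n. set_lebesgue_integral ?Q (A n) g)"
    proof (rule lebesgue_integral_countable_add[OF A])
      show "A i \<inter> A j = {}" if "i \<noteq> j" for i j
        using union(1) that by (simp add: disjoint_family_on_def)
      show "set_integrable ?Q (\<Union>n. A n) g"
        using A by (intro int sets.countable_UN) blast
    qed
    then show ?case using union(3) by simp
  qed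
qed

text \<open>The product bumps lie between 0 and 1, so |g| dominates the integrands, and their
  convergence can fail only on the boundary of the cube, a null set. In the limit, testing with them
  integrates g over boxes.\<close>

theorem mixed_fundamental_lemma:
  fixes g :: "(nat \<Rightarrow> real) \<Rightarrow> complex"
  assumes g: "integrable (cube_measure a b d) g"
    and test: "\<And>\<Phi>. mixed_test_family a b d \<Phi> \<Longrightarrow> (\<integral>x. g x * \<Phi> (\<lambda>_. 0) x \<partial>cube_measure a b d) = 0"
  shows "AE x in cube_measure a b d. g x = 0"
proof (rule AE_zero_if_boxes_zero[OF g])
  fix u v :: "nat \<Rightarrow> real"
  let ?Q = "cube_measure a b d"
  define B where "B n i = bump n (max (u i) a + inverse (Suc n)) (min (v i) b - inverse (Suc n))" for n i
  have zero: "(\<integral>x. (\<Prod>i<d. of_real (B n i (x i))) * g x \<partial>?Q) = 0" for n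
  proof -
    have "\<exists>\<Phi>. \<forall>i. smooth_family (\<Phi> i) \<and> \<Phi> i 0 = (\<lambda>t. complex_of_real (B n i t))"
      unfolding B_def using smooth_bump by (intro choice) blast
    then obtain \<Phi> where \<Phi>: "\<And>i. smooth_family (\<Phi> i)" "\<And>i. \<Phi> i 0 = (\<lambda>t. complex_of_real (B n i t))"
      by blast
    have "mixed_test_family a b d (\<lambda>\<alpha> x. \<Prod>i<d. \<Phi> i (\<alpha> i) (x i))"
    proof (rule mixed_test_family_prod)
      \<comment> \<open>These bounds hold for the supports of all factors, whatever the
        \<open>u i\<close> and \<open>v i\<close> are.\<close>
      show "a < a + inverse (Suc n)" "b - inverse (Suc n) < b" by auto
      fix i t assume "\<Phi> i 0 t \<noteq> 0"
      then have "B n i t \<noteq> 0" by (simp add: \<Phi>)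
      then have "max (u i) a + inverse (Suc n) < t" "t < min (v i) b - inverse (Suc n)"
        unfolding B_def by (meson bump_eq_0 not_less)+
      then show "t \<in> {a + inverse (Suc n)..b - inverse (Suc n)}" by auto
    qed (rule \<Phi>)
    from test[OF this] show ?thesis by (simp add: \<Phi> mult.commute)
  qed
  have Bmeas: "(\<lambda>x. \<Prod>i<d. complex_of_real (B n i (x i))) \<in> borel_measurable ?Q" for n
  proof (rule borel_measurable_cube_prod)
    fix i
    obtain \<Phi> where "smooth_family \<Phi>" "\<Phi> 0 = (\<lambda>t. of_real (B n i t))"
      using smooth_bump unfolding B_def by blast
    then have "continuous_on UNIV (\<lambda>t. complex_of_real (B n i t))"
      using smooth_family_continuous[of \<Phi> UNIV 0] by simp
    then show "(\<lambda>t. complex_of_real (B n i t)) \<in> borel_measurable (interval_measure_on a b)"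
      by (intro borel_measurable_interval borel_measurable_continuous_onI)
  qed
  have "AE t in interval_measure_on a b. a < t \<and> t < b"
  proof -
    have "AE t in lborel. t \<in> {a..b} \<longrightarrow> a < t \<and> t < b"
      using AE_lborel_singleton[of a] AE_lborel_singleton[of b] by eventually_elim auto
    then show ?thesis
      unfolding interval_measure_on_def by (subst AE_restrict_space_iff) auto
  qed
  then have "AE x in ?Q. \<forall>i\<in>{..<d}. a < x i \<and> x i < b"
    by (intro AE_finite_allI) (auto intro: AE_cube_component)
  then have lim: "AE x in ?Q. (\<lambda>n. (\<Prod>i<d. of_real (B n i (x i))) * g x) \<longlonglongrightarrow>
      (\<Prod>i<d. indicator {u i<..<v i} (x i)) * g x"
  proof eventually_elim
    case (elim x)
    have "(\<lambda>n. (\<Prod>i<d. complex_of_real (B n i (x i))) * g x) \<longlonglongrightarrow>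
      (\<Prod>i<d. of_real (indicator {u i<..<v i} (x i))) * g x"
      unfolding B_def using elim by (intro tendsto_intros tendsto_bump_indicator) auto
    then show ?case by (simp add: of_real_indicator)
  qed
  have "(\<lambda>n. \<integral>x. (\<Prod>i<d. of_real (B n i (x i))) * g x \<partial>?Q) \<longlonglongrightarrow>
      (\<integral>x. (\<Prod>i<d. indicator {u i<..<v i} (x i)) * g x \<partial>?Q)"
  proof (rule integral_dominated_convergence[where w = "\<lambda>x. norm (g x)"])
    show "(\<lambda>x. (\<Prod>i<d. indicator {u i<..<v i} (x i)) * g x) \<in> borel_measurable ?Q"
      using g by (intro borel_measurable_times borel_measurable_cube_prod borel_measurable_interval) auto
    show "AE x in ?Q. norm ((\<Prod>i<d. of_real (B n i (x i))) * g x) \<le> norm (g x)" for n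
    proof (rule AE_I2)
      fix x
      have "norm (\<Prod>i<d. complex_of_real (B n i (x i))) \<le> 1"
        unfolding B_def prod_norm[symmetric]
        by (intro prod_le_1) (auto simp: bump_bounds)
      then show "norm ((\<Prod>i<d. of_real (B n i (x i))) * g x) \<le> norm (g x)"
        unfolding norm_mult by (intro mult_left_le_one_le) auto
    qed
  qed (use g Bmeas lim in auto)
  then show "(\<integral>x. (\<Prod>i<d. indicator {u i<..<v i} (x i)) * g x \<partial>?Q) = 0"
    by (simp only: zero LIMSEQ_const_iff)
qed

section \<open>Weak derivatives on an interval\<close>

lemma L2_iff: "f \<in> vecs (L2_space M) \<longleftrightarrow> f \<in> borel_measurable M \<and> integrable M (\<lambda>x. (cmod (f x))\<^sup>2)"
  by (simp add: L2_space_def)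

lemma sprod_L2: "sprod (L2_space M) f g = (\<integral>x. f x * cnj (g x) \<partial>M)"
  by (simp add: L2_space_def)

lemma L2_measurable: "f \<in> vecs (L2_space M) \<Longrightarrow> f \<in> borel_measurable M"
  by (simp add: L2_iff)

lemma L2_mult_integrable:
  assumes "f \<in> vecs (L2_space M)" "g \<in> vecs (L2_space M)"
  shows "integrable M (\<lambda>x. f x * g x)"
proof (rule Bochner_Integration.integrable_bound)
  show "integrable M (\<lambda>x. (cmod (f x))\<^sup>2 + (cmod (g x))\<^sup>2)"
    using assms by (simp add: L2_iff)
  show "(\<lambda>x. f x * g x) \<in> borel_measurable M"
    using assms by (intro borel_measurable_times L2_measurable)
  have "norm (f x * g x) \<le> norm ((cmod (f x))\<^sup>2 + (cmod (g x))\<^sup>2)" for x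
  proof -
    have "0 \<le> cmod (f x) * cmod (g x)" by simp
    then show ?thesis
      using sum_squares_bound[of "cmod (f x)" "cmod (g x)"]
      unfolding norm_mult real_norm_def by linarith
  qed
  then show "AE x in M. norm (f x * g x) \<le> norm ((cmod (f x))\<^sup>2 + (cmod (g x))\<^sup>2)" by simp
qed

lemma L2_cnj: "f \<in> vecs (L2_space M) \<Longrightarrow> (\<lambda>x. cnj (f x)) \<in> vecs (L2_space M)"
  using measurable_compose[of f M borel cnj borel]
  by (simp add: L2_iff borel_measurable_continuous_onI continuous_on_cnj continuous_on_id)

lemma L2_sprod_integrable:
  "f \<in> vecs (L2_space M) \<Longrightarrow> g \<in> vecs (L2_space M) \<Longrightarrow> integrable M (\<lambda>x. f x * cnj (g x))"
  by (rule L2_mult_integrable[OF _ L2_cnj])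

lemma L2_zero: "(\<lambda>x. 0) \<in> vecs (L2_space M)"
  by (simp add: L2_iff)

lemma L2_cmult: "f \<in> vecs (L2_space M) \<Longrightarrow> (\<lambda>x. c * f x) \<in> vecs (L2_space M)"
  by (auto simp: L2_iff norm_mult power_mult_distrib intro!: borel_measurable_times)

lemma L2_add:
  assumes "f \<in> vecs (L2_space M)" "g \<in> vecs (L2_space M)"
  shows "(\<lambda>x. f x + g x) \<in> vecs (L2_space M)"
proof -
  have "integrable M (\<lambda>x. (cmod (f x + g x))\<^sup>2)"
  proof (rule Bochner_Integration.integrable_bound)
    show "integrable M (\<lambda>x. 2 * (cmod (f x))\<^sup>2 + 2 * (cmod (g x))\<^sup>2)"
      using assms by (simp add: L2_iff)
    show "(\<lambda>x. (cmod (f x + g x))\<^sup>2) \<in> borel_measurable M"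
      using assms[THEN L2_measurable] by simp
    have "(cmod (f x + g x))\<^sup>2 \<le> 2 * (cmod (f x))\<^sup>2 + 2 * (cmod (g x))\<^sup>2" for x
    proof -
      have "(cmod (f x + g x))\<^sup>2 \<le> (cmod (f x) + cmod (g x))\<^sup>2"
        by (intro power_mono norm_triangle_ineq norm_ge_zero)
      also have "\<dots> \<le> 2 * (cmod (f x))\<^sup>2 + 2 * (cmod (g x))\<^sup>2"
        using sum_squares_bound[of "cmod (f x)" "cmod (g x)"] by (simp add: power2_sum)
      finally show ?thesis .
    qed
    then show "AE x in M. norm ((cmod (f x + g x))\<^sup>2) \<le> norm (2 * (cmod (f x))\<^sup>2 + 2 * (cmod (g x))\<^sup>2)"
      by simp
  qed
  then show ?thesis using assms[THEN L2_measurable] by (simp add: L2_iff)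
qed

lemma L2_diff:
  assumes "f \<in> vecs (L2_space M)" "g \<in> vecs (L2_space M)"
  shows "(\<lambda>x. f x - g x) \<in> vecs (L2_space M)"
  using L2_add[OF assms(1) L2_cmult[OF assms(2), of "-1"]] by simp

lemma L2_bounded:
  assumes "finite_measure M" "f \<in> borel_measurable M" "\<And>x. x \<in> space M \<Longrightarrow> cmod (f x) \<le> B"
  shows "f \<in> vecs (L2_space M)"
proof -
  interpret finite_measure M by fact
  have "(cmod (f x))\<^sup>2 \<le> B\<^sup>2" if "x \<in> space M" for x
    using assms(3)[OF that] by (intro power_mono) auto
  then have "integrable M (\<lambda>x. (cmod (f x))\<^sup>2)"
    using assms(2) by (intro integrable_const_bound[of _ "B\<^sup>2"] AE_I2) auto
  then show ?thesis using assms by (simp add: L2_iff)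
qed

lemma L2_integrable:
  assumes "finite_measure M" "f \<in> vecs (L2_space M)"
  shows "integrable M f"
  using L2_mult_integrable[OF assms(2) L2_bounded[OF assms(1), of "\<lambda>_. 1" 1]] by simp

lemma L2_interval_continuous:
  assumes "continuous_on {a..b} f"
  shows "f \<in> vecs (L2_space (interval_measure_on a b))"
proof -
  obtain B where B: "\<And>t. t \<in> {a..b} \<Longrightarrow> cmod (f t) \<le> B"
    using compact_imp_bounded[OF compact_continuous_image[OF assms compact_Icc]]
    unfolding bounded_iff by blast
  have "f \<in> borel_measurable (interval_measure_on a b)"
    using borel_measurable_continuous_on_restrict[OF assms]
    by (simp add: measurable_cong_sets[OF sets_interval_measure refl])
  then show ?thesis
    by (rule L2_bounded[OF finite_interval_measure]) (use B in simp)
qed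

text \<open>Transfers the fundamental theorem for the gauge integral to the Bochner integral over
  the restricted measure; differentiability on the whole line keeps one-sided derivatives at the end
  points out of the applications.\<close>

lemma integral_interval_FTC:
  fixes f :: "real \<Rightarrow> 'a::euclidean_space"
  assumes "a \<le> b" "\<And>t. (f has_vector_derivative f' t) (at t)" "continuous_on {a..b} f'"
  shows "(\<integral>t. f' t \<partial>interval_measure_on a b) = f b - f a"
proof -
  have "(\<integral>t. f' t \<partial>interval_measure_on a b) = set_lebesgue_integral lborel {a..b} f'"
    unfolding interval_measure_on_def set_lebesgue_integral_def
    by (rule integral_restrict_space) simp
  also have "\<dots> = integral {a..b} f'"
    by (rule set_borel_integral_eq_integral(2)[OF borel_integrable_atLeastAtMost'[OF assms(3)]])
  also have "\<dots> = f b - f a"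
    using fundamental_theorem_of_calculus[OF assms(1) has_vector_derivative_at_within[OF assms(2)]]
    by (rule integral_unique)
  finally show ?thesis .
qed

text \<open>All derivatives share the support bounds of \<open>\<Phi> 0\<close>: the complement of
  [u, v] is open, so a function vanishing there has derivative 0 at each of its points.\<close>

lemma test_family_support:
  assumes "test_family a b \<Phi>"
  obtains u v where "a < u" "v < b" "\<And>l t. \<Phi> l t \<noteq> 0 \<Longrightarrow> t \<in> {u..v}"
proof -
  obtain u v where uv: "a < u" "v < b" "\<And>t. \<Phi> 0 t \<noteq> 0 \<Longrightarrow> t \<in> {u..v}"
    and \<Phi>: "smooth_family \<Phi>"
    using assms unfolding test_family_iff by metis
  have "t \<in> {u..v}" if "\<Phi> l t \<noteq> 0" for l t
    using that
  proof (induction l arbitrary: t)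
    case 0
    then show ?case by (rule uv)
  next
    case (Suc l)
    show ?case
    proof (rule ccontr)
      assume "t \<notin> {u..v}"
      then have "eventually (\<lambda>s. s \<in> - {u..v}) (nhds t)"
        by (intro eventually_nhds_in_open open_Compl) auto
      then have "eventually (\<lambda>s. \<Phi> l s = 0) (nhds t)"
        by eventually_elim (use Suc.IH in auto)
      then have "(\<Phi> l has_vector_derivative 0) (at t)"
        by (subst has_vector_derivative_cong_ev[where g = "\<lambda>_. 0"])
           (auto elim: eventually_mono dest: eventually_nhds_x_imp_x intro: has_vector_derivative_const)
      with Suc.prems smooth_familyD[OF \<Phi>] show False
        using vector_derivative_unique_at by metis
    qed
  qed
  then show thesis using that uv(1,2) by metis
qed

text \<open>A derivative of a test function is again a test function; this is what allows weak
  derivatives to be iterated.\<close>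

lemma test_family_shift: "test_family a b \<Phi> \<Longrightarrow> test_family a b (\<lambda>j. \<Phi> (k + j))"
  by (rule test_family_support[of a b \<Phi>], assumption) (auto simp: test_family_iff smooth_family_def)

lemma smooth_family_L2: "smooth_family \<Phi> \<Longrightarrow> \<Phi> l \<in> vecs (L2_space (interval_measure_on a b))"
  by (rule L2_interval_continuous[OF smooth_family_continuous])

text \<open>Integration by parts l times. The boundary terms vanish through the test function alone,
  so F may be any smooth function, in particular a constant, a linear function or an
  exponential.\<close>

lemma has_weak_deriv_smooth_family:
  assumes "a < b" "smooth_family F"
  shows "has_weak_deriv a b l (F 0) (F l)"
  unfolding has_weak_deriv_def
proof (intro conjI allI impI smooth_family_L2 assms)
  fix \<Phi> assume test: "test_family a b \<Phi>"
  then have \<Phi>: "smooth_family \<Phi>" by (simp add: test_family_iff)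
  obtain u v where uv: "a < u" "v < b" "\<And>l t. \<Phi> l t \<noteq> 0 \<Longrightarrow> t \<in> {u..v}"
    using test_family_support[OF test] by metis
  have ends: "\<Phi> l a = 0" "\<Phi> l b = 0" for l using uv(1,2) uv(3)[of l a] uv(3)[of l b] by auto
  have step: "(\<integral>t. F k t * \<Phi> (Suc m) t \<partial>interval_measure_on a b)
      = - (\<integral>t. F (Suc k) t * \<Phi> m t \<partial>interval_measure_on a b)" for k m
  proof -
    have "(\<integral>t. F k t * \<Phi> (Suc m) t + F (Suc k) t * \<Phi> m t \<partial>interval_measure_on a b)
        = F k b * \<Phi> m b - F k a * \<Phi> m a"
      by (rule integral_interval_FTC)
         (simp_all only: assms(1) less_imp_le has_vector_derivative_mult smooth_familyD \<Phi> assms(2)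
            continuous_on_add continuous_on_mult smooth_family_continuous)
    then show ?thesis
      by (subst (asm) Bochner_Integration.integral_add)
         (auto intro!: L2_mult_integrable smooth_family_L2 assms \<Phi> simp: ends add_eq_0_iff)
  qed
  \<comment> \<open>The claim is generalised over k because each integration by parts moves one
    derivative onto F.\<close>
  have "(\<integral>t. F k t * \<Phi> l t \<partial>interval_measure_on a b)
      = (- 1) ^ l * (\<integral>t. F (k + l) t * \<Phi> 0 t \<partial>interval_measure_on a b)" for k
    by (induction l arbitrary: k) (simp_all add: step)
  from this[of 0] show "(\<integral>t. F 0 t * \<Phi> l t \<partial>interval_measure_on a b)
      = (- 1) ^ l * (\<integral>t. F l t * \<Phi> 0 t \<partial>interval_measure_on a b)" by simp
qed

text \<open>Testing f with \<open>\<Phi> (l + m)\<close> can be read as order l + m, which gives h,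
  or as order l with a test function starting at \<open>\<Phi> m\<close>, which gives g. It permits
  peeling derivatives off one at a time.\<close>

lemma has_weak_deriv_shift:
  assumes "has_weak_deriv a b l f g" "has_weak_deriv a b (l + m) f h"
  shows "has_weak_deriv a b m g h"
  unfolding has_weak_deriv_def
proof (intro conjI allI impI)
  show "h \<in> vecs (L2_space (interval_measure_on a b))"
    using assms(2) by (simp add: has_weak_deriv_def)
  fix \<Phi> assume test: "test_family a b \<Phi>"
  have "(\<integral>t. f t * \<Phi> (l + m) t \<partial>interval_measure_on a b)
      = (- 1) ^ (l + m) * (\<integral>t. h t * \<Phi> 0 t \<partial>interval_measure_on a b)"
    using assms(2) test by (simp add: has_weak_deriv_def)
  moreover have "(\<integral>t. f t * \<Phi> (l + m) t \<partial>interval_measure_on a b)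
      = (- 1) ^ l * (\<integral>t. g t * \<Phi> m t \<partial>interval_measure_on a b)"
    using assms(1) test_family_shift[OF test, of m]
    by (auto simp: has_weak_deriv_def add.commute)
  ultimately show "(\<integral>t. g t * \<Phi> m t \<partial>interval_measure_on a b)
      = (- 1) ^ m * (\<integral>t. h t * \<Phi> 0 t \<partial>interval_measure_on a b)"
    by (simp add: power_add)
qed

lemma integrable_interval_continuous:
  fixes f :: "real \<Rightarrow> 'a::euclidean_space"
  assumes "continuous_on {a..b} f"
  shows "integrable (interval_measure_on a b) f"
  using borel_integrable_atLeastAtMost'[OF assms]
  unfolding interval_measure_on_def set_integrable_def
  by (subst integrable_restrict_space) simp_all

lemma continuous_on_if_deriv:
  fixes f :: "real \<Rightarrow> real"
  assumes "\<And>t. (f has_real_derivative f' t) (at t)"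
  shows "continuous_on S f"
  by (rule DERIV_continuous_on[OF has_field_derivative_at_within[OF assms]])

text \<open>The sign of the derivative records the monotonicity that bounds the total variation of
  the bumps.\<close>

lemma flat_exp_deriv:
  obtains D where "\<And>t. (flat_exp has_real_derivative D t) (at t)" "\<And>t. D t \<ge> 0" "\<And>S. continuous_on S D"
proof
  define D where "D t = poly [:0, 0, 1:] (1 / t) * flat_exp t" for t
  show "(flat_exp has_real_derivative D t) (at t)" for t
    using flat_exp_poly_deriv[of 1 t] by (simp add: D_def)
  show "D t \<ge> 0" for t by (simp add: D_def flat_exp_def)
  show "continuous_on S D" for S
    unfolding D_def
    by (rule continuous_on_if_deriv[OF flat_exp_poly_deriv])
qed

text \<open>A bump is p q with p increasing, q decreasing and both in [0, 1], so |(p q)'| \<le> p' -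
  q', whose integral telescopes to at most 2. The bound is uniform in n, u and v.\<close>

lemma integral_bump_deriv_le:
  assumes "a \<le> b" and b': "\<And>t. (bump n u v has_real_derivative b' t) (at t)"
  shows "(\<integral>t. \<bar>b' t\<bar> \<partial>interval_measure_on a b) \<le> 2" "continuous_on S b'"
proof -
  obtain D where D: "\<And>t. (flat_exp has_real_derivative D t) (at t)" "\<And>t. D t \<ge> 0"
    "\<And>S. continuous_on S D" using flat_exp_deriv by metis
  define p where "p t = flat_exp (real n * (t - u))" for t
  define q where "q t = flat_exp (real n * (v - t))" for t
  define p' where "p' t = D (real n * (t - u)) * real n" for t
  define q' where "q' t = D (real n * (v - t)) * (- real n)" for t
  have p: "(p has_real_derivative p' t) (at t)" for t
    unfolding p_def p'_def
    by (rule DERIV_chain2[OF D(1)]) (auto intro!: derivative_eq_intros)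
  have q: "(q has_real_derivative q' t) (at t)" for t
    unfolding q_def q'_def
    by (rule DERIV_chain2[OF D(1)]) (auto intro!: derivative_eq_intros)
  have pq: "0 \<le> p t" "p t \<le> 1" "0 \<le> q t" "q t \<le> 1" for t
    by (auto simp: p_def q_def flat_exp_def)
  have contp: "continuous_on S p'" "continuous_on S q'" for S
    unfolding p'_def q'_def
    by (intro continuous_intros continuous_on_compose2[OF D(3)[of UNIV]] subset_UNIV)+
  have contpq: "continuous_on S p" "continuous_on S q" for S
    by (rule continuous_on_if_deriv[OF p], rule continuous_on_if_deriv[OF q])
  have "bump n u v = (\<lambda>t. p t * q t)"
    by (simp add: fun_eq_iff bump_def p_def q_def)
  then have "(bump n u v has_real_derivative p t * q' t + p' t * q t) (at t)" for t
    using DERIV_mult'[OF p q] by simp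
  then have b'_eq: "b' = (\<lambda>t. p t * q' t + p' t * q t)"
    using DERIV_unique[OF b'] by blast
  then show cont: "continuous_on S b'" for S
    unfolding b'_eq by (intro continuous_on_add continuous_on_mult contp contpq)
  have le: "\<bar>b' t\<bar> \<le> p' t - q' t" for t
  proof -
    have "p' t \<ge> 0" "q' t \<le> 0" by (simp_all add: p'_def q'_def D(2))
    \<comment> \<open>Nonnegative combinations of these four products equal p' - q' minus,
      respectively plus, the derivative p q' + p' q.\<close>
    then have "0 \<le> (1 - p t) * (- q' t)" "0 \<le> p t * (- q' t)" "0 \<le> p' t * q t" "0 \<le> p' t * (1 - q t)"
      using pq[of t] by (intro mult_nonneg_nonneg; simp)+
    then show ?thesis unfolding b'_eq by (simp add: algebra_simps)
  qed
  have "(\<integral>t. \<bar>b' t\<bar> \<partial>interval_measure_on a b) \<le> (\<integral>t. p' t - q' t \<partial>interval_measure_on a b)"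
    by (rule integral_mono[OF _ _ le])
       (auto intro!: integrable_interval_continuous continuous_intros cont contp)
  also have "\<dots> = (p b - q b) - (p a - q a)"
    by (rule integral_interval_FTC[OF \<open>a \<le> b\<close>])
       (auto intro!: continuous_intros contp DERIV_diff p q
             simp flip: has_real_derivative_iff_has_vector_derivative)
  also have "\<dots> \<le> 2" using pq[of a] pq[of b] by linarith
  finally show "(\<integral>t. \<bar>b' t\<bar> \<partial>interval_measure_on a b) \<le> 2" .
qed

text \<open>Smooth functions supported inside (a, b) that tend to 1 there. For small n the two end
  points may cross, and then the cutoff is 0.\<close>

definition cutoff :: "real \<Rightarrow> real \<Rightarrow> nat \<Rightarrow> real \<Rightarrow> real" where
  "cutoff a b n = bump n (a + inverse (Suc n)) (b - inverse (Suc n))"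

lemma cutoff_bounds: "0 \<le> cutoff a b n t" "cutoff a b n t \<le> 1"
  by (simp_all only: cutoff_def bump_bounds)

lemma cutoff_eq_0: "t \<notin> {a + inverse (Suc n)..b - inverse (Suc n)} \<Longrightarrow> cutoff a b n t = 0"
  unfolding cutoff_def by (rule bump_eq_0) auto

lemma smooth_cutoff:
  obtains \<Phi> where "smooth_family \<Phi>" "\<Phi> 0 = (\<lambda>t. of_real (cutoff a b n t))"
  using smooth_bump unfolding cutoff_def by blast

lemma tendsto_integral_cutoff:
  assumes F: "integrable (interval_measure_on a b) F"
  shows "(\<lambda>n. \<integral>t. F t * complex_of_real (cutoff a b n t)
           \<partial>interval_measure_on a b) \<longlonglongrightarrow> (\<integral>t. F t \<partial>interval_measure_on a b)"
proof (rule integral_dominated_convergence[where w = "\<lambda>t. norm (F t)"])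
  have "AE t in lborel. t \<in> {a..b} \<longrightarrow> a < t \<and> t < b"
    using AE_lborel_singleton[of a] AE_lborel_singleton[of b] by eventually_elim auto
  then have "AE t in interval_measure_on a b. a < t \<and> t < b"
    unfolding interval_measure_on_def by (subst AE_restrict_space_iff) auto
  then show "AE t in interval_measure_on a b.
      (\<lambda>n. F t * complex_of_real (cutoff a b n t)) \<longlonglongrightarrow> F t"
  proof eventually_elim
    case (elim t)
    have "(\<lambda>n. cutoff a b n t) \<longlonglongrightarrow> indicator {a<..<b} t"
      using tendsto_bump_indicator[of a t b a b] elim unfolding cutoff_def max.idem min.idem by blast
    then have "(\<lambda>n. F t * complex_of_real (cutoff a b n t))
        \<longlonglongrightarrow> F t * complex_of_real (indicator {a<..<b} t)"
      by (intro tendsto_intros) simp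
    then show ?case using elim by simp
  qed
  show "(\<lambda>t. F t * complex_of_real (cutoff a b n t))
      \<in> borel_measurable (interval_measure_on a b)" for n
  proof (rule borel_measurable_times[OF borel_measurable_integrable[OF F] borel_measurable_interval])
    obtain \<Phi> where "smooth_family \<Phi>"
      "\<Phi> 0 = (\<lambda>t. of_real (cutoff a b n t))"
      using smooth_cutoff .
    then show "(\<lambda>t. complex_of_real (cutoff a b n t)) \<in> borel_measurable borel"
      using smooth_family_continuous[of \<Phi> UNIV 0] by (intro borel_measurable_continuous_onI) simp
  qed
  show "AE t in interval_measure_on a b.
      norm (F t * complex_of_real (cutoff a b n t)) \<le> norm (F t)" for n
    by (rule AE_I2) (simp add: norm_mult cutoff_bounds mult_left_le)
qed (use F in auto)

text \<open>The derivatives of the cutoffs are bounded in \<open>L\<^sub>1\<close>, so \<open>F\<close> may be replaced by a uniformly close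
  polynomial, for which the integral can be computed by parts.\<close>

lemma tendsto_integral_cutoff_deriv:
  fixes F :: "real \<Rightarrow> complex"
  assumes "a < b" and F: "continuous_on {a..b} F" "F a = F b"
    and B': "\<And>n t. (cutoff a b n has_real_derivative B' n t) (at t)"
  shows "(\<lambda>n. \<integral>t. F t * complex_of_real (B' n t) \<partial>interval_measure_on a b) \<longlonglongrightarrow> 0"
proof (rule LIMSEQ_I)
  fix e :: real assume "e > 0"
  let ?I = "interval_measure_on a b"
  let ?B = "\<lambda>n t. cutoff a b n t"
  \<comment> \<open>The cutoff derivatives have L1 norm at most 2, so an error of e/8 costs e/4; the
    end values of G differ by less than another e/4, and the convergence for G takes a
    third.\<close>
  obtain G where G: "polynomial_function G" "\<And>t. t \<in> {a..b} \<Longrightarrow> norm (F t - G t) < e / 8"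
    using Stone_Weierstrass_polynomial_function[OF compact_Icc F(1), of "e / 8"] \<open>e > 0\<close> by auto
  obtain G' where G': "polynomial_function G'" "\<And>t. (G has_vector_derivative G' t) (at t)"
    using has_vector_derivative_polynomial_function[OF G(1)] by metis
  have contG: "continuous_on S G" "continuous_on S G'" for S
    using G(1) G'(1) by (auto intro: continuous_on_polymonial_function)
  have contB: "continuous_on S (B' n)" for S n
    using integral_bump_deriv_le(2)[OF less_imp_le[OF \<open>a < b\<close>] B'[unfolded cutoff_def]] .
  have contB0: "continuous_on S (?B n)" for S n
    by (rule continuous_on_if_deriv[OF B'])
  have int_B: "integrable ?I (\<lambda>t. H t * complex_of_real (B' n t))"
    "integrable ?I (\<lambda>t. H t * complex_of_real (?B n t))" if "continuous_on {a..b} H" for H n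
    by (intro integrable_interval_continuous continuous_intros that contB contB0)+
  have B0: "?B n a = 0" "?B n b = 0" for n
    by (auto intro!: cutoff_eq_0)
  have parts: "(\<integral>t. G t * complex_of_real (B' n t) \<partial>?I) = - (\<integral>t. G' t * complex_of_real (?B n t) \<partial>?I)" for n
  proof -
    have "(\<integral>t. G t * complex_of_real (B' n t) + G' t * complex_of_real (?B n t) \<partial>?I)
       = G b * complex_of_real (?B n b) - G a * complex_of_real (?B n a)"
    proof (rule integral_interval_FTC)
      show "((\<lambda>t. G t * complex_of_real (?B n t)) has_vector_derivative
          G t * complex_of_real (B' n t) + G' t * complex_of_real (?B n t)) (at t)" for t
        by (intro has_vector_derivative_mult G' has_vector_derivative_of_real B')
    qed (intro less_imp_le \<open>a < b\<close> continuous_intros contG contB contB0)+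
    then show ?thesis
      using int_B[OF contG(1)] int_B[OF contG(2)] by (simp add: B0 add_eq_0_iff)
  qed
  have close: "norm (\<integral>t. (F t - G t) * complex_of_real (B' n t) \<partial>?I) \<le> e / 4" for n
  proof -
    have "norm (\<integral>t. (F t - G t) * complex_of_real (B' n t) \<partial>?I)
        \<le> (\<integral>t. e / 8 * \<bar>B' n t\<bar> \<partial>?I)"
    proof (rule order_trans[OF integral_norm_bound integral_mono])
      show "integrable ?I (\<lambda>t. norm ((F t - G t) * complex_of_real (B' n t)))"
        by (intro integrable_interval_continuous continuous_intros F contG contB)
      show "integrable ?I (\<lambda>t. e / 8 * \<bar>B' n t\<bar>)"
        by (intro integrable_interval_continuous continuous_intros contB)
      show "norm ((F t - G t) * complex_of_real (B' n t)) \<le> e / 8 * \<bar>B' n t\<bar>" if "t \<in> space ?I" for t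
        unfolding norm_mult norm_of_real using G(2)[of t] that by (intro mult_right_mono) auto
    qed
    also have "\<dots> \<le> e / 8 * 2"
      using integral_bump_deriv_le(1)[OF less_imp_le[OF \<open>a < b\<close>] B'[unfolded cutoff_def], of n] \<open>e > 0\<close>
      by (simp add: mult_left_mono)
    finally show ?thesis by simp
  qed
  have "(\<lambda>n. - (\<integral>t. G' t * complex_of_real (?B n t) \<partial>?I)) \<longlonglongrightarrow> - (\<integral>t. G' t \<partial>?I)"
    by (intro tendsto_minus tendsto_integral_cutoff integrable_interval_continuous contG)
  moreover have "(\<integral>t. G' t \<partial>?I) = G b - G a"
    using \<open>a < b\<close> by (intro integral_interval_FTC G' contG) auto
  ultimately have lim: "(\<lambda>n. \<integral>t. G t * complex_of_real (B' n t) \<partial>?I) \<longlonglongrightarrow> G a - G b"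
    by (simp add: parts)
  \<comment> \<open>Here F a = F b enters: the limit G a - G b for the polynomial is small only
    because the end values of F agree.\<close>
  have ab: "norm (G a - G b) < e / 4"
  proof -
    have "G a - G b = (F b - G b) - (F a - G a)" using F(2) by simp
    then have "norm (G a - G b) \<le> norm (F b - G b) + norm (F a - G a)"
      using norm_triangle_ineq4[of "F b - G b" "F a - G a"] by simp
    then show ?thesis using G(2)[of a] G(2)[of b] \<open>a < b\<close> by simp
  qed
  obtain N where N: "\<And>n. n \<ge> N \<Longrightarrow> norm ((\<integral>t. G t * complex_of_real (B' n t) \<partial>?I) - (G a - G b)) < e / 4"
    using LIMSEQ_D[OF lim, of "e / 4"] \<open>e > 0\<close> by auto
  have "norm ((\<integral>t. F t * complex_of_real (B' n t) \<partial>?I) - 0) < e" if "n \<ge> N" for n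
  proof -
    have split: "(\<integral>t. F t * complex_of_real (B' n t) \<partial>?I) =
        (\<integral>t. (F t - G t) * complex_of_real (B' n t) \<partial>?I) + (\<integral>t. G t * complex_of_real (B' n t) \<partial>?I)"
      using int_B[OF contG(1)] int_B[OF F(1)] by (simp add: left_diff_distrib)
    show ?thesis
      unfolding diff_zero split
      using close[of n] N[OF that] ab
        norm_triangle_ineq[of "\<integral>t. (F t - G t) * complex_of_real (B' n t) \<partial>?I" "\<integral>t. G t * complex_of_real (B' n t) \<partial>?I"]
        norm_triangle_ineq2[of "\<integral>t. G t * complex_of_real (B' n t) \<partial>?I" "G a - G b"] \<open>e > 0\<close>
      by linarith
  qed
  then show "\<exists>N. \<forall>n\<ge>N. norm ((\<integral>t. F t * complex_of_real (B' n t) \<partial>?I) - 0) < e" by blast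
qed

text \<open>E need not vanish at the end points, so it is multiplied by a cutoff before testing. The
  product rule leaves the extra integral of g E times the derivative of the cutoff, which tends to 0
  because g E takes equal values at a and b.\<close>

lemma periodic_integration_by_parts:
  assumes "a < b" and g: "continuous_on {a..b} g" "g a = g b" and h: "has_weak_deriv a b 1 g h"
    and E: "smooth_family E" "E 0 a = E 0 b"
  shows "(\<integral>t. h t * E 0 t \<partial>interval_measure_on a b) = - (\<integral>t. g t * E 1 t \<partial>interval_measure_on a b)"
proof -
  let ?I = "interval_measure_on a b"
  let ?B = "\<lambda>n t. cutoff a b n t"
  have "\<exists>D. \<forall>t. (?B n has_real_derivative D t) (at t)" for n
  proof -
    obtain \<Phi> where \<Phi>: "smooth_family \<Phi>" "\<Phi> 0 = (\<lambda>t. of_real (?B n t))"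
      using smooth_cutoff .
    have "(?B n has_real_derivative Re (\<Phi> 1 t)) (at t)" for t
      using bounded_linear.has_vector_derivative[OF bounded_linear_Re smooth_familyD[OF \<Phi>(1), of 0 t]]
      by (simp add: \<Phi>(2) has_real_derivative_iff_has_vector_derivative)
    then show ?thesis by (intro exI[of _ "\<lambda>t. Re (\<Phi> 1 t)"] allI)
  qed
  then obtain B' where B': "\<And>n t. (?B n has_real_derivative B' n t) (at t)" by metis
  have contB: "continuous_on S (B' n)" for S n
    using integral_bump_deriv_le(2)[OF less_imp_le[OF \<open>a < b\<close>] B'[unfolded cutoff_def]] .
  have contB0: "continuous_on S (?B n)" for S n
    by (rule continuous_on_if_deriv[OF B'])
  have contE: "continuous_on S (E l)" for S l by (rule smooth_family_continuous[OF E(1)])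
  have eq: "(\<integral>t. g t * E 1 t * of_real (?B n t) \<partial>?I) + (\<integral>t. g t * E 0 t * of_real (B' n t) \<partial>?I)
      = - (\<integral>t. h t * E 0 t * of_real (?B n t) \<partial>?I)" for n
  proof -
    obtain \<Phi> where \<Phi>: "smooth_family \<Phi>" "\<Phi> 0 = (\<lambda>t. of_real (?B n t))"
      using smooth_cutoff .
    obtain \<Theta> where \<Theta>: "smooth_family \<Theta>" "\<Theta> 0 = (\<lambda>t. E 0 t * \<Phi> 0 t)"
      using smooth_family_mult[OF E(1) \<Phi>(1)] by blast
    have test: "test_family a b \<Theta>"
      unfolding test_family_iff
    proof (intro conjI exI allI impI \<Theta>(1))
      fix t assume "\<Theta> 0 t \<noteq> 0"
      then have "?B n t \<noteq> 0" by (simp add: \<Theta> \<Phi>)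
      then show "t \<in> {a + inverse (Suc n)..b - inverse (Suc n)}"
        using cutoff_eq_0 by blast
    qed auto
    \<comment> \<open>\<open>\<Theta>\<close> comes without a formula for its derivatives, so
      \<open>\<Theta> 1\<close> is identified by uniqueness of the derivative.\<close>
    have "\<Theta> 1 t = E 1 t * of_real (?B n t) + E 0 t * of_real (B' n t)" for t
    proof (rule vector_derivative_unique_at)
      show "(\<Theta> 0 has_vector_derivative \<Theta> 1 t) (at t)" using smooth_familyD[OF \<Theta>(1), of 0 t] by simp
      have "(E 0 has_vector_derivative E 1 t) (at t)" using smooth_familyD[OF E(1), of 0 t] by simp
      from has_vector_derivative_mult[OF this has_vector_derivative_of_real[OF B'[of n t]]]
      show "(\<Theta> 0 has_vector_derivative E 1 t * of_real (?B n t) + E 0 t * of_real (B' n t)) (at t)"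
        by (simp add: \<Theta>(2) \<Phi>(2) add.commute)
    qed
    moreover have "(\<integral>t. g t * \<Theta> 1 t \<partial>?I) = - (\<integral>t. h t * \<Theta> 0 t \<partial>?I)"
      using h test by (simp add: has_weak_deriv_def)
    ultimately have "(\<integral>t. g t * E 1 t * of_real (?B n t) + g t * E 0 t * of_real (B' n t) \<partial>?I)
        = - (\<integral>t. h t * E 0 t * of_real (?B n t) \<partial>?I)"
      by (simp add: \<Theta>(2) \<Phi>(2) algebra_simps)
    moreover have "integrable ?I (\<lambda>t. g t * E 1 t * of_real (?B n t))"
      "integrable ?I (\<lambda>t. g t * E 0 t * of_real (B' n t))"
      by (intro integrable_interval_continuous continuous_intros g contE contB contB0)+
    ultimately show ?thesis by simp
  qed
  have "h \<in> vecs (L2_space ?I)" using h by (simp add: has_weak_deriv_def)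
  then have "integrable ?I (\<lambda>t. h t * E 0 t)"
    by (rule L2_mult_integrable[OF _ smooth_family_L2[OF E(1)]])
  from tendsto_minus[OF tendsto_integral_cutoff[OF this]]
  have lim1: "(\<lambda>n. - (\<integral>t. h t * E 0 t * of_real (?B n t) \<partial>?I)) \<longlonglongrightarrow> - (\<integral>t. h t * E 0 t \<partial>?I)" .
  have "(\<lambda>n. (\<integral>t. g t * E 1 t * of_real (?B n t) \<partial>?I) + (\<integral>t. g t * E 0 t * of_real (B' n t) \<partial>?I))
      \<longlonglongrightarrow> (\<integral>t. g t * E 1 t \<partial>?I) + 0"
    by (intro tendsto_add tendsto_integral_cutoff tendsto_integral_cutoff_deriv[OF \<open>a < b\<close> _ _ B']
          integrable_interval_continuous continuous_intros g contE)
       (simp add: g(2) E(2))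
  then have "(\<lambda>n. - (\<integral>t. h t * E 0 t * of_real (?B n t) \<partial>?I)) \<longlonglongrightarrow> (\<integral>t. g t * E 1 t \<partial>?I)"
    unfolding eq add_0_right .
  from LIMSEQ_unique[OF lim1 this] show ?thesis by (metis minus_minus)
qed

text \<open>The case d = 1 of the cube version, transported along the projection x \<mapsto> x 0,
  which maps the one-dimensional cube measure to the interval measure.\<close>

theorem interval_fundamental_lemma:
  fixes g :: "real \<Rightarrow> complex"
  assumes g: "integrable (interval_measure_on a b) g"
    and test: "\<And>\<Phi>. test_family a b \<Phi> \<Longrightarrow> (\<integral>t. g t * \<Phi> 0 t \<partial>interval_measure_on a b) = 0"
  shows "AE t in interval_measure_on a b. g t = 0"
proof -
  let ?I = "interval_measure_on a b" and ?Q = "cube_measure a b 1"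
  have Q: "?Q = PiM {0} (\<lambda>_. ?I)" by (simp add: cube_measure_def lessThan_Suc)
  have distr: "distr ?Q ?I (\<lambda>x. x 0) = ?I"
    unfolding Q by (rule intervals.distr_singleton)
  have comp [measurable]: "(\<lambda>x. x 0) \<in> measurable ?Q ?I" by (rule measurable_cube_component) simp
  have "AE x in ?Q. g (x 0) = 0"
  proof (rule mixed_fundamental_lemma)
    show "integrable ?Q (\<lambda>x. g (x 0))"
      using integrable_distr[OF comp, of g, unfolded distr, OF g] .
    fix \<Phi> assume \<Phi>: "mixed_test_family a b 1 \<Phi>"
    \<comment> \<open>\<open>p t\<close> is the point of the one-dimensional cube with coordinate t,
      \<open>undefined\<close> elsewhere as in the extensional function space;
      \<open>\<beta> l\<close> is the multi-index of order l padded with zeros.\<close>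
    define p where "p t = (\<lambda>i::nat. if i = 0 then t else undefined)" for t :: real
    define \<beta> where "\<beta> l = (\<lambda>i::nat. if i = 0 then l else 0)" for l :: nat
    have p: "p t \<in> {..<1} \<rightarrow>\<^sub>E UNIV" for t by (rule PiE_I) (simp_all add: p_def)
    have upd: "(p t)(0 := s) = p s" "(\<beta> l)(0 := m) = \<beta> m" "p t 0 = t" "\<beta> l 0 = l" "\<beta> 0 = (\<lambda>_. 0)"
      for t s l m by (auto simp: p_def \<beta>_def)
    have "smooth_family (\<lambda>l t. \<Phi> (\<beta> l) (p t))"
      unfolding smooth_family_def
    proof (intro allI)
      fix l t
      have "((\<lambda>s. \<Phi> (\<beta> l) ((p t)(0 := s))) has_vector_derivative \<Phi> ((\<beta> l)(0 := Suc (\<beta> l 0))) (p t)) (at (p t 0))"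
        using \<Phi> p[of t] unfolding mixed_test_family_def by blast
      then show "((\<lambda>t. \<Phi> (\<beta> l) (p t)) has_vector_derivative \<Phi> (\<beta> (Suc l)) (p t)) (at t)"
        by (simp only: upd)
    qed
    moreover obtain u v where "a < u" "v < b"
      "\<And>x. x \<in> {..<1} \<rightarrow>\<^sub>E UNIV \<Longrightarrow> \<Phi> (\<lambda>_. 0) x \<noteq> 0 \<Longrightarrow> \<forall>i<1. x i \<in> {u..v}"
      using \<Phi> unfolding mixed_test_family_def by metis
    ultimately have test': "test_family a b (\<lambda>l t. \<Phi> (\<beta> l) (p t))"
      unfolding test_family_iff using p upd(3,5) by (metis less_one)
    have "(\<integral>x. g (x 0) * \<Phi> (\<lambda>_. 0) x \<partial>?Q) = (\<integral>x. (\<lambda>t. g t * \<Phi> (\<lambda>_. 0) (p t)) (x 0) \<partial>?Q)"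
    proof (rule Bochner_Integration.integral_cong[OF refl])
      fix x assume "x \<in> space ?Q"
      then have "x \<in> {..<1} \<rightarrow>\<^sub>E {a..b}" by (simp only: space_cube_measure)
      then have "x i = p (x 0) i" for i
        using PiE_arb[of x "{..<1}" "\<lambda>_. {a..b}" i] by (cases "i = 0") (simp_all add: p_def)
      then have "x = p (x 0)" by (rule ext)
      then show "g (x 0) * \<Phi> (\<lambda>_. 0) x = (\<lambda>t. g t * \<Phi> (\<lambda>_. 0) (p t)) (x 0)" by simp
    qed
    also have "\<dots> = (\<integral>t. g t * \<Phi> (\<lambda>_. 0) (p t) \<partial>distr ?Q ?I (\<lambda>x. x 0))"
    proof (rule integral_distr[symmetric, OF comp])
      have "(\<lambda>t. \<Phi> (\<beta> 0) (p t)) \<in> borel_measurable ?I"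
        using smooth_family_L2[of "\<lambda>l t. \<Phi> (\<beta> l) (p t)" 0 a b] test'
        by (intro L2_measurable) (simp add: test_family_iff)
      then show "(\<lambda>t. g t * \<Phi> (\<lambda>_. 0) (p t)) \<in> borel_measurable ?I"
        using g by (simp add: upd(5))
    qed
    also have "\<dots> = 0" using test[OF test'] by (simp only: distr upd(5))
    finally show "(\<integral>x. g (x 0) * \<Phi> (\<lambda>_. 0) x \<partial>?Q) = 0" .
  qed
  moreover have "{t \<in> space ?I. g t = 0} \<in> sets ?I"
    using borel_measurable_integrable[OF g] by measurable
  ultimately have "AE t in distr ?Q ?I (\<lambda>x. x 0). g t = 0"
    by (simp only: AE_distr_iff[OF comp])
  then show ?thesis by (simp only: distr)
qed

text \<open>Order 0 is how the boundary condition names a continuous representative of f; this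
  identifies that representative with f.\<close>

lemma has_weak_deriv_0_AE:
  assumes f: "f \<in> vecs (L2_space (interval_measure_on a b))" and g: "has_weak_deriv a b 0 f g"
  shows "AE t in interval_measure_on a b. f t = g t"
proof -
  have "AE t in interval_measure_on a b. f t - g t = 0"
  proof (rule interval_fundamental_lemma)
    have g': "g \<in> vecs (L2_space (interval_measure_on a b))"
      using g by (simp add: has_weak_deriv_def)
    show "integrable (interval_measure_on a b) (\<lambda>t. f t - g t)"
      by (intro L2_integrable[OF finite_interval_measure] L2_diff f g')
    fix \<Phi> assume \<Phi>: "test_family a b \<Phi>"
    then have \<Phi>0: "\<Phi> 0 \<in> vecs (L2_space (interval_measure_on a b))"
      by (intro smooth_family_L2) (simp add: test_family_iff)
    show "(\<integral>t. (f t - g t) * \<Phi> 0 t \<partial>interval_measure_on a b) = 0"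
      using g \<Phi> L2_mult_integrable[OF f \<Phi>0] L2_mult_integrable[OF g' \<Phi>0]
      by (simp add: has_weak_deriv_def left_diff_distrib)
  qed
  then show ?thesis by simp
qed

section \<open>Mixed weak derivatives\<close>

lemma L2_cube_vecs: "vecs (L2_cube a b d) = vecs (L2_space (cube_measure a b d))"
  by (simp add: L2_cube_def)

lemma L2_cube_prod:
  assumes "\<And>i. i < d \<Longrightarrow> u i \<in> vecs (L2_space (interval_measure_on a b))"
  shows "(\<lambda>x. \<Prod>i<d. u i (x i)) \<in> vecs (L2_cube a b d)"
proof -
  have "integrable (PiM {..<d} (\<lambda>_. interval_measure_on a b)) (\<lambda>x. \<Prod>i<d. (cmod (u i (x i)))\<^sup>2)"
    using assms by (intro intervals.product_integrable_prod) (simp_all add: L2_iff)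
  moreover have "(cmod (\<Prod>i<d. u i (x i)))\<^sup>2 = (\<Prod>i<d. (cmod (u i (x i)))\<^sup>2)" for x
    by (simp only: prod_norm[symmetric] prod_power_distrib)
  ultimately show ?thesis
    unfolding L2_cube_vecs L2_iff
    using borel_measurable_cube_prod[OF L2_measurable[OF assms]]
    by (simp only: cube_measure_def simp_thms)
qed

lemma sprod_L2_cube_prod:
  assumes "\<And>i. i < d \<Longrightarrow> u i \<in> vecs (L2_space (interval_measure_on a b))"
    and "\<And>i. i < d \<Longrightarrow> v i \<in> vecs (L2_space (interval_measure_on a b))"
  shows "sprod (L2_cube a b d) (\<lambda>x. \<Prod>i<d. u i (x i)) (\<lambda>x. \<Prod>i<d. v i (x i)) =
    (\<Prod>i<d. sprod (L2_space (interval_measure_on a b)) (u i) (v i))"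
proof -
  have "sprod (L2_cube a b d) (\<lambda>x. \<Prod>i<d. u i (x i)) (\<lambda>x. \<Prod>i<d. v i (x i)) =
      (\<integral>x. (\<Prod>i<d. u i (x i) * cnj (v i (x i))) \<partial>PiM {..<d} (\<lambda>_. interval_measure_on a b))"
    by (simp add: L2_cube_def sprod_L2 cube_measure_def prod.distrib)
  also have "\<dots> = (\<Prod>i<d. \<integral>t. u i t * cnj (v i t) \<partial>interval_measure_on a b)"
    using assms by (intro intervals.product_integral_prod L2_sprod_integrable) simp_all
  finally show ?thesis by (simp add: sprod_L2)
qed

text \<open>Tychonoff's theorem, after the extensional cube is read as a product over all natural
  numbers with the singleton of \<open>undefined\<close> in the coordinates from d on.\<close>

lemma compact_cube: "compact ({..<d} \<rightarrow>\<^sub>E {a..b} :: (nat \<Rightarrow> real) set)"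
proof -
  have "{..<d} \<rightarrow>\<^sub>E {a..b} = Pi\<^sub>E UNIV (\<lambda>i::nat. if i < d then {a..b} else {undefined})"
    by (auto simp: PiE_def Pi_def extensional_def)
  moreover have "compactin (product_topology (\<lambda>_. euclidean) UNIV)
      (Pi\<^sub>E UNIV (\<lambda>i::nat. if i < d then {a..b} else {undefined}))"
    by (simp add: compactin_PiE)
  ultimately show ?thesis
    by (simp add: euclidean_product_topology)
qed

lemma mixed_test_family_L2:
  assumes "mixed_test_family a b d \<Phi>"
  shows "\<Phi> \<alpha> \<in> vecs (L2_cube a b d)"
proof -
  have cont: "continuous_on ({..<d} \<rightarrow>\<^sub>E UNIV) (\<Phi> \<alpha>)"
    using assms by (simp add: mixed_test_family_def)
  have sub: "{..<d} \<rightarrow>\<^sub>E {a..b} \<subseteq> {..<d} \<rightarrow>\<^sub>E UNIV" by (rule PiE_mono) simp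
  obtain B where B: "\<And>x. x \<in> {..<d} \<rightarrow>\<^sub>E {a..b} \<Longrightarrow> cmod (\<Phi> \<alpha> x) \<le> B"
    using compact_imp_bounded[OF compact_continuous_image[OF continuous_on_subset[OF cont sub] compact_cube]]
    unfolding bounded_iff by blast
  \<comment> \<open>Continuity of \<open>\<Phi> \<alpha>\<close> refers to the product topology,
    whose Borel sets must be measurable for the cube measure; with countably many coordinates it is
    enough to check each of them.\<close>
  have "(\<lambda>x. x) \<in> measurable (cube_measure a b d) borel"
  proof (rule measurable_coordinatewise_then_product)
    fix i
    show "(\<lambda>x. x i) \<in> borel_measurable (cube_measure a b d)"
    proof (cases "i < d")
      case True
      have "(\<lambda>t. t) \<in> borel_measurable (interval_measure_on a b)"
        by (rule borel_measurable_interval) simp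
      from measurable_compose[OF measurable_cube_component[OF True] this] show ?thesis .
    next
      case False
      then have "x i = undefined" if "x \<in> space (cube_measure a b d)" for x
        using that PiE_arb[of x "{..<d}" "\<lambda>_. {a..b}" i] by simp
      then show ?thesis by (subst measurable_cong[of _ _ "\<lambda>_. undefined"]) simp_all
    qed
  qed
  then have "(\<lambda>x. x) \<in> measurable (cube_measure a b d) (restrict_space borel ({..<d} \<rightarrow>\<^sub>E UNIV))"
    by (rule measurable_restrict_space2[rotated]) (use sub in auto)
  from measurable_compose[OF this borel_measurable_continuous_on_restrict[OF cont]]
  have "\<Phi> \<alpha> \<in> borel_measurable (cube_measure a b d)" .
  then show ?thesis
    unfolding L2_cube_vecs by (rule L2_bounded[OF cube.finite_measure_axioms]) (use B in simp)
qed

text \<open>Induction on the order: a nonzero multi-index vanishing from d on arises from a smaller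
  one by a derivative in some coordinate i < d, and near a point outside the support cube the lower
  derivative is 0 along that direction.\<close>

lemma mixed_test_family_support:
  assumes \<Phi>: "mixed_test_family a b d \<Phi>"
  obtains u v where "a < u" "v < b"
    "\<And>\<alpha> x i. \<lbrakk>\<forall>i\<ge>d. \<alpha> i = 0; x \<in> {..<d} \<rightarrow>\<^sub>E UNIV; \<Phi> \<alpha> x \<noteq> 0; i < d\<rbrakk> \<Longrightarrow> x i \<in> {u..v}"
proof -
  obtain u v where uv: "a < u" "v < b"
    "\<And>x i. \<lbrakk>x \<in> {..<d} \<rightarrow>\<^sub>E UNIV; \<Phi> (\<lambda>_. 0) x \<noteq> 0; i < d\<rbrakk> \<Longrightarrow> x i \<in> {u..v}"
    using \<Phi> unfolding mixed_test_family_def by metis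
  have "\<Phi> \<alpha> x = 0" if "\<forall>i\<ge>d. \<alpha> i = 0" "x \<in> {..<d} \<rightarrow>\<^sub>E UNIV" "j < d" "x j \<notin> {u..v}" for \<alpha> x j
    using that
  proof (induction "\<Sum>i<d. \<alpha> i" arbitrary: \<alpha> x j rule: less_induct)
    case less
    show ?case
    proof (cases "\<exists>i<d. \<alpha> i \<noteq> 0")
      case False
      then have "\<alpha> i = 0" for i using less.prems(1) by (cases "i < d") auto
      then have "\<alpha> = (\<lambda>_. 0)" by (rule ext)
      then show ?thesis using uv(3) less.prems by blast
    next
      case True
      then obtain i where i: "i < d" "\<alpha> i \<noteq> 0" by blast
      define \<beta> where "\<beta> = \<alpha>(i := \<alpha> i - 1)"
      have \<alpha>: "\<beta>(i := Suc (\<beta> i)) = \<alpha>" using i by (simp add: \<beta>_def)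
      have "(\<Sum>k<d. \<beta> k) < (\<Sum>k<d. \<alpha> k)"
        by (rule sum_strict_mono_ex1) (use i in \<open>auto simp: \<beta>_def intro!: bexI[of _ i]\<close>)
      moreover have "\<forall>i\<ge>d. \<beta> i = 0" using less.prems(1) i by (auto simp: \<beta>_def)
      ultimately have IH: "\<Phi> \<beta> y = 0" if "y \<in> {..<d} \<rightarrow>\<^sub>E UNIV" "j < d" "y j \<notin> {u..v}" for y j
        using less.hyps that by blast
      \<comment> \<open>If the violating coordinate j is the one that moves, it must stay off
        [u, v]; if another one moves, t is free.\<close>
      define S where "S = (if j = i then - {u..v} else UNIV)"
      have zero: "\<Phi> \<beta> (x(i := t)) = 0" if "t \<in> S" for t
      proof (rule IH[OF _ less.prems(3)])
        show "x(i := t) \<in> {..<d} \<rightarrow>\<^sub>E UNIV"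
          using less.prems(2) i(1) by (auto simp: PiE_def extensional_def)
        show "(x(i := t)) j \<notin> {u..v}" using that less.prems(4) by (auto simp: S_def)
      qed
      have "((\<lambda>t. \<Phi> \<beta> (x(i := t))) has_vector_derivative \<Phi> (\<beta>(i := Suc (\<beta> i))) x) (at (x i))"
        using \<Phi> less.prems(2) i(1) unfolding mixed_test_family_def by blast
      then have der: "((\<lambda>t. \<Phi> \<beta> (x(i := t))) has_vector_derivative \<Phi> \<alpha> x) (at (x i))"
        by (simp only: \<alpha>)
      have "((\<lambda>t. \<Phi> \<beta> (x(i := t))) has_vector_derivative 0) (at (x i))"
      proof (rule has_vector_derivative_transform_within_open[OF has_vector_derivative_const])
        show "open S" by (auto simp: S_def)
        show "x i \<in> S" using less.prems(4) by (auto simp: S_def)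
      qed (simp add: zero)
      from vector_derivative_unique_at[OF der this] show ?thesis .
    qed
  qed
  then show thesis using that[OF uv(1,2)] by blast
qed

text \<open>Freezing all coordinates except i leaves a test function in one variable, against which
  a one-dimensional weak derivative can be tested under Fubini's integral.\<close>

lemma mixed_test_family_slice:
  assumes \<Phi>: "mixed_test_family a b d \<Phi>" and i: "i < d" and \<alpha>: "\<forall>i\<ge>d. \<alpha> i = 0"
    and x: "x \<in> ({..<d} - {i}) \<rightarrow>\<^sub>E UNIV"
  shows "test_family a b (\<lambda>l t. \<Phi> (\<alpha>(i := l)) (x(i := t)))"
proof -
  have mem: "x(i := t) \<in> {..<d} \<rightarrow>\<^sub>E UNIV" for t
    using x i by (auto simp: PiE_def extensional_def)
  obtain u v where uv: "a < u" "v < b"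
    "\<And>\<alpha> x i. \<lbrakk>\<forall>i\<ge>d. \<alpha> i = 0; x \<in> {..<d} \<rightarrow>\<^sub>E UNIV; \<Phi> \<alpha> x \<noteq> 0; i < d\<rbrakk> \<Longrightarrow> x i \<in> {u..v}"
    using mixed_test_family_support[OF \<Phi>] by metis
  have "smooth_family (\<lambda>l t. \<Phi> (\<alpha>(i := l)) (x(i := t)))"
    unfolding smooth_family_def
  proof (intro allI)
    fix l t
    have "((\<lambda>s. \<Phi> (\<alpha>(i := l)) ((x(i := t))(i := s))) has_vector_derivative
        \<Phi> ((\<alpha>(i := l))(i := Suc ((\<alpha>(i := l)) i))) (x(i := t))) (at ((x(i := t)) i))"
      using \<Phi> mem[of t] i unfolding mixed_test_family_def by blast
    then show "((\<lambda>t. \<Phi> (\<alpha>(i := l)) (x(i := t))) has_vector_derivative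
        \<Phi> (\<alpha>(i := Suc l)) (x(i := t))) (at t)" by simp
  qed
  moreover have "t \<in> {u..v}" if "\<Phi> (\<alpha>(i := 0)) (x(i := t)) \<noteq> 0" for t
    using uv(3)[OF _ mem that i] \<alpha> i by simp
  ultimately show ?thesis
    unfolding test_family_iff using uv(1,2) by blast
qed

lemma integral_cube_Fubini:
  fixes f :: "(nat \<Rightarrow> real) \<Rightarrow> complex"
  assumes "i < d" "integrable (cube_measure a b d) f"
  shows "(\<integral>x. f x \<partial>cube_measure a b d) = (\<integral>x. (\<integral>t. f (x(i := t)) \<partial>interval_measure_on a b)
    \<partial>PiM ({..<d} - {i}) (\<lambda>_. interval_measure_on a b))"
proof -
  have "insert i ({..<d} - {i}) = {..<d}" using assms(1) by auto
  then show ?thesis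
    using intervals.product_integral_insert[of "{..<d} - {i}" i a b f] assms(2)
    by (simp add: cube_measure_def)
qed

text \<open>One coordinate is integrated by parts: Fubini isolates coordinate i, where the
  definition of the weak derivative of \<open>u i\<close> trades the \<alpha> i derivatives of the
  test function for g and a sign.\<close>

lemma integral_prod_test_step:
  assumes \<Phi>: "mixed_test_family a b d \<Phi>" and i: "i < d" and \<alpha>: "\<forall>i\<ge>d. \<alpha> i = 0"
    and u: "\<And>j. j < d \<Longrightarrow> u j \<in> vecs (L2_space (interval_measure_on a b))"
    and g: "has_weak_deriv a b (\<alpha> i) (u i) g"
  shows "(\<integral>x. (\<Prod>j<d. u j (x j)) * \<Phi> \<alpha> x \<partial>cube_measure a b d) =
    (-1) ^ \<alpha> i * (\<integral>x. (\<Prod>j<d. (u(i := g)) j (x j)) * \<Phi> (\<alpha>(i := 0)) x \<partial>cube_measure a b d)"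
proof -
  let ?I = "interval_measure_on a b" and ?J = "{..<d} - {i}"
  have g2: "g \<in> vecs (L2_space ?I)" using g by (simp add: has_weak_deriv_def)
  have prod: "(\<Prod>j<d. w j ((x(i := t)) j)) = w i t * (\<Prod>j\<in>?J. w j (x j))"
    for w :: "nat \<Rightarrow> real \<Rightarrow> complex" and x t
    using i prod.remove[of "{..<d}" i "\<lambda>j. w j ((x(i := t)) j)"] by simp
  have prod': "(\<Prod>j\<in>?J. (u(i := g)) j (x j)) = (\<Prod>j\<in>?J. u j (x j))" for x
    by (rule prod.cong) simp_all
  have int: "integrable (cube_measure a b d) (\<lambda>x. (\<Prod>j<d. w j (x j)) * \<Phi> \<beta> x)"
    if "\<And>j. j < d \<Longrightarrow> w j \<in> vecs (L2_space ?I)" for w \<beta>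
    using L2_cube_prod[OF that] mixed_test_family_L2[OF \<Phi>]
    unfolding L2_cube_vecs by (rule L2_mult_integrable)
  have "(\<integral>x. (\<Prod>j<d. u j (x j)) * \<Phi> \<alpha> x \<partial>cube_measure a b d) =
      (\<integral>x. (\<integral>t. (\<Prod>j<d. u j ((x(i := t)) j)) * \<Phi> \<alpha> (x(i := t)) \<partial>?I) \<partial>PiM ?J (\<lambda>_. ?I))"
    by (rule integral_cube_Fubini[OF i int[OF u]])
  also have "\<dots> = (\<integral>x. (-1) ^ \<alpha> i * (\<integral>t. (\<Prod>j<d. (u(i := g)) j ((x(i := t)) j)) * \<Phi> (\<alpha>(i := 0)) (x(i := t)) \<partial>?I)
      \<partial>PiM ?J (\<lambda>_. ?I))"
  proof (rule Bochner_Integration.integral_cong[OF refl])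
    fix x assume "x \<in> space (PiM ?J (\<lambda>_. ?I))"
    then have "x \<in> ?J \<rightarrow>\<^sub>E {a..b}" by (simp only: space_PiM space_interval_measure)
    then have "x \<in> ?J \<rightarrow>\<^sub>E UNIV" using PiE_mono[of ?J "\<lambda>_. {a..b}" "\<lambda>_. UNIV"] by blast
    from mixed_test_family_slice[OF \<Phi> i \<alpha> this]
    have "(\<integral>t. u i t * \<Phi> (\<alpha>(i := \<alpha> i)) (x(i := t)) \<partial>?I) =
        (-1) ^ \<alpha> i * (\<integral>t. g t * \<Phi> (\<alpha>(i := 0)) (x(i := t)) \<partial>?I)"
      using g unfolding has_weak_deriv_def by blast
    then have eq: "(\<integral>t. u i t * \<Phi> \<alpha> (x(i := t)) \<partial>?I) =
        (-1) ^ \<alpha> i * (\<integral>t. g t * \<Phi> (\<alpha>(i := 0)) (x(i := t)) \<partial>?I)"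
      by (simp only: fun_upd_triv)
    have "(\<integral>t. (\<Prod>j<d. u j ((x(i := t)) j)) * \<Phi> \<alpha> (x(i := t)) \<partial>?I) =
        (\<Prod>j\<in>?J. u j (x j)) * (\<integral>t. u i t * \<Phi> \<alpha> (x(i := t)) \<partial>?I)"
      unfolding prod[of u] by (subst integral_mult_right_zero[symmetric]) (simp only: mult_ac)
    also have "\<dots> = (-1) ^ \<alpha> i * ((\<Prod>j\<in>?J. u j (x j)) * (\<integral>t. g t * \<Phi> (\<alpha>(i := 0)) (x(i := t)) \<partial>?I))"
      unfolding eq by (simp only: mult_ac)
    also have "(\<Prod>j\<in>?J. u j (x j)) * (\<integral>t. g t * \<Phi> (\<alpha>(i := 0)) (x(i := t)) \<partial>?I) =
        (\<integral>t. (\<Prod>j<d. (u(i := g)) j ((x(i := t)) j)) * \<Phi> (\<alpha>(i := 0)) (x(i := t)) \<partial>?I)"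
      unfolding prod[of "u(i := g)"] prod' fun_upd_same
      by (subst integral_mult_right_zero[symmetric]) (simp only: mult_ac)
    finally show "(\<integral>t. (\<Prod>j<d. u j ((x(i := t)) j)) * \<Phi> \<alpha> (x(i := t)) \<partial>?I) =
      (-1) ^ \<alpha> i * (\<integral>t. (\<Prod>j<d. (u(i := g)) j ((x(i := t)) j)) * \<Phi> (\<alpha>(i := 0)) (x(i := t)) \<partial>?I)" .
  qed
  also have "\<dots> = (-1) ^ \<alpha> i * (\<integral>x. (\<integral>t. (\<Prod>j<d. (u(i := g)) j ((x(i := t)) j)) * \<Phi> (\<alpha>(i := 0)) (x(i := t)) \<partial>?I)
      \<partial>PiM ?J (\<lambda>_. ?I))"
    by (rule integral_mult_right_zero)
  also have "(\<integral>x. (\<integral>t. (\<Prod>j<d. (u(i := g)) j ((x(i := t)) j)) * \<Phi> (\<alpha>(i := 0)) (x(i := t)) \<partial>?I)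
      \<partial>PiM ?J (\<lambda>_. ?I)) = (\<integral>x. (\<Prod>j<d. (u(i := g)) j (x j)) * \<Phi> (\<alpha>(i := 0)) x \<partial>cube_measure a b d)"
    by (rule integral_cube_Fubini[OF i int, symmetric]) (use u g2 in auto)
  finally show ?thesis .
qed

lemma has_mixed_weak_deriv_prod:
  assumes \<alpha>: "\<forall>i\<ge>d. \<alpha> i = 0"
    and u: "\<And>j. j < d \<Longrightarrow> u j \<in> vecs (L2_space (interval_measure_on a b))"
    and g: "\<And>j. j < d \<Longrightarrow> has_weak_deriv a b (\<alpha> j) (u j) (g j)"
  shows "has_mixed_weak_deriv a b d \<alpha> (\<lambda>x. \<Prod>j<d. u j (x j)) (\<lambda>x. \<Prod>j<d. g j (x j))"
  unfolding has_mixed_weak_deriv_def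
proof (intro conjI allI impI)
  have g2: "g j \<in> vecs (L2_space (interval_measure_on a b))" if "j < d" for j
    using g[OF that] by (simp add: has_weak_deriv_def)
  then show "(\<lambda>x. \<Prod>j<d. g j (x j)) \<in> vecs (L2_cube a b d)" by (rule L2_cube_prod)
  fix \<Phi> assume \<Phi>: "mixed_test_family a b d \<Phi>"
  \<comment> \<open>Interpolation between the two sides: after k steps the first k factors are
    differentiated and the first k entries of \<alpha> are cleared.\<close>
  define U where "U k = (\<lambda>j. if j < k then g j else u j)" for k
  define A where "A k = (\<lambda>j. if j < k then 0 else \<alpha> j)" for k
  have "(\<integral>x. (\<Prod>j<d. u j (x j)) * \<Phi> \<alpha> x \<partial>cube_measure a b d) =
      (-1) ^ (\<Sum>i<k. \<alpha> i) * (\<integral>x. (\<Prod>j<d. U k j (x j)) * \<Phi> (A k) x \<partial>cube_measure a b d)" if "k \<le> d" for k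
    using that
  proof (induction k)
    case 0
    then show ?case by (simp add: U_def A_def)
  next
    case (Suc k)
    then have "k < d" by simp
    have "(\<integral>x. (\<Prod>j<d. U k j (x j)) * \<Phi> (A k) x \<partial>cube_measure a b d) =
      (-1) ^ A k k * (\<integral>x. (\<Prod>j<d. ((U k)(k := g k)) j (x j)) * \<Phi> ((A k)(k := 0)) x \<partial>cube_measure a b d)"
    proof (rule integral_prod_test_step[OF \<Phi> \<open>k < d\<close>])
      show "\<forall>i\<ge>d. A k i = 0" using \<alpha> by (simp add: A_def)
      show "U k j \<in> vecs (L2_space (interval_measure_on a b))" if "j < d" for j
        using u g2 that by (simp add: U_def)
      show "has_weak_deriv a b (A k k) (U k k) (g k)"
        using g[OF \<open>k < d\<close>] by (simp add: A_def U_def)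
    qed
    also have "(U k)(k := g k) = U (Suc k)" by (auto simp: U_def fun_eq_iff less_Suc_eq)
    also have "(A k)(k := 0) = A (Suc k)" by (auto simp: A_def fun_eq_iff less_Suc_eq)
    also have "A k k = \<alpha> k" by (simp add: A_def)
    finally show ?case using Suc by (simp add: power_add)
  qed
  from this[of d] have "(\<integral>x. (\<Prod>j<d. u j (x j)) * \<Phi> \<alpha> x \<partial>cube_measure a b d) =
      (-1) ^ (\<Sum>i<d. \<alpha> i) * (\<integral>x. (\<Prod>j<d. U d j (x j)) * \<Phi> (A d) x \<partial>cube_measure a b d)" by simp
  also have "A d = (\<lambda>_. 0)" using \<alpha> by (auto simp: A_def fun_eq_iff)
  also have "(\<lambda>x. (\<Prod>j<d. U d j (x j))) = (\<lambda>x. \<Prod>j<d. g j (x j))" 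
    by (intro ext prod.cong refl) (simp add: U_def)
  finally show "(\<integral>x. (\<Prod>j<d. u j (x j)) * \<Phi> \<alpha> x \<partial>cube_measure a b d) =
      (-1) ^ (\<Sum>i<d. \<alpha> i) * (\<integral>x. (\<Prod>j<d. g j (x j)) * \<Phi> (\<lambda>_. 0) x \<partial>cube_measure a b d)"
    by (simp add: fun_eq_iff)
qed

section \<open>Spaces with a semi-inner product\<close>

text \<open>The form is only semidefinite, as functions that agree almost everywhere are not
  identified. Projections are taken onto finite spans only, so the axioms are purely
  algebraic.\<close>

locale semi_inner_space =
  fixes X :: "'a hspace"
  assumes zero_mem: "(\<lambda>x. 0) \<in> vecs X"
    and add_mem: "\<lbrakk>f \<in> vecs X; g \<in> vecs X\<rbrakk> \<Longrightarrow> (\<lambda>x. f x + g x) \<in> vecs X"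
    and cmult_mem: "f \<in> vecs X \<Longrightarrow> (\<lambda>x. c * f x) \<in> vecs X"
    and sprod_add_left: "\<lbrakk>f \<in> vecs X; g \<in> vecs X; h \<in> vecs X\<rbrakk> \<Longrightarrow>
      sprod X (\<lambda>x. f x + g x) h = sprod X f h + sprod X g h"
    and sprod_cmult_left: "\<lbrakk>f \<in> vecs X; h \<in> vecs X\<rbrakk> \<Longrightarrow> sprod X (\<lambda>x. c * f x) h = c * sprod X f h"
    and sprod_commute: "\<lbrakk>f \<in> vecs X; g \<in> vecs X\<rbrakk> \<Longrightarrow> sprod X g f = cnj (sprod X f g)"
    and sprod_nonneg: "f \<in> vecs X \<Longrightarrow> 0 \<le> Re (sprod X f f)"
begin

lemma sprod_add_right:
  assumes "f \<in> vecs X" "g \<in> vecs X" "h \<in> vecs X"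
  shows "sprod X h (\<lambda>x. f x + g x) = sprod X h f + sprod X h g"
  using assms sprod_commute[of "\<lambda>x. f x + g x" h] sprod_commute[of f h] sprod_commute[of g h]
  by (simp add: add_mem sprod_add_left)

lemma sprod_cmult_right:
  assumes "f \<in> vecs X" "h \<in> vecs X"
  shows "sprod X h (\<lambda>x. c * f x) = cnj c * sprod X h f"
  using assms sprod_commute[of "\<lambda>x. c * f x" h] sprod_commute[of f h]
  by (simp add: cmult_mem sprod_cmult_left)

lemma diff_mem: "\<lbrakk>f \<in> vecs X; g \<in> vecs X\<rbrakk> \<Longrightarrow> (\<lambda>x. f x - g x) \<in> vecs X"
  using add_mem[of f "\<lambda>x. (-1) * g x"] cmult_mem[of g "-1"] by simp

lemma sum_mem: "(\<And>i. i \<in> I \<Longrightarrow> f i \<in> vecs X) \<Longrightarrow> (\<lambda>x. \<Sum>i\<in>I. f i x) \<in> vecs X"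
  by (induction I rule: infinite_finite_induct) (simp_all add: zero_mem add_mem)

lemma sprod_zero_left: "h \<in> vecs X \<Longrightarrow> sprod X (\<lambda>x. 0) h = 0"
  using sprod_cmult_left[of "\<lambda>x. 0" h 0] by (simp add: zero_mem)

lemma sprod_sum_left:
  assumes "\<And>i. i \<in> I \<Longrightarrow> f i \<in> vecs X" "h \<in> vecs X"
  shows "sprod X (\<lambda>x. \<Sum>i\<in>I. f i x) h = (\<Sum>i\<in>I. sprod X (f i) h)"
  using assms
  by (induction I rule: infinite_finite_induct)
     (simp_all add: sprod_zero_left sprod_add_left sum_mem)

lemma sprod_sum_right:
  assumes "\<And>i. i \<in> I \<Longrightarrow> f i \<in> vecs X" "h \<in> vecs X"
  shows "sprod X h (\<lambda>x. \<Sum>i\<in>I. f i x) = (\<Sum>i\<in>I. sprod X h (f i))"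
proof -
  have "sprod X h (\<lambda>x. \<Sum>i\<in>I. f i x) = cnj (sprod X (\<lambda>x. \<Sum>i\<in>I. f i x) h)"
    using assms by (intro sprod_commute sum_mem)
  also have "\<dots> = (\<Sum>i\<in>I. cnj (sprod X (f i) h))"
    using assms by (simp add: sprod_sum_left)
  also have "\<dots> = (\<Sum>i\<in>I. sprod X h (f i))"
    by (intro sum.cong refl sprod_commute[symmetric] assms)
  finally show ?thesis .
qed

lemma sprod_self: "f \<in> vecs X \<Longrightarrow> sprod X f f = of_real ((hnorm X f)\<^sup>2)"
  using sprod_commute[of f f] sprod_nonneg[of f]
  by (auto simp: hnorm_def complex_eq_iff)

lemma hnorm_nonneg: "f \<in> vecs X \<Longrightarrow> 0 \<le> hnorm X f"
  by (simp add: hnorm_def sprod_nonneg)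

lemma hnorm_cmult: "f \<in> vecs X \<Longrightarrow> hnorm X (\<lambda>x. c * f x) = cmod c * hnorm X f"
proof -
  assume f: "f \<in> vecs X"
  have "sprod X (\<lambda>x. c * f x) (\<lambda>x. c * f x) = of_real ((cmod c * hnorm X f)\<^sup>2)"
    unfolding sprod_cmult_left[OF f cmult_mem[OF f]] sprod_cmult_right[OF f f] sprod_self[OF f]
      power_mult_distrib of_real_mult complex_norm_square by (simp only: mult.assoc)
  then show ?thesis
    using f by (simp add: hnorm_def[of X "\<lambda>x. c * f x"] hnorm_nonneg abs_mult)
qed

lemma hnorm_add_sq:
  assumes "f \<in> vecs X" "g \<in> vecs X"
  shows "(hnorm X (\<lambda>x. f x + g x))\<^sup>2 = (hnorm X f)\<^sup>2 + 2 * Re (sprod X f g) + (hnorm X g)\<^sup>2"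
proof -
  have "of_real ((hnorm X (\<lambda>x. f x + g x))\<^sup>2) = sprod X (\<lambda>x. f x + g x) (\<lambda>x. f x + g x)"
    using assms by (intro sprod_self[symmetric] add_mem)
  also have "\<dots> = sprod X f f + sprod X g g + (sprod X f g + cnj (sprod X f g))"
    using assms by (simp add: sprod_add_left sprod_add_right add_mem sprod_commute[of f g])
  also have "\<dots> = of_real ((hnorm X f)\<^sup>2 + 2 * Re (sprod X f g) + (hnorm X g)\<^sup>2)"
    using assms by (simp add: sprod_self complex_add_cnj)
  finally show ?thesis by (simp only: of_real_eq_iff)
qed

lemma Cauchy_Schwarz:
  assumes f: "f \<in> vecs X" and g: "g \<in> vecs X"
  shows "cmod (sprod X f g) \<le> hnorm X f * hnorm X g"
proof -
  let ?p = "sprod X f g"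
  \<comment> \<open>Expansion of the squared norm of f - t p g, where p is the product of f and g
    and t is real.\<close>
  have key: "0 \<le> (hnorm X f)\<^sup>2 - 2 * t * (cmod ?p)\<^sup>2 + t\<^sup>2 * (cmod ?p)\<^sup>2 * (hnorm X g)\<^sup>2" for t :: real
  proof -
    let ?c = "- of_real t * ?p"
    have "(hnorm X (\<lambda>x. f x + ?c * g x))\<^sup>2 =
        (hnorm X f)\<^sup>2 + 2 * Re (sprod X f (\<lambda>x. ?c * g x)) + (hnorm X (\<lambda>x. ?c * g x))\<^sup>2"
      by (intro hnorm_add_sq f cmult_mem g)
    also have "sprod X f (\<lambda>x. ?c * g x) = - of_real (t * (cmod ?p)\<^sup>2)"
      unfolding sprod_cmult_right[OF g f] of_real_mult complex_norm_square by simp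
    also have "hnorm X (\<lambda>x. ?c * g x) = \<bar>t\<bar> * cmod ?p * hnorm X g"
      unfolding hnorm_cmult[OF g] by (simp add: norm_mult)
    finally have "(hnorm X (\<lambda>x. f x + ?c * g x))\<^sup>2 =
        (hnorm X f)\<^sup>2 - 2 * t * (cmod ?p)\<^sup>2 + t\<^sup>2 * (cmod ?p)\<^sup>2 * (hnorm X g)\<^sup>2"
      by (simp add: power_mult_distrib)
    then show ?thesis by (metis zero_le_power2)
  qed
  have "(cmod ?p)\<^sup>2 \<le> (hnorm X f * hnorm X g)\<^sup>2"
  proof (cases "hnorm X g = 0")
    case False
    from key[of "1 / (hnorm X g)\<^sup>2"]
    have "0 \<le> (hnorm X f)\<^sup>2 - (cmod ?p)\<^sup>2 / (hnorm X g)\<^sup>2"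
      using False by (simp add: field_simps power2_eq_square)
    then show ?thesis using False by (simp add: field_simps power_mult_distrib)
  next
    case True
    show ?thesis
    proof (cases "?p = 0")
      case False
      \<comment> \<open>A vector of norm 0 may be a nonzero function, so this case is not trivial:
        the quadratic in t becomes linear, and this t makes its value -1.\<close>
      from key[of "((hnorm X f)\<^sup>2 + 1) / (2 * (cmod ?p)\<^sup>2)"] show ?thesis
        using True False by simp
    qed simp
  qed
  then show ?thesis
    by (rule power2_le_imp_le) (simp add: f g hnorm_nonneg)
qed

lemma hnorm_triangle:
  assumes "f \<in> vecs X" "g \<in> vecs X"
  shows "hnorm X (\<lambda>x. f x + g x) \<le> hnorm X f + hnorm X g"
proof (rule power2_le_imp_le)
  have "Re (sprod X f g) \<le> hnorm X f * hnorm X g"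
    using Cauchy_Schwarz[OF assms] complex_Re_le_cmod[of "sprod X f g"] by linarith
  then show "(hnorm X (\<lambda>x. f x + g x))\<^sup>2 \<le> (hnorm X f + hnorm X g)\<^sup>2"
    unfolding hnorm_add_sq[OF assms] by (simp add: power2_sum)
qed (use assms in \<open>simp add: hnorm_nonneg\<close>)

lemma hnorm_zero: "hnorm X (\<lambda>x. 0) = 0"
  by (simp add: hnorm_def sprod_zero_left zero_mem)

lemma hdist_triangle:
  assumes "f \<in> vecs X" "g \<in> vecs X" "h \<in> vecs X"
  shows "hdist X f h \<le> hdist X f g + hdist X g h"
  using hnorm_triangle[of "\<lambda>x. f x - g x" "\<lambda>x. g x - h x"] assms
  by (simp add: hdist_def diff_mem)

lemma hdist_nonneg: "\<lbrakk>f \<in> vecs X; g \<in> vecs X\<rbrakk> \<Longrightarrow> 0 \<le> hdist X f g"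
  by (simp add: hdist_def hnorm_nonneg diff_mem)

lemma hnorm_le_hdist:
  assumes "f \<in> vecs X" "g \<in> vecs X"
  shows "hnorm X f \<le> hnorm X g + hdist X f g"
  using hnorm_triangle[of g "\<lambda>x. f x - g x"] assms by (simp add: hdist_def diff_mem)

lemma hdist_sum:
  assumes "\<And>i. i \<in> I \<Longrightarrow> f i \<in> vecs X" "\<And>i. i \<in> I \<Longrightarrow> g i \<in> vecs X"
  shows "hdist X (\<lambda>x. \<Sum>i\<in>I. f i x) (\<lambda>x. \<Sum>i\<in>I. g i x) \<le> (\<Sum>i\<in>I. hdist X (f i) (g i))"
  using assms
proof (induction I rule: infinite_finite_induct)
  case (insert i I)
  have "hdist X (\<lambda>x. \<Sum>i\<in>insert i I. f i x) (\<lambda>x. \<Sum>i\<in>insert i I. g i x)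
      = hnorm X (\<lambda>x. (f i x - g i x) + ((\<Sum>i\<in>I. f i x) - (\<Sum>i\<in>I. g i x)))"
    using insert.hyps by (simp add: hdist_def algebra_simps)
  also have "\<dots> \<le> hdist X (f i) (g i) + hdist X (\<lambda>x. \<Sum>i\<in>I. f i x) (\<lambda>x. \<Sum>i\<in>I. g i x)"
    unfolding hdist_def using insert.prems by (intro hnorm_triangle diff_mem sum_mem) auto
  finally show ?case using insert by simp
qed (simp_all add: hdist_def hnorm_zero)

lemma Pythagoras:
  assumes "finite I" "\<And>i. i \<in> I \<Longrightarrow> f i \<in> vecs X"
    and "\<And>i j. \<lbrakk>i \<in> I; j \<in> I; i \<noteq> j\<rbrakk> \<Longrightarrow> sprod X (f i) (f j) = 0"
  shows "(hnorm X (\<lambda>x. \<Sum>i\<in>I. c i * f i x))\<^sup>2 = (\<Sum>i\<in>I. (cmod (c i))\<^sup>2 * (hnorm X (f i))\<^sup>2)"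
  using assms
proof (induction I rule: finite_induct)
  case (insert i I)
  have mem: "(\<lambda>x. c i * f i x) \<in> vecs X" "(\<lambda>x. \<Sum>j\<in>I. c j * f j x) \<in> vecs X"
    using insert.prems by (auto intro!: cmult_mem sum_mem)
  have "sprod X (f i) (\<lambda>x. \<Sum>j\<in>I. c j * f j x) = (\<Sum>j\<in>I. sprod X (f i) (\<lambda>x. c j * f j x))"
    using insert.prems by (intro sprod_sum_right cmult_mem) auto
  also have "\<dots> = 0"
    using insert.prems insert.hyps by (intro sum.neutral) (auto simp: sprod_cmult_right)
  finally have "sprod X (\<lambda>x. c i * f i x) (\<lambda>x. \<Sum>j\<in>I. c j * f j x) = 0"
    using mem insert.prems by (simp add: sprod_cmult_left)
  then have "(hnorm X (\<lambda>x. c i * f i x + (\<Sum>j\<in>I. c j * f j x)))\<^sup>2 =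
      (hnorm X (\<lambda>x. c i * f i x))\<^sup>2 + (hnorm X (\<lambda>x. \<Sum>j\<in>I. c j * f j x))\<^sup>2"
    using hnorm_add_sq[OF mem] by simp
  then show ?case
    using insert by (simp add: hnorm_cmult power_mult_distrib)
qed (simp add: hnorm_zero)

text \<open>\<open>projection\<close> is the orthogonal projection if the \<open>e k\<close> are orthogonal of norm \<open>r\<close>.\<close>

definition projection :: "real \<Rightarrow> ('k \<Rightarrow> 'a \<Rightarrow> complex) \<Rightarrow> 'k set \<Rightarrow> ('a \<Rightarrow> complex) \<Rightarrow> 'a \<Rightarrow> complex" where
  "projection r e K f = (\<lambda>x. \<Sum>k\<in>K. (sprod X f (e k) / of_real (r\<^sup>2)) * e k x)"

context
  fixes e :: "'k \<Rightarrow> 'a \<Rightarrow> complex" and K :: "'k set" and r :: real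
  assumes K: "finite K" and e: "\<And>k. k \<in> K \<Longrightarrow> e k \<in> vecs X" and r: "r > 0"
    and norm: "\<And>k. k \<in> K \<Longrightarrow> hnorm X (e k) = r"
    and orth: "\<And>k l. \<lbrakk>k \<in> K; l \<in> K; k \<noteq> l\<rbrakk> \<Longrightarrow> sprod X (e k) (e l) = 0"
begin

lemma projection_mem: "projection r e K f \<in> vecs X"
  unfolding projection_def by (intro sum_mem cmult_mem e)

lemma sprod_combination:
  assumes "k \<in> K"
  shows "sprod X (\<lambda>x. \<Sum>l\<in>K. c l * e l x) (e k) = c k * of_real (r\<^sup>2)"
proof -
  have "sprod X (\<lambda>x. \<Sum>l\<in>K. c l * e l x) (e k) = (\<Sum>l\<in>K. sprod X (\<lambda>x. c l * e l x) (e k))"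
    using assms by (intro sprod_sum_left cmult_mem e)
  also have "\<dots> = (\<Sum>l\<in>K. if l = k then c k * of_real (r\<^sup>2) else 0)"
    using assms by (intro sum.cong refl) (simp add: sprod_cmult_left e orth sprod_self norm)
  also have "\<dots> = c k * of_real (r\<^sup>2)" using assms K by simp
  finally show ?thesis .
qed

lemma sprod_projection: "k \<in> K \<Longrightarrow> sprod X (projection r e K f) (e k) = sprod X f (e k)"
  unfolding projection_def using r by (subst sprod_combination) simp_all

text \<open>That the span is fixed later puts the \<open>e k\<close> into the range of the
  projection, as the definition of the rank demands.\<close>

lemma projection_combination:
  "projection r e K (\<lambda>x. \<Sum>l\<in>K. c l * e l x) = (\<lambda>x. \<Sum>l\<in>K. c l * e l x)"
  unfolding projection_def using r by (simp add: sprod_combination cong: sum.cong)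

lemma hnorm_combination_sq:
  "(hnorm X (\<lambda>x. \<Sum>l\<in>K. c l * e l x))\<^sup>2 = r\<^sup>2 * (\<Sum>l\<in>K. (cmod (c l))\<^sup>2)"
  using Pythagoras[of K e c, OF K e orth] by (simp add: norm sum_distrib_left mult.commute cong: sum.cong)

text \<open>Pythagoras, as the projection error is orthogonal to the span. Free coefficients c give
  best approximation, c = 0 gives Bessel's inequality, and coefficients supported on a subset
  compare two projections.\<close>

lemma hnorm_minus_combination_sq:
  assumes f: "f \<in> vecs X"
  shows "(hnorm X (\<lambda>x. f x - (\<Sum>l\<in>K. c l * e l x)))\<^sup>2 =
    (hnorm X (\<lambda>x. f x - projection r e K f x))\<^sup>2 +
    r\<^sup>2 * (\<Sum>l\<in>K. (cmod (sprod X f (e l) / of_real (r\<^sup>2) - c l))\<^sup>2)"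
proof -
  let ?d = "\<lambda>l. sprod X f (e l) / of_real (r\<^sup>2) - c l"
  have mem: "(\<lambda>x. f x - projection r e K f x) \<in> vecs X" "(\<lambda>x. \<Sum>l\<in>K. ?d l * e l x) \<in> vecs X"
    using f by (auto intro!: diff_mem projection_mem sum_mem cmult_mem e)
  have orth0: "sprod X (\<lambda>x. f x - projection r e K f x) (e l) = 0" if "l \<in> K" for l
    using sprod_add_left[of "\<lambda>x. f x - projection r e K f x" "projection r e K f" "e l"]
      sprod_projection[OF that, of f] f that by (simp add: mem projection_mem e)
  have "sprod X (\<lambda>x. f x - projection r e K f x) (\<lambda>x. \<Sum>l\<in>K. ?d l * e l x) =
      (\<Sum>l\<in>K. sprod X (\<lambda>x. f x - projection r e K f x) (\<lambda>x. ?d l * e l x))"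
    by (intro sprod_sum_right cmult_mem e mem)
  also have "\<dots> = 0"
    by (intro sum.neutral ballI) (simp only: sprod_cmult_right[OF e mem(1)] orth0 mult_zero_right)
  finally have "(hnorm X (\<lambda>x. (f x - projection r e K f x) + (\<Sum>l\<in>K. ?d l * e l x)))\<^sup>2 =
      (hnorm X (\<lambda>x. f x - projection r e K f x))\<^sup>2 + (hnorm X (\<lambda>x. \<Sum>l\<in>K. ?d l * e l x))\<^sup>2"
    using hnorm_add_sq[OF mem] by simp
  moreover have "(\<lambda>x. (f x - projection r e K f x) + (\<Sum>l\<in>K. ?d l * e l x)) =
      (\<lambda>x. f x - (\<Sum>l\<in>K. c l * e l x))"
    by (simp add: projection_def left_diff_distrib sum_subtractf)
  ultimately show ?thesis by (simp only: hnorm_combination_sq)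
qed

lemma Bessel:
  assumes f: "f \<in> vecs X"
  shows "(\<Sum>k\<in>K. (cmod (sprod X f (e k)))\<^sup>2) \<le> r\<^sup>2 * (hnorm X f)\<^sup>2"
proof -
  have "r\<^sup>2 * (\<Sum>l\<in>K. (cmod (sprod X f (e l) / of_real (r\<^sup>2)))\<^sup>2) \<le> (hnorm X f)\<^sup>2"
    using hnorm_minus_combination_sq[OF f, of "\<lambda>_. 0"] by simp
  also have "(\<Sum>l\<in>K. (cmod (sprod X f (e l) / of_real (r\<^sup>2)))\<^sup>2) =
      (\<Sum>l\<in>K. (cmod (sprod X f (e l)))\<^sup>2) / (r\<^sup>2)\<^sup>2"
    by (simp add: norm_divide power_divide sum_divide_distrib norm_power)
  also have "r\<^sup>2 * ((\<Sum>l\<in>K. (cmod (sprod X f (e l)))\<^sup>2) / (r\<^sup>2)\<^sup>2) = (\<Sum>l\<in>K. (cmod (sprod X f (e l)))\<^sup>2) / r\<^sup>2"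
    using r by (simp add: power2_eq_square)
  finally show ?thesis using r by (simp add: field_simps)
qed

end

end

section \<open>L2 and mixed Sobolev spaces with their semi-inner products\<close>

lemma semi_inner_space_subspace:
  assumes "semi_inner_space X" "vecs Z \<subseteq> vecs X" "sprod Z = sprod X"
    and "(\<lambda>x. 0) \<in> vecs Z" "\<And>f g. \<lbrakk>f \<in> vecs Z; g \<in> vecs Z\<rbrakk> \<Longrightarrow> (\<lambda>x. f x + g x) \<in> vecs Z"
    and "\<And>c f. f \<in> vecs Z \<Longrightarrow> (\<lambda>x. c * f x) \<in> vecs Z"
  shows "semi_inner_space Z"
proof -
  interpret semi_inner_space X by fact
  have mem: "f \<in> vecs X" if "f \<in> vecs Z" for f using that assms(2) by (rule subsetD[rotated])
  show ?thesis
  proof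
    show "sprod Z g f = cnj (sprod Z f g)" if "f \<in> vecs Z" "g \<in> vecs Z" for f g
      unfolding assms(3) by (intro sprod_commute mem that)
  qed (simp_all add: assms(3-6) mem sprod_add_left sprod_cmult_left sprod_nonneg)
qed

lemma semi_inner_space_L2: "semi_inner_space (L2_space M)"
proof
  show "(\<lambda>x. 0) \<in> vecs (L2_space M)" by (rule L2_zero)
  fix f g h :: "'a \<Rightarrow> complex" and c assume f: "f \<in> vecs (L2_space M)"
  show "(\<lambda>x. c * f x) \<in> vecs (L2_space M)" by (rule L2_cmult[OF f])
  show "0 \<le> Re (sprod (L2_space M) f f)"
  proof -
    have "sprod (L2_space M) f f = (\<integral>x. of_real ((cmod (f x))\<^sup>2) \<partial>M)"
      by (simp only: sprod_L2 complex_norm_square)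
    then show ?thesis by (simp only: integral_complex_of_real) simp
  qed
  { assume g: "g \<in> vecs (L2_space M)"
    show "(\<lambda>x. f x + g x) \<in> vecs (L2_space M)" by (rule L2_add[OF f g])
    show "sprod (L2_space M) g f = cnj (sprod (L2_space M) f g)"
    proof -
      have "(\<integral>x. g x * cnj (f x) \<partial>M) = (\<integral>x. cnj (f x * cnj (g x)) \<partial>M)"
        by (simp only: complex_cnj_mult complex_cnj_cnj mult.commute)
      also have "\<dots> = cnj (\<integral>x. f x * cnj (g x) \<partial>M)" by (rule Bochner_Integration.integral_cnj)
      finally show ?thesis by (simp only: sprod_L2)
    qed
    assume h: "h \<in> vecs (L2_space M)"
    show "sprod (L2_space M) (\<lambda>x. f x + g x) h = sprod (L2_space M) f h + sprod (L2_space M) g h"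
      unfolding sprod_L2 using L2_sprod_integrable[OF f h] L2_sprod_integrable[OF g h]
      by (simp add: distrib_right)
  }
  assume "h \<in> vecs (L2_space M)"
  show "sprod (L2_space M) (\<lambda>x. c * f x) h = c * sprod (L2_space M) f h"
    unfolding sprod_L2 by (simp add: mult.assoc)
qed

lemma semi_inner_space_L2_cube: "semi_inner_space (L2_cube a b d)"
  unfolding L2_cube_def by (rule semi_inner_space_L2)

interpretation L2_cube: semi_inner_space "L2_cube a b d" for a b d
  by (rule semi_inner_space_L2_cube)

lemma sprod_L2_cong_AE:
  assumes "AE x in M. f x = f' x" "AE x in M. g x = g' x"
    "f \<in> vecs (L2_space M)" "f' \<in> vecs (L2_space M)" "g \<in> vecs (L2_space M)" "g' \<in> vecs (L2_space M)"
  shows "sprod (L2_space M) f g = sprod (L2_space M) f' g'"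
  unfolding sprod_L2
proof (rule integral_cong_AE)
  show "AE x in M. f x * cnj (g x) = f' x * cnj (g' x)"
    using assms(1,2) by eventually_elim simp
  show "(\<lambda>x. f x * cnj (g x)) \<in> borel_measurable M" "(\<lambda>x. f' x * cnj (g' x)) \<in> borel_measurable M"
    using assms by (auto intro!: borel_measurable_integrable L2_sprod_integrable)
qed

lemma has_mixed_weak_deriv_L2: "has_mixed_weak_deriv a b d \<alpha> f g \<Longrightarrow> g \<in> vecs (L2_cube a b d)"
  by (simp add: has_mixed_weak_deriv_def)

text \<open>This makes the choice in \<open>mixed_weak_deriv\<close> harmless: scalar products of
  derivatives do not depend on the representatives.\<close>

lemma has_mixed_weak_deriv_unique:
  assumes "has_mixed_weak_deriv a b d \<alpha> f g" "has_mixed_weak_deriv a b d \<alpha> f g'"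
  shows "AE x in cube_measure a b d. g x = g' x"
proof -
  have g: "g \<in> vecs (L2_space (cube_measure a b d))" "g' \<in> vecs (L2_space (cube_measure a b d))"
    using assms[THEN has_mixed_weak_deriv_L2] by (simp_all add: L2_cube_vecs)
  have "AE x in cube_measure a b d. g x - g' x = 0"
  proof (rule mixed_fundamental_lemma)
    show "integrable (cube_measure a b d) (\<lambda>x. g x - g' x)"
      by (intro L2_integrable[OF cube.finite_measure_axioms] L2_diff g)
    fix \<Phi> assume \<Phi>: "mixed_test_family a b d \<Phi>"
    have "(-1) ^ (\<Sum>i<d. \<alpha> i) * (\<integral>x. h x * \<Phi> (\<lambda>_. 0) x \<partial>cube_measure a b d) =
        (\<integral>x. f x * \<Phi> \<alpha> x \<partial>cube_measure a b d)" if "has_mixed_weak_deriv a b d \<alpha> f h" for h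
      using that \<Phi> by (simp only: has_mixed_weak_deriv_def)
    from this[OF assms(1)] this[OF assms(2)]
    have "(-1) ^ (\<Sum>i<d. \<alpha> i) * (\<integral>x. g x * \<Phi> (\<lambda>_. 0) x \<partial>cube_measure a b d) =
        (-1) ^ (\<Sum>i<d. \<alpha> i) * (\<integral>x. g' x * \<Phi> (\<lambda>_. 0) x \<partial>cube_measure a b d)"
      by (simp only:)
    moreover have "integrable (cube_measure a b d) (\<lambda>x. g x * \<Phi> (\<lambda>_. 0) x)"
      "integrable (cube_measure a b d) (\<lambda>x. g' x * \<Phi> (\<lambda>_. 0) x)"
      using mixed_test_family_L2[OF \<Phi>] g by (auto intro!: L2_mult_integrable simp: L2_cube_vecs)
    ultimately show "(\<integral>x. (g x - g' x) * \<Phi> (\<lambda>_. 0) x \<partial>cube_measure a b d) = 0"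
      by (simp add: left_diff_distrib)
  qed
  then show ?thesis by simp
qed

lemma has_mixed_weak_deriv_add:
  assumes "f \<in> vecs (L2_cube a b d)" "g \<in> vecs (L2_cube a b d)"
    and f': "has_mixed_weak_deriv a b d \<alpha> f f'" and g': "has_mixed_weak_deriv a b d \<alpha> g g'"
  shows "has_mixed_weak_deriv a b d \<alpha> (\<lambda>x. f x + g x) (\<lambda>x. f' x + g' x)"
  unfolding has_mixed_weak_deriv_def
proof (intro conjI allI impI)
  show "(\<lambda>x. f' x + g' x) \<in> vecs (L2_cube a b d)"
    by (intro L2_cube.add_mem has_mixed_weak_deriv_L2[OF f'] has_mixed_weak_deriv_L2[OF g'])
  fix \<Phi> assume \<Phi>: "mixed_test_family a b d \<Phi>"
  have int: "integrable (cube_measure a b d) (\<lambda>x. h x * \<Phi> \<beta> x)" if "h \<in> vecs (L2_cube a b d)" for h \<beta>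
    using that mixed_test_family_L2[OF \<Phi>] unfolding L2_cube_vecs by (rule L2_mult_integrable)
  have "(\<integral>x. f x * \<Phi> \<alpha> x \<partial>cube_measure a b d) = (-1) ^ (\<Sum>i<d. \<alpha> i) * (\<integral>x. f' x * \<Phi> (\<lambda>_. 0) x \<partial>cube_measure a b d)"
    "(\<integral>x. g x * \<Phi> \<alpha> x \<partial>cube_measure a b d) = (-1) ^ (\<Sum>i<d. \<alpha> i) * (\<integral>x. g' x * \<Phi> (\<lambda>_. 0) x \<partial>cube_measure a b d)"
    using f' g' \<Phi> by (simp_all add: has_mixed_weak_deriv_def)
  then show "(\<integral>x. (f x + g x) * \<Phi> \<alpha> x \<partial>cube_measure a b d) =
      (-1) ^ (\<Sum>i<d. \<alpha> i) * (\<integral>x. (f' x + g' x) * \<Phi> (\<lambda>_. 0) x \<partial>cube_measure a b d)"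
    using int[OF assms(1)] int[OF assms(2)] int[OF has_mixed_weak_deriv_L2[OF f']]
      int[OF has_mixed_weak_deriv_L2[OF g']]
    by (simp add: distrib_right distrib_left)
qed

lemma has_mixed_weak_deriv_cmult:
  assumes "has_mixed_weak_deriv a b d \<alpha> f f'"
  shows "has_mixed_weak_deriv a b d \<alpha> (\<lambda>x. c * f x) (\<lambda>x. c * f' x)"
  using assms by (simp add: has_mixed_weak_deriv_def L2_cube.cmult_mem mult.assoc)

lemma has_mixed_weak_deriv_zero: "has_mixed_weak_deriv a b d \<alpha> (\<lambda>x. 0) (\<lambda>x. 0)"
  by (simp add: has_mixed_weak_deriv_def L2_cube.zero_mem)

lemma has_mixed_weak_deriv_sum:
  assumes "\<And>i. i \<in> I \<Longrightarrow> f i \<in> vecs (L2_cube a b d)"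
    "\<And>i. i \<in> I \<Longrightarrow> has_mixed_weak_deriv a b d \<alpha> (f i) (f' i)"
  shows "has_mixed_weak_deriv a b d \<alpha> (\<lambda>x. \<Sum>i\<in>I. f i x) (\<lambda>x. \<Sum>i\<in>I. f' i x)"
  using assms
  by (induction I rule: infinite_finite_induct)
     (simp_all add: has_mixed_weak_deriv_zero has_mixed_weak_deriv_add L2_cube.sum_mem)

lemma mixed_weak_deriv_AE:
  assumes "has_mixed_weak_deriv a b d \<alpha> f g"
  shows "AE x in cube_measure a b d. mixed_weak_deriv a b d \<alpha> f x = g x"
    and "has_mixed_weak_deriv a b d \<alpha> f (mixed_weak_deriv a b d \<alpha> f)"
proof -
  show "has_mixed_weak_deriv a b d \<alpha> f (mixed_weak_deriv a b d \<alpha> f)"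
    unfolding mixed_weak_deriv_def using assms by (rule someI[of "has_mixed_weak_deriv a b d \<alpha> f"])
  then show "AE x in cube_measure a b d. mixed_weak_deriv a b d \<alpha> f x = g x"
    using assms by (rule has_mixed_weak_deriv_unique)
qed

text \<open>Multi-indices are padded with 0, extensional functions with \<open>undefined\<close>;
  the bijection gives access to the distributive law for sums over the latter.\<close>

lemma bij_betw_multi_indices:
  "bij_betw (\<lambda>\<alpha>. restrict \<alpha> {..<d}) (multi_indices d s) ({..<d} \<rightarrow>\<^sub>E {..s})"
proof (rule bij_betwI[where g = "\<lambda>\<beta> i. if i < d then \<beta> i else 0"])
  show "(\<lambda>\<alpha>. restrict \<alpha> {..<d}) \<in> multi_indices d s \<rightarrow> ({..<d} \<rightarrow>\<^sub>E {..s})"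
    by (auto simp: multi_indices_def)
  show "(\<lambda>\<beta> i. if i < d then \<beta> i else 0) \<in> ({..<d} \<rightarrow>\<^sub>E {..s}) \<rightarrow> multi_indices d s"
    by (auto simp: multi_indices_def PiE_def Pi_def)
  show "(\<lambda>i. if i < d then restrict \<alpha> {..<d} i else 0) = \<alpha>" if "\<alpha> \<in> multi_indices d s" for \<alpha>
    using that by (auto simp: multi_indices_def fun_eq_iff)
  show "restrict (\<lambda>i. if i < d then \<beta> i else 0) {..<d} = \<beta>" if "\<beta> \<in> {..<d} \<rightarrow>\<^sub>E {..s}" for \<beta>
    using that by (auto simp: fun_eq_iff PiE_def extensional_def)
qed

lemma finite_multi_indices [simp]: "finite (multi_indices d s)"
  using bij_betw_finite[OF bij_betw_multi_indices] by (simp add: finite_PiE)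

text \<open>Distributivity is what splits the mixed scalar product, a sum over multi-indices, into
  one factor per coordinate.\<close>

lemma sum_prod_multi_indices:
  fixes h :: "nat \<Rightarrow> nat \<Rightarrow> 'a::comm_semiring_1"
  shows "(\<Sum>\<alpha>\<in>multi_indices d s. \<Prod>i<d. h i (\<alpha> i)) = (\<Prod>i<d. \<Sum>l\<le>s. h i l)"
proof -
  have "(\<Sum>\<alpha>\<in>multi_indices d s. \<Prod>i<d. h i (\<alpha> i)) = (\<Sum>\<alpha>\<in>multi_indices d s. \<Prod>i<d. h i (restrict \<alpha> {..<d} i))"
    by (intro sum.cong prod.cong refl) simp
  also have "\<dots> = (\<Sum>\<beta>\<in>{..<d} \<rightarrow>\<^sub>E {..s}. \<Prod>i<d. h i (\<beta> i))"
    by (rule sum.reindex_bij_betw[OF bij_betw_multi_indices])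
  also have "\<dots> = (\<Prod>i<d. \<Sum>l\<le>s. h i l)"
    by (subst prod_sum_PiE) simp_all
  finally show ?thesis .
qed

lemma mixed_sobolev_vecs:
  "f \<in> vecs (mixed_sobolev a b s d) \<longleftrightarrow>
    f \<in> vecs (L2_cube a b d) \<and> (\<forall>\<alpha>\<in>multi_indices d s. \<exists>g. has_mixed_weak_deriv a b d \<alpha> f g)"
  by (simp add: mixed_sobolev_def)

lemma mixed_sobolevI:
  "\<lbrakk>f \<in> vecs (L2_cube a b d); \<forall>\<alpha>\<in>multi_indices d s. has_mixed_weak_deriv a b d \<alpha> f (F \<alpha>)\<rbrakk>
    \<Longrightarrow> f \<in> vecs (mixed_sobolev a b s d)"
  unfolding mixed_sobolev_vecs by blast

text \<open>Any derivatives may stand in for the chosen ones. The choice itself is not linear in f,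
  so linearity of the scalar product has to be derived through this lemma.\<close>

lemma sprod_mixed_sobolev:
  assumes "\<forall>\<alpha>\<in>multi_indices d s. has_mixed_weak_deriv a b d \<alpha> f (F \<alpha>)"
    and "\<forall>\<alpha>\<in>multi_indices d s. has_mixed_weak_deriv a b d \<alpha> g (G \<alpha>)"
  shows "sprod (mixed_sobolev a b s d) f g = (\<Sum>\<alpha>\<in>multi_indices d s. sprod (L2_cube a b d) (F \<alpha>) (G \<alpha>))"
proof -
  have "sprod (L2_cube a b d) (mixed_weak_deriv a b d \<alpha> f) (mixed_weak_deriv a b d \<alpha> g) =
      sprod (L2_cube a b d) (F \<alpha>) (G \<alpha>)" if "\<alpha> \<in> multi_indices d s" for \<alpha>
  proof -
    note F = assms(1)[rule_format, OF that] and G = assms(2)[rule_format, OF that]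
    show ?thesis
      using mixed_weak_deriv_AE[OF F] mixed_weak_deriv_AE[OF G] F G
      unfolding L2_cube_def
      by (intro sprod_L2_cong_AE) (simp_all add: has_mixed_weak_deriv_def L2_cube_def)
  qed
  then show ?thesis by (simp add: mixed_sobolev_def)
qed

lemma mixed_sobolev_derivs:
  assumes "f \<in> vecs (mixed_sobolev a b s d)" "\<alpha> \<in> multi_indices d s"
  shows "has_mixed_weak_deriv a b d \<alpha> f (mixed_weak_deriv a b d \<alpha> f)"
  using assms mixed_weak_deriv_AE(2) unfolding mixed_sobolev_vecs by blast

lemma mixed_sobolev_derivs_all:
  "f \<in> vecs (mixed_sobolev a b s d) \<Longrightarrow>
    \<forall>\<alpha>\<in>multi_indices d s. has_mixed_weak_deriv a b d \<alpha> f (mixed_weak_deriv a b d \<alpha> f)"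
  by (intro ballI mixed_sobolev_derivs)

lemma mixed_sobolev_L2: "f \<in> vecs (mixed_sobolev a b s d) \<Longrightarrow> f \<in> vecs (L2_cube a b d)"
  by (simp add: mixed_sobolev_vecs)

lemma semi_inner_space_mixed_sobolev: "semi_inner_space (mixed_sobolev a b s d)"
proof
  let ?X = "mixed_sobolev a b s d" and ?D = "mixed_weak_deriv a b d"
  show "(\<lambda>x. 0) \<in> vecs ?X"
    by (rule mixed_sobolevI[OF L2_cube.zero_mem ballI[OF has_mixed_weak_deriv_zero]])
  fix f g h :: "(nat \<Rightarrow> real) \<Rightarrow> complex" and c assume f: "f \<in> vecs ?X"
  note Df = mixed_sobolev_derivs_all[OF f]
  note Df2 = has_mixed_weak_deriv_L2[OF mixed_sobolev_derivs[OF f]]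
  have cf: "\<forall>\<alpha>\<in>multi_indices d s. has_mixed_weak_deriv a b d \<alpha> (\<lambda>x. c * f x) (\<lambda>x. c * ?D \<alpha> f x)"
    by (intro ballI has_mixed_weak_deriv_cmult Df[rule_format])
  show "(\<lambda>x. c * f x) \<in> vecs ?X"
    by (rule mixed_sobolevI[OF L2_cube.cmult_mem[OF mixed_sobolev_L2[OF f]] cf])
  show "0 \<le> Re (sprod ?X f f)"
    unfolding sprod_mixed_sobolev[OF Df Df] Re_sum
    by (intro sum_nonneg L2_cube.sprod_nonneg Df2)
  { assume g: "g \<in> vecs ?X"
    note Dg = mixed_sobolev_derivs_all[OF g]
    note Dg2 = has_mixed_weak_deriv_L2[OF mixed_sobolev_derivs[OF g]]
    have fg: "\<forall>\<alpha>\<in>multi_indices d s. has_mixed_weak_deriv a b d \<alpha> (\<lambda>x. f x + g x) (\<lambda>x. ?D \<alpha> f x + ?D \<alpha> g x)"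
      by (intro ballI has_mixed_weak_deriv_add mixed_sobolev_L2[OF f] mixed_sobolev_L2[OF g] Df[rule_format] Dg[rule_format])
    show "(\<lambda>x. f x + g x) \<in> vecs ?X"
      by (rule mixed_sobolevI[OF L2_cube.add_mem[OF mixed_sobolev_L2[OF f] mixed_sobolev_L2[OF g]] fg])
    show "sprod ?X g f = cnj (sprod ?X f g)"
      unfolding sprod_mixed_sobolev[OF Df Dg] sprod_mixed_sobolev[OF Dg Df] cnj_sum
      by (intro sum.cong refl L2_cube.sprod_commute Df2 Dg2)
    assume h: "h \<in> vecs ?X"
    note Dh = mixed_sobolev_derivs_all[OF h]
    note Dh2 = has_mixed_weak_deriv_L2[OF mixed_sobolev_derivs[OF h]]
    show "sprod ?X (\<lambda>x. f x + g x) h = sprod ?X f h + sprod ?X g h"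
      unfolding sprod_mixed_sobolev[OF fg Dh] sprod_mixed_sobolev[OF Df Dh] sprod_mixed_sobolev[OF Dg Dh]
        sum.distrib[symmetric]
      by (intro sum.cong refl L2_cube.sprod_add_left Df2 Dg2 Dh2)
  }
  assume h: "h \<in> vecs ?X"
  note Dh = mixed_sobolev_derivs_all[OF h]
  note Dh2 = has_mixed_weak_deriv_L2[OF mixed_sobolev_derivs[OF h]]
  show "sprod ?X (\<lambda>x. c * f x) h = c * sprod ?X f h"
    unfolding sprod_mixed_sobolev[OF cf Dh] sprod_mixed_sobolev[OF Df Dh] sum_distrib_left
    by (intro sum.cong refl L2_cube.sprod_cmult_left Df2 Dh2)
qed

interpretation mixed: semi_inner_space "mixed_sobolev a b s d" for a b s d
  by (rule semi_inner_space_mixed_sobolev)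

lemma hnorm_mixed_sobolev:
  assumes f: "f \<in> vecs (mixed_sobolev a b s d)"
    and F: "\<forall>\<alpha>\<in>multi_indices d s. has_mixed_weak_deriv a b d \<alpha> f (F \<alpha>)"
  shows "(hnorm (mixed_sobolev a b s d) f)\<^sup>2 = (\<Sum>\<alpha>\<in>multi_indices d s. (hnorm (L2_cube a b d) (F \<alpha>))\<^sup>2)"
proof -
  have "complex_of_real ((hnorm (mixed_sobolev a b s d) f)\<^sup>2) =
      (\<Sum>\<alpha>\<in>multi_indices d s. of_real ((hnorm (L2_cube a b d) (F \<alpha>))\<^sup>2))"
    unfolding mixed.sprod_self[OF f, symmetric] sprod_mixed_sobolev[OF F F]
    by (intro sum.cong refl L2_cube.sprod_self has_mixed_weak_deriv_L2[OF F[rule_format]])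
  then show ?thesis by (simp only: of_real_sum[symmetric] of_real_eq_iff)
qed

text \<open>A single summand is at most the whole squared norm. The resulting continuity of weak
  differentiation carries identities from algebraic tensors to their closure.\<close>

lemma hnorm_deriv_le:
  assumes f: "f \<in> vecs (mixed_sobolev a b s d)" and \<alpha>: "\<alpha> \<in> multi_indices d s"
    and g: "has_mixed_weak_deriv a b d \<alpha> f g"
  shows "hnorm (L2_cube a b d) g \<le> hnorm (mixed_sobolev a b s d) f"
proof (rule power2_le_imp_le)
  define F where "F = (\<lambda>\<beta>. if \<beta> = \<alpha> then g else mixed_weak_deriv a b d \<beta> f)"
  have F: "\<forall>\<beta>\<in>multi_indices d s. has_mixed_weak_deriv a b d \<beta> f (F \<beta>)"
    using mixed_sobolev_derivs[OF f] g by (simp add: F_def)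
  have "(hnorm (L2_cube a b d) (F \<alpha>))\<^sup>2 \<le> (\<Sum>\<beta>\<in>multi_indices d s. (hnorm (L2_cube a b d) (F \<beta>))\<^sup>2)"
    by (rule member_le_sum[OF \<alpha>]) simp_all
  then show "(hnorm (L2_cube a b d) g)\<^sup>2 \<le> (hnorm (mixed_sobolev a b s d) f)\<^sup>2"
    unfolding hnorm_mixed_sobolev[OF f F] by (simp add: F_def)
qed (rule mixed.hnorm_nonneg[OF f])

lemma zero_multi_index: "(\<lambda>_. 0) \<in> multi_indices d s"
  by (simp add: multi_indices_def)

lemma has_mixed_weak_deriv_0: "f \<in> vecs (L2_cube a b d) \<Longrightarrow> has_mixed_weak_deriv a b d (\<lambda>_. 0) f f"
  by (simp add: has_mixed_weak_deriv_def)

lemma hnorm_L2_le_mixed: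
  "f \<in> vecs (mixed_sobolev a b s d) \<Longrightarrow> hnorm (L2_cube a b d) f \<le> hnorm (mixed_sobolev a b s d) f"
  by (rule hnorm_deriv_le[OF _ zero_multi_index has_mixed_weak_deriv_0[OF mixed_sobolev_L2]])

section \<open>Approximation numbers\<close>

text \<open>Gaussian elimination. It takes the place of dimension theory for functions that are read
  modulo distance 0.\<close>

lemma underdetermined_system:
  fixes c :: "'i \<Rightarrow> nat \<Rightarrow> 'k::field"
  assumes "finite I" "m < card I"
  shows "\<exists>a. (\<exists>i\<in>I. a i \<noteq> 0) \<and> (\<forall>j<m. (\<Sum>i\<in>I. a i * c i j) = 0)"
  using assms
proof (induction m arbitrary: I c)
  case 0
  then have "I \<noteq> {}" by auto
  then show ?case by (intro exI[of _ "\<lambda>_. 1"]) auto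
next
  case (Suc m)
  show ?case
  proof (cases "\<forall>i\<in>I. c i m = 0")
    case True
    obtain a where a: "\<exists>i\<in>I. a i \<noteq> 0" "\<forall>j<m. (\<Sum>i\<in>I. a i * c i j) = 0"
      using Suc.IH[of I c] Suc.prems by auto
    have "(\<Sum>i\<in>I. a i * c i j) = 0" if "j < Suc m" for j
      using a(2) True that by (cases "j = m") (auto intro: sum.neutral)
    then show ?thesis using a(1) by blast
  next
    case False
    then obtain p where p: "p \<in> I" "c p m \<noteq> 0" by blast
    \<comment> \<open>The pivot p clears the unknown p from the first m equations by means of
      equation m; afterwards the value at p is set so that equation m holds.\<close>
    define c' where "c' i j = c i j - c i m / c p m * c p j" for i j
    have "m < card (I - {p})" using Suc.prems p by simp
    then obtain a where a: "\<exists>i\<in>I - {p}. a i \<noteq> 0" "\<forall>j<m. (\<Sum>i\<in>I - {p}. a i * c' i j) = 0"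
      using Suc.IH[of "I - {p}" c'] Suc.prems by auto
    define s where "s = (\<Sum>i\<in>I - {p}. a i * c i m)"
    define a' where "a' = a(p := - s / c p m)"
    have split: "(\<Sum>i\<in>I. a' i * c i j) = - s / c p m * c p j + (\<Sum>i\<in>I - {p}. a i * c i j)" for j
      using p Suc.prems by (subst sum.remove[of I p]) (auto simp: a'_def intro!: sum.cong)
    have "(\<Sum>i\<in>I. a' i * c i j) = 0" if "j < Suc m" for j
    proof (cases "j = m")
      case True
      then show ?thesis unfolding split using p by (simp add: s_def)
    next
      case False
      then have "(\<Sum>i\<in>I - {p}. a i * c' i j) = 0" using a(2) that by auto
      moreover have "(\<Sum>i\<in>I - {p}. a i * c' i j) =
          (\<Sum>i\<in>I - {p}. a i * c i j) - (\<Sum>i\<in>I - {p}. a i * c i m * (c p j / c p m))"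
        unfolding sum_subtractf[symmetric] by (rule sum.cong) (simp_all add: c'_def algebra_simps)
      moreover have "(\<Sum>i\<in>I - {p}. a i * c i m * (c p j / c p m)) = s * (c p j / c p m)"
        by (simp only: s_def sum_distrib_right)
      ultimately show ?thesis unfolding split by simp
    qed
    moreover have "\<exists>i\<in>I. a' i \<noteq> 0"
      using a(1) by (auto simp: a'_def)
    ultimately show ?thesis by blast
  qed
qed

text \<open>The embedding is the identity on functions. For the tensor powers its norm is at most 1
  because the squared mixed norm contains the squared L2 norm as the term \<alpha> = 0.\<close>

locale contractive_embedding = X: semi_inner_space X + Y: semi_inner_space Y
  for X Y :: "'a hspace" +
  assumes emb: "f \<in> vecs X \<Longrightarrow> f \<in> vecs Y" and le: "f \<in> vecs X \<Longrightarrow> hnorm Y f \<le> hnorm X f"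
begin

lemma bounded_linear_opD:
  assumes "bounded_linear_op X Y A"
  shows "f \<in> vecs X \<Longrightarrow> A f \<in> vecs Y"
    and "\<lbrakk>f \<in> vecs X; g \<in> vecs X\<rbrakk> \<Longrightarrow> hdist Y (A (\<lambda>x. f x + g x)) (\<lambda>y. A f y + A g y) = 0"
    and "f \<in> vecs X \<Longrightarrow> hdist Y (A (\<lambda>x. c * f x)) (\<lambda>y. c * A f y) = 0"
  using assms unfolding bounded_linear_op_def by blast+

text \<open>A real supremum is an upper bound of its set only if the set is bounded above; the
  constant K of A provides that.\<close>

lemma op_norm_ge:
  assumes A: "bounded_linear_op X Y A" and f: "f \<in> vecs X" "hnorm X f \<le> 1"
  shows "hnorm Y (\<lambda>y. f y - A f y) \<le> op_norm X Y (\<lambda>f y. f y - A f y)"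
proof -
  obtain K where K: "\<And>f. f \<in> vecs X \<Longrightarrow> hnorm Y (A f) \<le> K * hnorm X f"
    using A unfolding bounded_linear_op_def by blast
  \<comment> \<open>1 bounds the embedding on the unit ball; the absolute value is taken since
    nothing fixes the sign of K.\<close>
  have "hnorm Y (\<lambda>y. f y - A f y) \<le> 1 + \<bar>K\<bar>" if f: "f \<in> vecs X" "hnorm X f \<le> 1" for f
  proof -
    have "hnorm Y (\<lambda>y. f y + (-1) * A f y) \<le> hnorm Y f + hnorm Y (\<lambda>y. (-1) * A f y)"
      by (intro Y.hnorm_triangle emb f(1) Y.cmult_mem bounded_linear_opD(1)[OF A])
    also have "hnorm Y (\<lambda>y. (-1) * A f y) = hnorm Y (A f)"
      using Y.hnorm_cmult[OF bounded_linear_opD(1)[OF A f(1)], of "-1"] by simp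
    also have "hnorm Y f \<le> 1" using le[OF f(1)] f(2) by simp
    also have "hnorm Y (A f) \<le> K * hnorm X f" by (rule K[OF f(1)])
    also have "K * hnorm X f \<le> \<bar>K\<bar> * 1"
      using f X.hnorm_nonneg[OF f(1)] by (intro mult_mono) auto
    finally show ?thesis by simp
  qed
  then have "bdd_above ((\<lambda>f. hnorm Y (\<lambda>y. f y - A f y)) ` {f \<in> vecs X. hnorm X f \<le> 1})"
    by (intro bdd_aboveI2[of _ _ "1 + \<bar>K\<bar>"]) simp
  then show ?thesis
    unfolding op_norm_def using f by (intro cSUP_upper) simp_all
qed

lemma op_norm_nonneg:
  assumes "bounded_linear_op X Y A"
  shows "0 \<le> op_norm X Y (\<lambda>f y. f y - A f y)"
proof -
  have "0 \<le> hnorm Y (\<lambda>y. (\<lambda>x. 0) y - A (\<lambda>x. 0) y)"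
    by (intro Y.hnorm_nonneg Y.diff_mem Y.zero_mem bounded_linear_opD(1)[OF assms] X.zero_mem)
  also have "\<dots> \<le> op_norm X Y (\<lambda>f y. f y - A f y)"
    by (rule op_norm_ge[OF assms X.zero_mem]) (simp add: X.hnorm_zero)
  finally show ?thesis .
qed

lemma approx_number_le:
  assumes A: "bounded_linear_op X Y A" "op_rank X Y A < enat n"
    and le: "\<And>f. \<lbrakk>f \<in> vecs X; hnorm X f \<le> 1\<rbrakk> \<Longrightarrow> hnorm Y (\<lambda>y. f y - A f y) \<le> \<epsilon>"
  shows "approx_number X Y (\<lambda>f. f) n \<le> \<epsilon>"
proof -
  have "op_norm X Y (\<lambda>f y. f y - A f y) \<le> \<epsilon>"
    unfolding op_norm_def
    using X.zero_mem X.hnorm_zero by (intro cSUP_least) (auto intro: le)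
  then show ?thesis
    unfolding approx_number_def
    by (intro cInf_lower2[of "op_norm X Y (\<lambda>f y. f y - A f y)"] bdd_belowI[of _ 0])
       (use A op_norm_nonneg in blast)+
qed

text \<open>A is additive and homogeneous only up to distance 0, so finite sums need an induction
  with triangle inequalities.\<close>

lemma bounded_linear_op_combination:
  assumes A: "bounded_linear_op X Y A" and "finite I" "\<And>i. i \<in> I \<Longrightarrow> e i \<in> vecs X"
  shows "hdist Y (A (\<lambda>x. \<Sum>i\<in>I. c i * e i x)) (\<lambda>y. \<Sum>i\<in>I. c i * A (e i) y) = 0"
  using assms(2,3)
proof (induction I rule: finite_induct)
  case empty
  then show ?case using bounded_linear_opD(3)[OF A X.zero_mem, of 0] by simp
next
  case (insert i I)
  let ?s = "\<lambda>x. \<Sum>i\<in>I. c i * e i x" and ?t = "\<lambda>y. \<Sum>i\<in>I. c i * A (e i) y"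
  have s: "?s \<in> vecs X" "(\<lambda>x. c i * e i x) \<in> vecs X" "e i \<in> vecs X"
    using insert.prems by (auto intro!: X.sum_mem X.cmult_mem)
  have t: "?t \<in> vecs Y"
    using insert.prems by (auto intro!: Y.sum_mem Y.cmult_mem bounded_linear_opD(1)[OF A])
  have sum: "(\<lambda>x. \<Sum>i\<in>insert i I. c i * e i x) = (\<lambda>x. c i * e i x + ?s x)"
    "(\<lambda>y. \<Sum>i\<in>insert i I. c i * A (e i) y) = (\<lambda>y. c i * A (e i) y + ?t y)"
    using insert.hyps by simp_all
  have "hdist Y (A (\<lambda>x. c i * e i x + ?s x)) (\<lambda>y. c i * A (e i) y + ?t y)
     \<le> hdist Y (A (\<lambda>x. c i * e i x + ?s x)) (\<lambda>y. A (\<lambda>x. c i * e i x) y + A ?s y) +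
       hdist Y (\<lambda>y. A (\<lambda>x. c i * e i x) y + A ?s y) (\<lambda>y. c i * A (e i) y + ?t y)"
    by (intro Y.hdist_triangle bounded_linear_opD(1)[OF A] X.add_mem s Y.add_mem t Y.cmult_mem)
  also have "hdist Y (A (\<lambda>x. c i * e i x + ?s x)) (\<lambda>y. A (\<lambda>x. c i * e i x) y + A ?s y) = 0"
    by (rule bounded_linear_opD(2)[OF A s(2,1)])
  also have "hdist Y (\<lambda>y. A (\<lambda>x. c i * e i x) y + A ?s y) (\<lambda>y. c i * A (e i) y + ?t y)
     = hnorm Y (\<lambda>y. (A (\<lambda>x. c i * e i x) y - c i * A (e i) y) + (A ?s y - ?t y))"
    by (simp add: hdist_def algebra_simps)
  also have "\<dots> \<le> hdist Y (A (\<lambda>x. c i * e i x)) (\<lambda>y. c i * A (e i) y) + hdist Y (A ?s) ?t"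
    unfolding hdist_def
    by (intro Y.hnorm_triangle Y.diff_mem bounded_linear_opD(1)[OF A] s Y.cmult_mem t)
  also have "\<dots> = 0"
    using insert bounded_linear_opD(3)[OF A s(3), of "c i"] by simp
  finally have "hdist Y (A (\<lambda>x. c i * e i x + ?s x)) (\<lambda>y. c i * A (e i) y + ?t y) \<le> 0" by simp
  moreover have "0 \<le> hdist Y (A (\<lambda>x. c i * e i x + ?s x)) (\<lambda>y. c i * A (e i) y + ?t y)"
    by (intro Y.hdist_nonneg bounded_linear_opD(1)[OF A] X.add_mem s Y.add_mem t Y.cmult_mem)
  ultimately show ?case unfolding sum by simp
qed

text \<open>An operator of rank less than \<open>n\<close> annihilates a nonzero vector of the span of \<open>n\<close> orthogonal
  vectors, on which the ratio of the two norms is constant.\<close>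

lemma approx_number_ge:
  assumes I: "finite I" "n \<le> card I" "1 \<le> n" and e: "\<And>i. i \<in> I \<Longrightarrow> e i \<in> vecs X"
    and orthX: "\<And>i j. \<lbrakk>i \<in> I; j \<in> I; i \<noteq> j\<rbrakk> \<Longrightarrow> sprod X (e i) (e j) = 0"
    and orthY: "\<And>i j. \<lbrakk>i \<in> I; j \<in> I; i \<noteq> j\<rbrakk> \<Longrightarrow> sprod Y (e i) (e j) = 0"
    and normY: "\<And>i. i \<in> I \<Longrightarrow> hnorm Y (e i) = r" and r: "r > 0"
    and normX: "\<And>i. i \<in> I \<Longrightarrow> hnorm X (e i) = \<kappa> * r" and \<kappa>: "\<kappa> > 0"
  shows "1 / \<kappa> \<le> approx_number X Y (\<lambda>f. f) n"
  unfolding approx_number_def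
proof (rule cInf_greatest)
  \<comment> \<open>The zero operator has rank 0 < n, so the infimum runs over a nonempty
    set.\<close>
  have "bounded_linear_op X Y (\<lambda>f y. 0)"
    by (auto simp: bounded_linear_op_def hdist_def Y.zero_mem Y.hnorm_zero intro!: exI[of _ 0])
  moreover have "op_rank X Y (\<lambda>f y. 0) \<le> enat 0"
    unfolding op_rank_def
    by (intro Inf_lower CollectI exI[of _ "0::nat"]) (auto simp: hdist_def Y.hnorm_zero)
  then have "op_rank X Y (\<lambda>f y. 0) < enat n"
    using I(3) by (simp add: zero_enat_def[symmetric] enat_0_iff)
  ultimately show "{op_norm X Y (\<lambda>f y. f y - A f y) |A. bounded_linear_op X Y A \<and> op_rank X Y A < enat n} \<noteq> {}"
    by blast
next
  fix x assume "x \<in> {op_norm X Y (\<lambda>f y. f y - A f y) |A. bounded_linear_op X Y A \<and> op_rank X Y A < enat n}"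
  then obtain A where x: "x = op_norm X Y (\<lambda>f y. f y - A f y)"
    and A: "bounded_linear_op X Y A" "op_rank X Y A < enat n" by blast
  obtain m and g :: "nat \<Rightarrow> 'a \<Rightarrow> complex" where m: "m < n" and g: "\<forall>j<m. g j \<in> A ` vecs X"
    and span: "\<forall>f\<in>vecs X. \<exists>c :: nat \<Rightarrow> complex. hdist Y (A f) (\<lambda>y. \<Sum>j<m. c j * g j y) = 0"
    using A(2) unfolding op_rank_def Inf_less_iff by auto
  have "\<exists>c. \<forall>i\<in>I. hdist Y (A (e i)) (\<lambda>y. \<Sum>j<m. c i j * g j y) = 0"
    using span e by (intro bchoice) blast
  then obtain c where c: "\<And>i. i \<in> I \<Longrightarrow> hdist Y (A (e i)) (\<lambda>y. \<Sum>j<m. c i j * g j y) = 0"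
    by blast
  have "m < card I" using m I(2) by simp
  \<comment> \<open>m equations in at least n > m unknowns: w is a nontrivial combination whose
    image under A has distance 0 from 0.\<close>
  then obtain w where w: "\<exists>i\<in>I. w i \<noteq> 0" "\<And>j. j < m \<Longrightarrow> (\<Sum>i\<in>I. w i * c i j) = 0"
    using underdetermined_system[OF I(1), of m c] by blast
  define v where "v = (\<lambda>x. \<Sum>i\<in>I. w i * e i x)"
  have v: "v \<in> vecs X" unfolding v_def by (intro X.sum_mem X.cmult_mem e)
  have gY: "(\<lambda>y. \<Sum>j<m. b j * g j y) \<in> vecs Y" for b
    using g bounded_linear_opD(1)[OF A(1)] by (intro Y.sum_mem Y.cmult_mem) auto
  have AeY: "A (e i) \<in> vecs Y" if "i \<in> I" for i
    by (intro bounded_linear_opD(1)[OF A(1)] e that)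
  define h where "h = (\<lambda>i y. \<Sum>j<m. c i j * g j y)"
  have hY: "h i \<in> vecs Y" for i unfolding h_def by (rule gY)
  have "hdist Y (A v) (\<lambda>y. 0) = 0"
  proof -
    have "hdist Y (A v) (\<lambda>y. \<Sum>i\<in>I. w i * h i y) \<le>
        hdist Y (A v) (\<lambda>y. \<Sum>i\<in>I. w i * A (e i) y) +
        hdist Y (\<lambda>y. \<Sum>i\<in>I. w i * A (e i) y) (\<lambda>y. \<Sum>i\<in>I. w i * h i y)"
      by (intro Y.hdist_triangle bounded_linear_opD(1)[OF A(1)] v Y.sum_mem Y.cmult_mem AeY hY)
    also have "hdist Y (A v) (\<lambda>y. \<Sum>i\<in>I. w i * A (e i) y) = 0"
      unfolding v_def by (rule bounded_linear_op_combination[OF A(1) I(1) e])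
    also have "hdist Y (\<lambda>y. \<Sum>i\<in>I. w i * A (e i) y) (\<lambda>y. \<Sum>i\<in>I. w i * h i y) \<le>
        (\<Sum>i\<in>I. hdist Y (\<lambda>y. w i * A (e i) y) (\<lambda>y. w i * h i y))"
      by (intro Y.hdist_sum Y.cmult_mem AeY hY)
    also have "\<dots> = (\<Sum>i\<in>I. cmod (w i) * hdist Y (A (e i)) (h i))"
      unfolding hdist_def right_diff_distrib[symmetric]
      by (intro sum.cong refl Y.hnorm_cmult Y.diff_mem AeY hY)
    also have "\<dots> = 0" using c by (intro sum.neutral) (simp add: h_def)
    finally have "hdist Y (A v) (\<lambda>y. \<Sum>i\<in>I. w i * h i y) \<le> 0" by simp
    moreover have "0 \<le> hdist Y (A v) (\<lambda>y. \<Sum>i\<in>I. w i * h i y)"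
      by (intro Y.hdist_nonneg bounded_linear_opD(1)[OF A(1)] v Y.sum_mem Y.cmult_mem hY)
    moreover have "(\<lambda>y. \<Sum>i\<in>I. w i * h i y) = (\<lambda>y. 0)"
    proof
      fix y
      have "(\<Sum>i\<in>I. w i * h i y) = (\<Sum>i\<in>I. \<Sum>j<m. w i * c i j * g j y)"
        by (simp add: h_def sum_distrib_left mult.assoc)
      also have "\<dots> = (\<Sum>j<m. \<Sum>i\<in>I. w i * c i j * g j y)" by (rule sum.swap)
      also have "\<dots> = (\<Sum>j<m. (\<Sum>i\<in>I. w i * c i j) * g j y)" by (simp only: sum_distrib_right)
      also have "\<dots> = 0" using w(2) by (intro sum.neutral) simp
      finally show "(\<Sum>i\<in>I. w i * h i y) = 0" .
    qed
    ultimately show ?thesis by simp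
  qed
  then have Av: "hnorm Y (A v) = 0" by (simp add: hdist_def)
  define W where "W = (\<Sum>i\<in>I. (cmod (w i))\<^sup>2)"
  have W: "W > 0"
  proof -
    obtain i where "i \<in> I" "w i \<noteq> 0" using w(1) by blast
    then show ?thesis unfolding W_def using I(1) by (intro sum_pos2[of I i]) auto
  qed
  have "(hnorm Y v)\<^sup>2 = r\<^sup>2 * W"
    unfolding v_def W_def using Y.Pythagoras[of I e w, OF I(1) emb[OF e] orthY]
    by (simp add: normY sum_distrib_left mult.commute cong: sum.cong)
  moreover have "(hnorm X v)\<^sup>2 = (\<kappa> * r)\<^sup>2 * W"
    unfolding v_def W_def using X.Pythagoras[of I e w, OF I(1) e orthX]
    by (simp add: normX sum_distrib_left mult.commute cong: sum.cong)
  ultimately have "(hnorm X v)\<^sup>2 = (\<kappa> * hnorm Y v)\<^sup>2"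
    by (simp add: power_mult_distrib)
  then have Xv: "hnorm X v = \<kappa> * hnorm Y v"
    using X.hnorm_nonneg[OF v] Y.hnorm_nonneg[OF emb[OF v]] \<kappa> by (simp add: power2_eq_iff_nonneg)
  have "hnorm Y v \<noteq> 0" using \<open>(hnorm Y v)\<^sup>2 = r\<^sup>2 * W\<close> W r by auto
  then have Yv: "hnorm Y v > 0" using Y.hnorm_nonneg[OF emb[OF v]] by simp
  have pos: "hnorm X v > 0" unfolding Xv using Yv \<kappa> by simp
  \<comment> \<open>Normalised to norm 1 in X, the vector has norm 1/\<kappa> in Y, and A maps it to
    a vector of norm 0. Hence the error there is at least 1/\<kappa>.\<close>
  define t where "t = complex_of_real (1 / hnorm X v)"
  have u: "(\<lambda>x. t * v x) \<in> vecs X" by (intro X.cmult_mem v)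
  have "hnorm X (\<lambda>x. t * v x) = 1"
    using X.hnorm_cmult[OF v, of t] pos by (simp add: t_def norm_divide)
  then have "hnorm Y (\<lambda>y. t * v y - A (\<lambda>x. t * v x) y) \<le> x"
    unfolding x using op_norm_ge[OF A(1) u] by simp
  moreover have "1 / \<kappa> \<le> hnorm Y (\<lambda>y. t * v y - A (\<lambda>x. t * v x) y)"
  proof -
    have "hnorm Y (A (\<lambda>x. t * v x)) \<le> hnorm Y (\<lambda>y. t * A v y) + hdist Y (A (\<lambda>x. t * v x)) (\<lambda>y. t * A v y)"
      by (intro Y.hnorm_le_hdist bounded_linear_opD(1)[OF A(1)] u v Y.cmult_mem)
    also have "\<dots> = 0"
      using bounded_linear_opD(3)[OF A(1) v, of t] Y.hnorm_cmult[OF bounded_linear_opD(1)[OF A(1) v], of t]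
      by (simp add: Av)
    finally have "hnorm Y (A (\<lambda>x. t * v x)) \<le> 0" .
    moreover have "hnorm Y (\<lambda>x. t * v x) \<le> hnorm Y (A (\<lambda>x. t * v x)) + hdist Y (\<lambda>x. t * v x) (A (\<lambda>x. t * v x))"
      by (intro Y.hnorm_le_hdist bounded_linear_opD(1)[OF A(1)] u emb)
    moreover have "hnorm Y (\<lambda>x. t * v x) = 1 / \<kappa>"
      using Y.hnorm_cmult[OF emb[OF v], of t] Yv \<kappa> by (simp add: t_def norm_divide norm_mult Xv)
    ultimately show ?thesis by (simp add: hdist_def)
  qed
  ultimately show "1 / \<kappa> \<le> x" by simp
qed

text \<open>Only the error estimate is left to the applications: the projection is linear,
  contractive by Pythagoras, and its rank is at most the number of vectors.\<close>

lemma approx_number_le_projection: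
  assumes K: "finite K" "card K < n" and e: "\<And>k. k \<in> K \<Longrightarrow> e k \<in> vecs X"
    and norm: "\<And>k. k \<in> K \<Longrightarrow> hnorm Y (e k) = r" and r: "r > 0"
    and orth: "\<And>k l. \<lbrakk>k \<in> K; l \<in> K; k \<noteq> l\<rbrakk> \<Longrightarrow> sprod Y (e k) (e l) = 0"
    and le: "\<And>f. \<lbrakk>f \<in> vecs X; hnorm X f \<le> 1\<rbrakk> \<Longrightarrow> hnorm Y (\<lambda>x. f x - Y.projection r e K f x) \<le> \<epsilon>"
  shows "approx_number X Y (\<lambda>f. f) n \<le> \<epsilon>"
proof (rule approx_number_le[OF _ _ le])
  let ?A = "Y.projection r e K"
  note eY = emb[OF e]
  show "bounded_linear_op X Y ?A"
    unfolding bounded_linear_op_def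
  proof (intro conjI ballI allI)
    fix f assume f: "f \<in> vecs X"
    show "?A f \<in> vecs Y" by (rule Y.projection_mem[OF K(1) eY r norm orth])
    fix c
    have "?A (\<lambda>x. c * f x) = (\<lambda>y. c * ?A f y)"
      unfolding Y.projection_def sum_distrib_left
      by (intro ext sum.cong refl) (simp add: Y.sprod_cmult_left emb[OF f] eY)
    then show "hdist Y (?A (\<lambda>x. c * f x)) (\<lambda>y. c * ?A f y) = 0"
      by (simp add: hdist_def Y.hnorm_zero)
    fix g assume g: "g \<in> vecs X"
    have "?A (\<lambda>x. f x + g x) = (\<lambda>y. ?A f y + ?A g y)"
      unfolding Y.projection_def sum.distrib[symmetric]
      by (intro ext sum.cong refl)
         (simp add: Y.sprod_add_left emb[OF f] emb[OF g] eY add_divide_distrib distrib_right)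
    then show "hdist Y (?A (\<lambda>x. f x + g x)) (\<lambda>y. ?A f y + ?A g y) = 0"
      by (simp add: hdist_def Y.hnorm_zero)
  next
    have "hnorm Y (?A f) \<le> 1 * hnorm X f" if f: "f \<in> vecs X" for f
    proof -
      have "(hnorm Y (?A f))\<^sup>2 \<le> (hnorm Y f)\<^sup>2"
      proof -
        have "(hnorm Y (?A f))\<^sup>2 = r\<^sup>2 * (\<Sum>l\<in>K. (cmod (sprod Y f (e l) / of_real (r\<^sup>2)))\<^sup>2)"
          unfolding Y.projection_def by (rule Y.hnorm_combination_sq[OF K(1) eY r norm orth])
        also have "\<dots> \<le> (hnorm Y f)\<^sup>2"
          using Y.hnorm_minus_combination_sq[OF K(1) eY r norm orth emb[OF f], where c = "\<lambda>_. 0"] by simp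
        finally show ?thesis .
      qed
      then have "hnorm Y (?A f) \<le> hnorm Y f"
        by (rule power2_le_imp_le) (rule Y.hnorm_nonneg[OF emb[OF f]])
      then show ?thesis using le[OF f] contractive_embedding.le[OF contractive_embedding_axioms f] by simp
    qed
    then show "\<exists>K. \<forall>f\<in>vecs X. hnorm Y (?A f) \<le> K * hnorm X f" by blast
  qed
  have "op_rank X Y ?A \<le> enat (card K)"
    unfolding op_rank_def
  proof (intro Inf_lower CollectI exI[of _ "card K"] conjI refl)
    obtain k where k: "bij_betw k {..<card K} K"
      using ex_bij_betw_nat_finite[OF K(1)] by (auto simp: atLeast0LessThan)
    have "e (k j) = ?A (e (k j))" if "j < card K" for j
    proof -
      have kj: "k j \<in> K" using k that by (auto simp: bij_betw_def)
      \<comment> \<open>Indicator coefficients write the vector as a combination, which the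
        projection fixes; the definition of rank wants spanning vectors from the range.\<close>
      have sum: "(\<lambda>x. \<Sum>l\<in>K. (if l = k j then 1 else 0) * e l x) = e (k j)"
        using kj K(1) by (simp add: if_distrib[of "\<lambda>c. c * _"] cong: if_cong)
      have "?A (\<lambda>x. \<Sum>l\<in>K. (if l = k j then 1 else 0) * e l x) =
          (\<lambda>x. \<Sum>l\<in>K. (if l = k j then 1 else 0) * e l x)"
        by (rule Y.projection_combination[OF K(1) _ r]) (use eY norm orth in blast)+
      then show ?thesis unfolding sum by (rule sym)
    qed
    then have "\<forall>j<card K. e (k j) \<in> ?A ` vecs X"
      using e k by (auto simp: bij_betw_def intro!: image_eqI[of _ ?A])
    moreover have "\<exists>c :: nat \<Rightarrow> complex. hdist Y (?A f) (\<lambda>y. \<Sum>j<card K. c j * e (k j) y) = 0" for f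
    proof (intro exI)
      have "(\<lambda>y. \<Sum>j<card K. (sprod Y f (e (k j)) / of_real (r\<^sup>2)) * e (k j) y) = ?A f"
        unfolding Y.projection_def by (intro ext sum.reindex_bij_betw[OF k])
      then show "hdist Y (?A f) (\<lambda>y. \<Sum>j<card K. (sprod Y f (e (k j)) / of_real (r\<^sup>2)) * e (k j) y) = 0"
        by (simp add: hdist_def Y.hnorm_zero)
    qed
    ultimately show "\<exists>g :: nat \<Rightarrow> 'a \<Rightarrow> complex. (\<forall>j<card K. g j \<in> ?A ` vecs X) \<and>
        (\<forall>f\<in>vecs X. \<exists>c. hdist Y (?A f) (\<lambda>y. \<Sum>j<card K. c j * g j y) = 0)"
      by (intro exI[of _ "\<lambda>j. e (k j)"]) simp
  qed
  also have "\<dots> < enat n" using K(2) by simp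
  finally show "op_rank X Y ?A < enat n" .
qed

end

text \<open>Bounding all n up to N, rather than N alone, spares an appeal to monotonicity of the
  approximation numbers. An infinite set counts as \<infinity>, so that case is immediate.\<close>

lemma info_complexity_ge:
  assumes "\<And>n. \<lbrakk>1 \<le> n; n \<le> N\<rbrakk> \<Longrightarrow> \<epsilon> \<le> approx_number X Y T n"
  shows "enat N \<le> info_complexity X Y T \<epsilon>"
proof -
  let ?N = "{n. n \<ge> 1 \<and> approx_number X Y T n \<ge> \<epsilon>}"
  have "{1..N} \<subseteq> ?N" using assms by auto
  then have "finite ?N \<Longrightarrow> N \<le> card ?N" using card_mono[of ?N "{1..N}"] by simp
  then show ?thesis by (simp add: info_complexity_def Let_def)
qed

lemma info_complexity_le:
  assumes "\<And>n. n > N \<Longrightarrow> approx_number X Y T n < \<epsilon>"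
  shows "info_complexity X Y T \<epsilon> \<le> enat N"
proof -
  let ?N = "{n. n \<ge> 1 \<and> approx_number X Y T n \<ge> \<epsilon>}"
  have "?N \<subseteq> {1..N}" using assms by (auto simp: not_le[symmetric]) (meson not_le)
  then have "finite ?N" "card ?N \<le> N"
    using finite_subset card_mono[of "{1..N}" ?N] by auto
  then show ?thesis by (simp add: info_complexity_def Let_def)
qed

section \<open>Tensor powers\<close>

lemma sum_lessThan_add:
  fixes f :: "nat \<Rightarrow> 'a::comm_monoid_add"
  shows "(\<Sum>j<m + n. f j) = (\<Sum>j<m. f j) + (\<Sum>j<n. f (m + j))"
  by (induction n) (simp_all add: add.assoc)

lemma algebraic_tensor_powerI:
  fixes m :: nat
  assumes "f = (\<lambda>x. \<Sum>j<m. c j * (\<Prod>i<d. u j i (x i)))" "\<forall>j<m. \<forall>i<d. u j i \<in> V"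
  shows "f \<in> algebraic_tensor_power d V"
  unfolding algebraic_tensor_power_def
  by (rule CollectI, rule exI[of _ m], rule exI[of _ c], rule exI[of _ u]) (use assms in simp)

lemma algebraic_tensor_power_prod:
  assumes "\<And>i. i < d \<Longrightarrow> u i \<in> V"
  shows "(\<lambda>x. \<Prod>i<d. u i (x i)) \<in> algebraic_tensor_power d V"
  by (rule algebraic_tensor_powerI[where m = 1 and c = "\<lambda>_. 1" and u = "\<lambda>_. u"]) (use assms in simp_all)

lemma algebraic_tensor_power_zero: "(\<lambda>x. 0) \<in> algebraic_tensor_power d V"
  by (rule algebraic_tensor_powerI[where m = 0]) simp_all

lemma algebraic_tensor_power_cmult:
  assumes "f \<in> algebraic_tensor_power d V"
  shows "(\<lambda>x. c * f x) \<in> algebraic_tensor_power d V"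
proof -
  obtain m :: nat and c' u where f: "f = (\<lambda>x. \<Sum>j<m. c' j * (\<Prod>i<d. u j i (x i)))"
    and u: "\<forall>j<m. \<forall>i<d. u j i \<in> V"
    using assms unfolding algebraic_tensor_power_def by blast
  have "(\<lambda>x. c * f x) = (\<lambda>x. \<Sum>j<m. (c * c' j) * (\<Prod>i<d. u j i (x i)))"
    by (simp add: f sum_distrib_left mult.assoc)
  then show ?thesis
    using u by (rule algebraic_tensor_powerI)
qed

lemma algebraic_tensor_power_add:
  assumes "f \<in> algebraic_tensor_power d V" "g \<in> algebraic_tensor_power d V"
  shows "(\<lambda>x. f x + g x) \<in> algebraic_tensor_power d V"
proof -
  obtain m :: nat and c u where f: "f = (\<lambda>x. \<Sum>j<m. c j * (\<Prod>i<d. u j i (x i)))"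
    and u: "\<forall>j<m. \<forall>i<d. u j i \<in> V"
    using assms(1) unfolding algebraic_tensor_power_def by blast
  obtain n :: nat and c' v where g: "g = (\<lambda>x. \<Sum>j<n. c' j * (\<Prod>i<d. v j i (x i)))"
    and v: "\<forall>j<n. \<forall>i<d. v j i \<in> V"
    using assms(2) unfolding algebraic_tensor_power_def by blast
  define C where "C j = (if j < m then c j else c' (j - m))" for j
  define U where "U j = (if j < m then u j else v (j - m))" for j
  have "(\<lambda>x. f x + g x) = (\<lambda>x. \<Sum>j<m + n. C j * (\<Prod>i<d. U j i (x i)))"
    unfolding sum_lessThan_add f g by (simp add: C_def U_def)
  moreover have "\<forall>j<m + n. \<forall>i<d. U j i \<in> V"
    using u v by (simp add: U_def)
  ultimately show ?thesis
    by (rule algebraic_tensor_powerI)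
qed

lemma sobolev_interval_L2: "f \<in> vecs (sobolev_interval a b s) \<Longrightarrow> f \<in> vecs (L2_space (interval_measure_on a b))"
  by (simp add: sobolev_interval_def)

lemma has_weak_deriv_0_self:
  "f \<in> vecs (L2_space (interval_measure_on a b)) \<Longrightarrow> has_weak_deriv a b 0 f f"
  by (simp add: has_weak_deriv_def)

lemma sobolev_interval_weak_deriv:
  assumes "f \<in> vecs (sobolev_interval a b s)" "l \<le> s"
  shows "\<exists>g. has_weak_deriv a b l f g"
  using assms has_weak_deriv_0_self[OF sobolev_interval_L2[OF assms(1)]]
  by (cases "l = 0") (auto simp: sobolev_interval_def)

lemma sobolev_torus_subset: "vecs (sobolev_torus a b s) \<subseteq> vecs (sobolev_interval a b s)"
  by (auto simp: sobolev_torus_def)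

lemma multi_indicesD: "\<alpha> \<in> multi_indices d s \<Longrightarrow> i < d \<Longrightarrow> \<alpha> i \<le> s" "\<alpha> \<in> multi_indices d s \<Longrightarrow> \<forall>i\<ge>d. \<alpha> i = 0"
  by (simp_all add: multi_indices_def)

lemma has_mixed_weak_deriv_prod':
  assumes u: "\<And>i. i < d \<Longrightarrow> u i \<in> vecs (L2_space (interval_measure_on a b))"
    and U: "\<And>i l. \<lbrakk>i < d; l \<le> s\<rbrakk> \<Longrightarrow> has_weak_deriv a b l (u i) (U i l)"
  shows "\<forall>\<alpha>\<in>multi_indices d s. has_mixed_weak_deriv a b d \<alpha> (\<lambda>x. \<Prod>i<d. u i (x i)) (\<lambda>x. \<Prod>i<d. U i (\<alpha> i) (x i))"
proof
  fix \<alpha> assume "\<alpha> \<in> multi_indices d s"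
  then show "has_mixed_weak_deriv a b d \<alpha> (\<lambda>x. \<Prod>i<d. u i (x i)) (\<lambda>x. \<Prod>i<d. U i (\<alpha> i) (x i))"
    by (intro has_mixed_weak_deriv_prod[OF _ u U]) (simp_all add: multi_indicesD)
qed

lemma mixed_sobolev_prod:
  assumes "\<And>i. i < d \<Longrightarrow> u i \<in> vecs (sobolev_interval a b s)"
  shows "(\<lambda>x. \<Prod>i<d. u i (x i)) \<in> vecs (mixed_sobolev a b s d)"
proof -
  have "\<exists>U. \<forall>i<d. \<forall>l\<le>s. has_weak_deriv a b l (u i) (U i l)"
    using sobolev_interval_weak_deriv[OF assms] by metis
  then obtain U where U: "\<And>i l. \<lbrakk>i < d; l \<le> s\<rbrakk> \<Longrightarrow> has_weak_deriv a b l (u i) (U i l)"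
    by blast
  have u: "u i \<in> vecs (L2_space (interval_measure_on a b))" if "i < d" for i
    using assms[OF that] by (rule sobolev_interval_L2)
  show ?thesis
    by (rule mixed_sobolevI[OF L2_cube_prod[OF u] has_mixed_weak_deriv_prod'[OF u U]])
qed

lemma algebraic_tensor_power_mixed_sobolev:
  assumes "V \<subseteq> vecs (sobolev_interval a b s)" "f \<in> algebraic_tensor_power d V"
  shows "f \<in> vecs (mixed_sobolev a b s d)"
proof -
  obtain m :: nat and c u where f: "f = (\<lambda>x. \<Sum>j<m. c j * (\<Prod>i<d. u j i (x i)))"
    and u: "\<forall>j<m. \<forall>i<d. u j i \<in> V"
    using assms(2) unfolding algebraic_tensor_power_def by blast
  show ?thesis
    unfolding f
  proof (rule mixed.sum_mem, rule mixed.cmult_mem, rule mixed_sobolev_prod)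
    fix j i assume "j \<in> {..<m}" "i < d"
    then have "u j i \<in> V" using u by simp
    then show "u j i \<in> vecs (sobolev_interval a b s)" by (rule subsetD[OF assms(1)])
  qed
qed

lemma tensor_power_simps:
  "sprod (tensor_power a b s d H) = sprod (mixed_sobolev a b s d)"
  "hnorm (tensor_power a b s d H) = hnorm (mixed_sobolev a b s d)"
  by (simp_all add: tensor_power_def hnorm_def fun_eq_iff)

lemma tensor_power_vecs:
  "f \<in> vecs (tensor_power a b s d H) \<longleftrightarrow> f \<in> vecs (mixed_sobolev a b s d) \<and>
    (\<forall>e>0. \<exists>g \<in> algebraic_tensor_power d (vecs H). hdist (mixed_sobolev a b s d) f g < e)"
  by (simp add: tensor_power_def)

context
  fixes a b :: real and s d :: nat and H :: "real hspace"
  assumes H: "vecs H \<subseteq> vecs (sobolev_interval a b s)"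
begin

lemma algebraic_tensor_power_subset:
  assumes "f \<in> algebraic_tensor_power d (vecs H)"
  shows "f \<in> vecs (tensor_power a b s d H)"
  unfolding tensor_power_vecs
proof (intro conjI allI impI bexI[of _ f] assms)
  show "f \<in> vecs (mixed_sobolev a b s d)"
    by (rule algebraic_tensor_power_mixed_sobolev[OF H assms])
qed (simp add: hdist_def mixed.hnorm_zero)

text \<open>Sums and multiples of approximants approximate sums and multiples, so the closure is a
  space with the inherited product; the contraction property is that of the ambient space.\<close>

lemma tensor_power_contractive_embedding:
  "contractive_embedding (tensor_power a b s d H) (L2_cube a b d)"
proof -
  let ?T = "tensor_power a b s d H" and ?M = "mixed_sobolev a b s d"
  have alg: "g \<in> vecs ?M" if "g \<in> algebraic_tensor_power d (vecs H)" for g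
    by (rule algebraic_tensor_power_mixed_sobolev[OF H that])
  have "semi_inner_space ?T"
  proof (rule semi_inner_space_subspace[OF semi_inner_space_mixed_sobolev])
    show "vecs ?T \<subseteq> vecs ?M" by (auto simp: tensor_power_vecs)
    show "sprod ?T = sprod ?M" by (rule tensor_power_simps)
    show "(\<lambda>x. 0) \<in> vecs ?T"
      by (rule algebraic_tensor_power_subset[OF algebraic_tensor_power_zero])
  next
    fix f g assume f: "f \<in> vecs ?T" and g: "g \<in> vecs ?T"
    note fM = conjunct1[OF f[unfolded tensor_power_vecs]] and gM = conjunct1[OF g[unfolded tensor_power_vecs]]
    show "(\<lambda>x. f x + g x) \<in> vecs ?T"
      unfolding tensor_power_vecs
    proof (intro conjI allI impI)
      show "(\<lambda>x. f x + g x) \<in> vecs ?M" by (rule mixed.add_mem[OF fM gM])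
      fix e :: real assume "e > 0"
      then have "e / 2 > 0" by simp
      then obtain f' g' where f': "f' \<in> algebraic_tensor_power d (vecs H)" "hdist ?M f f' < e / 2"
        and g': "g' \<in> algebraic_tensor_power d (vecs H)" "hdist ?M g g' < e / 2"
        using f g unfolding tensor_power_vecs by metis
      have "hdist ?M (\<lambda>x. f x + g x) (\<lambda>x. f' x + g' x) =
          hnorm ?M (\<lambda>x. (f x - f' x) + (g x - g' x))"
        by (simp add: hdist_def algebra_simps)
      also have "\<dots> \<le> hdist ?M f f' + hdist ?M g g'"
        unfolding hdist_def by (intro mixed.hnorm_triangle mixed.diff_mem fM gM alg f' g')
      finally have "hdist ?M (\<lambda>x. f x + g x) (\<lambda>x. f' x + g' x) < e"
        using f'(2) g'(2) by simp
      then show "\<exists>h\<in>algebraic_tensor_power d (vecs H). hdist ?M (\<lambda>x. f x + g x) h < e"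
        by (rule bexI[where x = "\<lambda>x. f' x + g' x"]) (rule algebraic_tensor_power_add[OF f'(1) g'(1)])
    qed
  next
    fix c f assume f: "f \<in> vecs ?T"
    note fM = conjunct1[OF f[unfolded tensor_power_vecs]]
    show "(\<lambda>x. c * f x) \<in> vecs ?T"
      unfolding tensor_power_vecs
    proof (intro conjI allI impI)
      show "(\<lambda>x. c * f x) \<in> vecs ?M" by (rule mixed.cmult_mem[OF fM])
      fix e :: real assume "e > 0"
      \<comment> \<open>Adding 1 keeps the denominator positive when c = 0.\<close>
      then have "e / (cmod c + 1) > 0" by (simp add: add_nonneg_pos)
      then obtain f' where f': "f' \<in> algebraic_tensor_power d (vecs H)" "hdist ?M f f' < e / (cmod c + 1)"
        using f unfolding tensor_power_vecs by metis
      have "hdist ?M (\<lambda>x. c * f x) (\<lambda>x. c * f' x) = cmod c * hdist ?M f f'"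
        unfolding hdist_def right_diff_distrib[symmetric]
        by (intro mixed.hnorm_cmult mixed.diff_mem fM alg f')
      also have "\<dots> \<le> cmod c * (e / (cmod c + 1))"
        using f'(2) by (intro mult_left_mono) simp_all
      also have "\<dots> < e"
      proof -
        have "0 < cmod c + 1" by (simp add: add_nonneg_pos)
        then show ?thesis using \<open>e > 0\<close> by (simp add: pos_divide_less_eq distrib_left mult.commute)
      qed
      finally show "\<exists>g\<in>algebraic_tensor_power d (vecs H). hdist ?M (\<lambda>x. c * f x) g < e"
        by (intro bexI[where x = "\<lambda>x. c * f' x"] algebraic_tensor_power_cmult[OF f'(1)])
    qed
  qed
  then interpret X: semi_inner_space ?T .
  show ?thesis
  proof
    show "f \<in> vecs (L2_cube a b d)" if "f \<in> vecs ?T" for f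
      using that by (auto simp: tensor_power_vecs mixed_sobolev_L2)
    show "hnorm (L2_cube a b d) f \<le> hnorm ?T f" if "f \<in> vecs ?T" for f
      using that hnorm_L2_le_mixed by (auto simp: tensor_power_vecs tensor_power_simps)
  qed
qed

end

text \<open>The defining property of the tensor product norm: on products of functions the sum over
  multi-indices factors into one-dimensional Sobolev products.\<close>

lemma sprod_mixed_sobolev_prod:
  assumes u: "\<And>i. i < d \<Longrightarrow> u i \<in> vecs (L2_space (interval_measure_on a b))"
    and v: "\<And>i. i < d \<Longrightarrow> v i \<in> vecs (L2_space (interval_measure_on a b))"
    and U: "\<And>i l. \<lbrakk>i < d; l \<le> s\<rbrakk> \<Longrightarrow> has_weak_deriv a b l (u i) (U i l)"
    and V: "\<And>i l. \<lbrakk>i < d; l \<le> s\<rbrakk> \<Longrightarrow> has_weak_deriv a b l (v i) (V i l)"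
  shows "sprod (mixed_sobolev a b s d) (\<lambda>x. \<Prod>i<d. u i (x i)) (\<lambda>x. \<Prod>i<d. v i (x i)) =
    (\<Prod>i<d. \<Sum>l\<le>s. sprod (L2_space (interval_measure_on a b)) (U i l) (V i l))"
proof -
  have "sprod (mixed_sobolev a b s d) (\<lambda>x. \<Prod>i<d. u i (x i)) (\<lambda>x. \<Prod>i<d. v i (x i)) =
      (\<Sum>\<alpha>\<in>multi_indices d s. sprod (L2_cube a b d) (\<lambda>x. \<Prod>i<d. U i (\<alpha> i) (x i)) (\<lambda>x. \<Prod>i<d. V i (\<alpha> i) (x i)))"
    by (rule sprod_mixed_sobolev[OF has_mixed_weak_deriv_prod'[OF u U] has_mixed_weak_deriv_prod'[OF v V]])
  also have "\<dots> = (\<Sum>\<alpha>\<in>multi_indices d s. \<Prod>i<d. sprod (L2_space (interval_measure_on a b)) (U i (\<alpha> i)) (V i (\<alpha> i)))"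
  proof (intro sum.cong refl sprod_L2_cube_prod)
    fix \<alpha> i assume "\<alpha> \<in> multi_indices d s" "i < d"
    then have "\<alpha> i \<le> s" by (rule multi_indicesD)
    then show "U i (\<alpha> i) \<in> vecs (L2_space (interval_measure_on a b))"
      "V i (\<alpha> i) \<in> vecs (L2_space (interval_measure_on a b))"
      using U[OF \<open>i < d\<close>] V[OF \<open>i < d\<close>] by (simp_all add: has_weak_deriv_def)
  qed
  also have "\<dots> = (\<Prod>i<d. \<Sum>l\<le>s. sprod (L2_space (interval_measure_on a b)) (U i l) (V i l))"
    by (rule sum_prod_multi_indices)
  finally show ?thesis .
qed

text \<open>The vectors are \<open>f\<close> in the coordinates of an \<open>m\<close>-element set and 1 elsewhere.\<close>

lemma info_complexity_ge_binomial:
  assumes "a < b" and H: "vecs H \<subseteq> vecs (sobolev_interval a b s)"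
    and F: "smooth_family F" and mem: "F 0 \<in> vecs H" "(\<lambda>t. 1) \<in> vecs H"
    and orth: "(\<integral>t. F 0 t \<partial>interval_measure_on a b) = 0"
    and norm0: "(\<integral>t. (cmod (F 0 t))\<^sup>2 \<partial>interval_measure_on a b) = \<rho>" and \<rho>: "\<rho> > 0"
    and norm: "(\<Sum>l\<le>s. \<integral>t. (cmod (F l t))\<^sup>2 \<partial>interval_measure_on a b) = A * \<rho>" and A: "A > 0"
  shows "enat (d choose m) \<le> info_complexity (tensor_power a b s d H) (L2_cube a b d) (\<lambda>f. f) (1 / sqrt (A ^ m))"
proof (rule info_complexity_ge)
  let ?L2 = "L2_space (interval_measure_on a b)" and ?T = "tensor_power a b s d H" and ?Y = "L2_cube a b d"
  \<comment> \<open>The constant 1 with its derivatives, so that both kinds of factors are smooth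
    families.\<close>
  define E where "E = (\<lambda>(l::nat) (t::real). if l = 0 then 1 else 0 :: complex)"
  have E: "smooth_family E"
    unfolding smooth_family_def E_def by (auto intro!: has_vector_derivative_const)
  define G where "G S i = (if i \<in> S then F else E)" for S :: "nat set" and i
  define e where "e S = (\<lambda>x. \<Prod>i<d. G S i 0 (x i))" for S
  define I where "I = {S. S \<subseteq> {..<d} \<and> card S = m}"
  have G: "smooth_family (G S i)" for S i by (simp add: G_def E F)
  have G2: "G S i l \<in> vecs ?L2" for S i l by (rule smooth_family_L2[OF G])
  have GW: "has_weak_deriv a b l (G S i 0) (G S i l)" for S i l
    by (rule has_weak_deriv_smooth_family[OF \<open>a < b\<close> G])
  have self: "sprod ?L2 (F l) (F l) = of_real (\<integral>t. (cmod (F l t))\<^sup>2 \<partial>interval_measure_on a b)" for l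
    by (simp only: sprod_L2 complex_norm_square[symmetric] integral_complex_of_real)
  have EE: "sprod ?L2 (E l) (E l) = of_real (if l = 0 then b - a else 0)" for l
  proof -
    have "measure (interval_measure_on a b) {a..b} = b - a"
      using \<open>a < b\<close> by (simp add: interval_measure_on_def measure_restrict_space)
    then show ?thesis by (simp add: sprod_L2 E_def scaleR_conv_of_real)
  qed
  \<comment> \<open>For l = 0 this is the orthogonality assumption, for l > 0 the derivative of the
    constant is 0; so F and 1 are orthogonal in both spaces.\<close>
  have FE: "sprod ?L2 (F l) (E l) = 0" for l
    using orth by (simp add: sprod_L2 E_def)
  have EF: "sprod ?L2 (E l) (F l) = 0" for l
  proof -
    have "sprod ?L2 (E l) (F l) = cnj (sprod ?L2 (F l) (E l))"
      by (rule semi_inner_space.sprod_commute[OF semi_inner_space_L2])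
         (rule smooth_family_L2, fact)+
    then show ?thesis by (simp add: FE)
  qed
  have FF: "sprod ?L2 (F 0) (F 0) = of_real \<rho>" "(\<Sum>l\<le>s. sprod ?L2 (F l) (F l)) = of_real (A * \<rho>)"
    unfolding self by (simp only: norm0, simp only: of_real_sum[symmetric] norm)
  have EE': "(\<Sum>l\<le>s. sprod ?L2 (E l) (E l)) = of_real (b - a)"
    unfolding EE of_real_sum[symmetric] by (simp add: sum.delta)
  have spY: "sprod ?Y (e S) (e S') = (\<Prod>i<d. sprod ?L2 (G S i 0) (G S' i 0))" for S S'
    unfolding e_def by (rule sprod_L2_cube_prod) (rule G2)+
  have spX: "sprod ?T (e S) (e S') = (\<Prod>i<d. \<Sum>l\<le>s. sprod ?L2 (G S i l) (G S' i l))" for S S'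
    unfolding e_def tensor_power_simps by (rule sprod_mixed_sobolev_prod) (rule G2 GW)+
  have count: "(\<Prod>i<d. if i \<in> S then x else y) = x ^ m * y ^ (d - m)" if "S \<in> I" for S and x y :: complex
  proof -
    have "S \<subseteq> {..<d}" "card S = m" using that by (auto simp: I_def)
    moreover from this have "card ({..<d} - S) = d - m"
      by (subst card_Diff_subset) (auto intro: finite_subset)
    ultimately show ?thesis
      by (subst prod.If_cases) (simp_all add: Int_absorb1 Diff_eq[symmetric])
  qed
  have selfY: "sprod ?Y (e S) (e S) = of_real (\<rho> ^ m * (b - a) ^ (d - m))" if "S \<in> I" for S
  proof -
    have "sprod ?Y (e S) (e S) = (\<Prod>i<d. if i \<in> S then of_real \<rho> else of_real (b - a))"
      unfolding spY by (intro prod.cong refl) (simp add: G_def FF EE)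
    then show ?thesis by (simp add: count[OF that])
  qed
  have selfX: "sprod ?T (e S) (e S) = of_real ((A * \<rho>) ^ m * (b - a) ^ (d - m))" if "S \<in> I" for S
  proof -
    have "sprod ?T (e S) (e S) = (\<Prod>i<d. if i \<in> S then of_real (A * \<rho>) else of_real (b - a))"
      unfolding spX by (intro prod.cong refl) (simp add: G_def FF(2) EE')
    then show ?thesis by (simp add: count[OF that])
  qed
  \<comment> \<open>Of two different sets of equal size neither contains the other. In a coordinate
    of S outside S' the factor F meets 1, and the whole product vanishes.\<close>
  have ex: "\<exists>i<d. i \<in> S \<and> i \<notin> S'" if "S \<in> I" "S' \<in> I" "S \<noteq> S'" for S S'
  proof (rule ccontr)
    assume "\<not> ?thesis"
    then have "S \<subseteq> S'" using that(1) by (auto simp: I_def)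
    moreover have "finite S'" using that(2) by (auto simp: I_def intro: finite_subset)
    ultimately show False
      using that card_subset_eq[of S' S] by (auto simp: I_def)
  qed
  fix n assume n: "1 \<le> n" "n \<le> d choose m"
  interpret contractive_embedding ?T ?Y
    by (rule tensor_power_contractive_embedding[OF H])
  have memT: "e S \<in> vecs ?T" for S
    unfolding e_def
    by (intro algebraic_tensor_power_subset[OF H] algebraic_tensor_power_prod)
       (use mem in \<open>simp add: G_def E_def\<close>)
  have fin: "finite I" unfolding I_def by (rule finite_subset[of _ "Pow {..<d}"]) auto
  have card: "card I = d choose m" unfolding I_def using n_subsets[of "{..<d}" m] by simp
  show "1 / sqrt (A ^ m) \<le> approx_number ?T ?Y (\<lambda>f. f) n"
  proof (rule approx_number_ge[OF fin _ n(1)])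
    show "n \<le> card I" using n card by simp
    show "e S \<in> vecs ?T" for S by (rule memT)
    show "sprod ?T (e S) (e S') = 0" if SS: "S \<in> I" "S' \<in> I" "S \<noteq> S'" for S S'
    proof -
      obtain i where "i < d" "i \<in> S" "i \<notin> S'" using ex[OF SS] by blast
      then show ?thesis unfolding spX by (intro prod_zero bexI[of _ i]) (simp_all add: G_def FE)
    qed
    show "sprod ?Y (e S) (e S') = 0" if SS: "S \<in> I" "S' \<in> I" "S \<noteq> S'" for S S'
    proof -
      obtain i where "i < d" "i \<in> S" "i \<notin> S'" using ex[OF SS] by blast
      then show ?thesis unfolding spY by (intro prod_zero bexI[of _ i]) (simp_all add: G_def FE)
    qed
    \<comment> \<open>The norms depend on S only through its size m, which makes their ratio the
      constant \<open>sqrt (A ^ m)\<close>.\<close>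
    show "hnorm ?Y (e S) = sqrt (\<rho> ^ m * (b - a) ^ (d - m))" if "S \<in> I" for S
      unfolding hnorm_def selfY[OF that] by simp
    show "hnorm ?T (e S) = sqrt (A ^ m) * sqrt (\<rho> ^ m * (b - a) ^ (d - m))" if "S \<in> I" for S
      unfolding hnorm_def selfX[OF that] by (simp add: power_mult_distrib real_sqrt_mult)
    show "0 < sqrt (\<rho> ^ m * (b - a) ^ (d - m))" "0 < sqrt (A ^ m)"
      using \<rho> A \<open>a < b\<close> by simp_all
  qed
qed

section \<open>Growth conditions from tractability\<close>

text \<open>With \<epsilon> = A^(-m/2) the lower bound and tractability give (d/m)^m \<le> C
  A^(mq/2) d^p. Since m \<ge> p + 1, dividing by d^p leaves at least d on the left.\<close>

lemma polynomially_tractable_growth: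
  assumes lower: "\<And>d m. d \<ge> 1 \<Longrightarrow>
      enat (d choose m) \<le> info_complexity (X d) (Y d) (T d) (1 / sqrt (A d ^ m))"
    and A: "\<And>d. A d \<ge> 1" and "polynomially_tractable X Y T"
  shows "\<exists>B r d0. B \<ge> 1 \<and> r \<ge> 1 \<and> (\<forall>d\<ge>d0. real d \<le> B * A d powr r)"
proof -
  obtain C p q where Cpq: "C \<ge> 0" "p \<ge> 0" "q \<ge> 0" and tr: "tractable_with C p q X Y T"
    using assms(3) unfolding polynomially_tractable_def by blast
  define m where "m = nat \<lceil>p\<rceil> + 1"
  \<comment> \<open>The maxima with 1 allow logarithms and reciprocals of B and r in the
    applications.\<close>
  define B where "B = max 1 (C * real m ^ m)"
  define r where "r = max 1 (real m * q / 2)"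
  have "real d \<le> B * A d powr r" if d: "d \<ge> m" for d
  proof -
    have "d \<ge> 1" using d by (simp add: m_def)
    then have d0: "real d > 0" by simp
    have "0 < A d" using A[of d] by linarith
    let ?\<epsilon> = "1 / sqrt (A d ^ m)"
    have "?\<epsilon> > 0" using \<open>0 < A d\<close> by simp
    have "ereal (real (d choose m)) \<le> ereal_of_enat (info_complexity (X d) (Y d) (T d) ?\<epsilon>)"
      using lower[OF \<open>d \<ge> 1\<close>, of m] by (metis ereal_of_enat_le_iff ereal_of_enat_simps(1))
    also have "\<dots> \<le> ereal (C * ?\<epsilon> powr (- q) * real d powr p)"
      using tr \<open>d \<ge> 1\<close> \<open>?\<epsilon> > 0\<close> unfolding tractable_with_def by blast
    finally have "real (d choose m) \<le> C * ?\<epsilon> powr (- q) * real d powr p" by simp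
    also have "?\<epsilon> powr (- q) = A d powr (real m * q / 2)"
    proof -
      have "sqrt (A d ^ m) = (A d powr real m) powr (1 / 2)"
        using \<open>0 < A d\<close> by (simp only: powr_realpow powr_half_sqrt zero_le_power less_imp_le)
      then have "?\<epsilon> = 1 / A d powr (real m / 2)" by (simp only: powr_powr) simp
      then have "?\<epsilon> = A d powr (- (real m / 2))" by (simp only: powr_minus_divide)
      then show ?thesis by (simp only: powr_powr) (simp add: mult.commute)
    qed
    also have "C * A d powr (real m * q / 2) * real d powr p \<le> C * A d powr r * real d powr p"
      using Cpq(1) A[of d] by (intro mult_right_mono mult_left_mono powr_mono) (simp_all add: r_def)
    finally have 1: "real (d choose m) \<le> C * A d powr r * real d powr p" .
    have "(real d / real m) ^ m \<le> real (d choose m)"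
      by (rule binomial_ge_n_over_k_pow_k[OF d])
    with 1 have "real d ^ m / real m ^ m \<le> C * A d powr r * real d powr p"
      by (simp add: power_divide)
    moreover have "0 < real m ^ m" by (simp add: m_def)
    ultimately have 2: "real d ^ m \<le> C * real m ^ m * A d powr r * real d powr p"
      by (simp add: pos_divide_le_eq mult_ac)
    have "real d * real d powr p = real d powr (1 + p)"
      using d0 by (simp add: powr_add)
    also have "\<dots> \<le> real d powr real m"
      using \<open>d \<ge> 1\<close> by (intro powr_mono) (simp_all add: m_def, linarith)
    also have "\<dots> = real d ^ m" using d0 by (simp add: powr_realpow)
    finally have "real d * real d powr p \<le> C * real m ^ m * A d powr r * real d powr p"
      using 2 by simp
    then have "real d \<le> C * real m ^ m * A d powr r"
      using d0 by simp
    also have "\<dots> \<le> B * A d powr r" by (intro mult_right_mono) (simp_all add: B_def)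
    finally show ?thesis .
  qed
  then show ?thesis
    by (intro exI[of _ B] exI[of _ r] exI[of _ m]) (simp add: B_def r_def)
qed

text \<open>A bounded ratio A would bound the dimension d by B K^r.\<close>

lemma not_polynomially_tractable_bounded:
  fixes K :: real
  assumes "\<And>d m. d \<ge> 1 \<Longrightarrow> enat (d choose m) \<le> info_complexity (X d) (Y d) (T d) (1 / sqrt (A d ^ m))"
    and A: "\<And>d. A d \<ge> 1" and K: "\<And>d. A d \<le> K"
  shows "\<not> polynomially_tractable X Y T"
proof
  assume "polynomially_tractable X Y T"
  from polynomially_tractable_growth[OF assms(1,2) this]
  obtain B r :: real and d0 where B: "B \<ge> 1" "r \<ge> 1" "\<forall>d\<ge>d0. real d \<le> B * A d powr r" by blast
  define d where "d = max d0 (nat \<lceil>B * K powr r\<rceil> + 1)"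
  have "real d \<le> B * A d powr r" using B(3) by (simp add: d_def)
  also have "\<dots> \<le> B * K powr r"
    using B A[of d] K[of d] by (intro mult_left_mono powr_mono2) auto
  also have "\<dots> < real d" unfolding d_def by linarith
  finally show False by simp
qed

lemma grows_polynomially_if_tractable:
  assumes "\<And>d m. d \<ge> 1 \<Longrightarrow> enat (d choose m) \<le> info_complexity (X d) (Y d) (T d) (1 / sqrt (A d ^ m))"
    and A: "\<And>d. A d = real (s d) + 1" and s: "\<And>d. d \<ge> 1 \<Longrightarrow> s d \<ge> 1"
    and "polynomially_tractable X Y T"
  shows "grows_at_least_polynomially s"
proof -
  have "A d \<ge> 1" for d by (simp add: A)
  from polynomially_tractable_growth[OF assms(1) this assms(4)]
  obtain B r :: real and d0 where B: "B \<ge> 1" "r \<ge> 1" "\<forall>d\<ge>d0. real d \<le> B * A d powr r" by blast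
  \<comment> \<open>Inverting d \<le> B (s + 1)^r gives the power; the factor 1/2 comes from s + 1
    \<le> 2 s, valid as s \<ge> 1.\<close>
  define c where "c = (1 / B) powr (1 / r) / 2"
  have "real (s d) \<ge> c * real d powr (1 / r)" if "d \<ge> max 1 d0" for d
  proof -
    have "d \<ge> 1" "d \<ge> d0" using that by auto
    have "real d / B \<le> A d powr r" using B(1) B(3)[rule_format, OF \<open>d \<ge> d0\<close>] by (simp add: field_simps)
    then have "(real d / B) powr (1 / r) \<le> (A d powr r) powr (1 / r)"
      using B by (intro powr_mono2) auto
    also have "\<dots> = A d" using B(2) by (simp add: powr_powr A)
    also have "\<dots> \<le> 2 * real (s d)" using s[OF \<open>d \<ge> 1\<close>] by (simp add: A)
    finally have "(1 / B) powr (1 / r) * real d powr (1 / r) \<le> 2 * real (s d)"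
      using B(1) powr_mult[of "1 / B" "real d" "1 / r"] by simp
    then show ?thesis by (simp add: c_def)
  qed
  moreover have "c > 0" "1 / r > 0" using B by (auto simp: c_def)
  ultimately show ?thesis
    unfolding grows_at_least_polynomially_def
    by (intro exI[of _ c] conjI exI[of _ "1 / r"] exI[of _ "max 1 d0"]) auto
qed

lemma grows_logarithmically_if_tractable:
  assumes "\<And>d m. d \<ge> 1 \<Longrightarrow> enat (d choose m) \<le> info_complexity (X d) (Y d) (T d) (1 / sqrt (A d ^ m))"
    and A1: "\<And>d. A d \<ge> 1" and A: "\<And>d. A d \<le> exp (M * real (s d))" and M: "M > 0"
    and "polynomially_tractable X Y T"
  shows "grows_at_least_logarithmically s"
proof -
  from polynomially_tractable_growth[OF assms(1,2,5)]
  obtain B r :: real and d0 where B: "B \<ge> 1" "r \<ge> 1" "\<forall>d\<ge>d0. real d \<le> B * A d powr r" by blast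
  \<comment> \<open>Taking logarithms, ln d \<le> ln B + r M s. From d \<ge> B^2 on, ln B is at most
    half of ln d, which yields the factor 2.\<close>
  define c where "c = 1 / (2 * M * r)"
  define d1 where "d1 = max (max 1 d0) (nat \<lceil>B\<^sup>2\<rceil>)"
  have "real (s d) \<ge> c * ln (real d)" if "d \<ge> d1" for d
  proof -
    have "nat \<lceil>B\<^sup>2\<rceil> \<le> d" using that by (simp add: d1_def)
    then have "real d \<ge> B\<^sup>2" using real_nat_ceiling_ge[of "B\<^sup>2"] by linarith
    then have d: "d \<ge> 1" "d \<ge> d0" "real d \<ge> B\<^sup>2" using that by (simp_all add: d1_def)
    have "real d \<le> B * A d powr r" by (rule B(3)[rule_format, OF d(2)])
    also have "\<dots> \<le> B * exp (M * real (s d)) powr r"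
      using A1[of d] A[of d] B by (intro mult_left_mono powr_mono2) auto
    also have "\<dots> = exp (ln B + r * M * real (s d))"
      using B(1) by (simp add: exp_add powr_def mult_ac)
    finally have 1: "ln (real d) \<le> ln B + r * M * real (s d)"
      using d(1) by (subst (asm) ln_le_cancel_iff[symmetric]) simp_all
    have "ln (B\<^sup>2) \<le> ln (real d)" using d(1,3) B(1) by (subst ln_le_cancel_iff) simp_all
    then have "2 * ln B \<le> ln (real d)" using B(1) by (simp add: ln_realpow)
    with 1 have "ln (real d) \<le> 2 * (r * M * real (s d))" by linarith
    then show ?thesis using M B(2) by (simp add: c_def field_simps)
  qed
  moreover have "c > 0" using M B by (auto simp: c_def)
  ultimately show ?thesis
    unfolding grows_at_least_logarithmically_def
    by (intro exI[of _ c] conjI exI[of _ d1]) (auto simp: d1_def)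
qed

section \<open>The interval: failure of tractability for every smoothness\<close>

theorem not_tractable_interval:
  assumes "a < b" and s: "\<And>d. d \<ge> 1 \<Longrightarrow> s d \<ge> 1"
  shows "\<not> polynomially_tractable (\<lambda>d. Hmix_interval a b (s d) d) (\<lambda>d. L2_cube a b d) (\<lambda>d f. f)"
proof -
  \<comment> \<open>Centring at the midpoint makes the linear function orthogonal to 1.\<close>
  define c where "c = (a + b) / 2"
  define F where "F = (\<lambda>(l::nat) t. if l = 0 then complex_of_real (t - c) else if l = 1 then 1 else 0)"
  let ?I = "interval_measure_on a b"
  define \<rho> where "\<rho> = (b - a) ^ 3 / 12"
  \<comment> \<open>\<rho> is the squared L2 norm of t - c, and b - a is that of its derivative 1;
    all higher derivatives vanish.\<close>
  define A where "A = 1 + (b - a) / \<rho>"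
  have \<rho>: "\<rho> > 0" using \<open>a < b\<close> by (simp add: \<rho>_def)
  have A: "A \<ge> 1" using \<open>a < b\<close> \<rho> by (simp add: A_def)
  have F: "smooth_family F"
    unfolding smooth_family_def
  proof (intro allI)
    fix l t
    have "((\<lambda>t. complex_of_real (t - c)) has_vector_derivative of_real 1) (at t)"
      by (rule has_vector_derivative_of_real) (auto intro!: derivative_eq_intros)
    then show "(F l has_vector_derivative F (Suc l) t) (at t)"
      by (cases "l = 0") (auto simp: F_def)
  qed
  have int0: "(\<integral>t. (t - c) \<partial>?I) = 0"
  proof -
    have "(\<integral>t. (t - c) \<partial>?I) = (b - c)\<^sup>2 / 2 - (a - c)\<^sup>2 / 2"
      by (rule integral_interval_FTC)
         (use \<open>a < b\<close> in \<open>auto intro!: derivative_eq_intros continuous_intros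
            simp flip: has_real_derivative_iff_has_vector_derivative\<close>)
    then show ?thesis by (simp add: c_def power2_eq_square field_simps)
  qed
  have int2: "(\<integral>t. (t - c)\<^sup>2 \<partial>?I) = \<rho>"
  proof -
    have "(\<integral>t. (t - c)\<^sup>2 \<partial>?I) = (b - c) ^ 3 / 3 - (a - c) ^ 3 / 3"
      by (rule integral_interval_FTC)
         (use \<open>a < b\<close> in \<open>auto intro!: derivative_eq_intros continuous_intros
            simp flip: has_real_derivative_iff_has_vector_derivative\<close>)
    then show ?thesis by (simp add: c_def \<rho>_def power3_eq_cube field_simps)
  qed
  have meas: "measure ?I {a..b} = b - a"
    using \<open>a < b\<close> by (simp add: interval_measure_on_def measure_restrict_space)
  have mem: "G 0 \<in> vecs (sobolev_interval a b n)" if "smooth_family G" for G n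
    using has_weak_deriv_smooth_family[OF \<open>a < b\<close> that] smooth_family_L2[OF that, of 0 a b]
    unfolding sobolev_interval_def by auto
  have one: "smooth_family (\<lambda>l t. if l = 0 then 1 else 0)"
    unfolding smooth_family_def by (auto intro!: has_vector_derivative_const)
  have "enat (d choose m) \<le> info_complexity (Hmix_interval a b (s d) d) (L2_cube a b d) (\<lambda>f. f) (1 / sqrt (A ^ m))"
    if "d \<ge> 1" for d m
    unfolding Hmix_interval_def
  proof (rule info_complexity_ge_binomial[OF \<open>a < b\<close> subset_refl F mem[OF F] _ _ _ \<rho>])
    show "(\<lambda>t. 1) \<in> vecs (sobolev_interval a b (s d))" using mem[OF one] by simp
    show "(\<integral>t. F 0 t \<partial>?I) = 0"
    proof -
      have "(\<integral>t. F 0 t \<partial>?I) = (\<integral>t. complex_of_real (t - c) \<partial>?I)" by (simp add: F_def)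
      also have "\<dots> = 0" by (simp only: integral_complex_of_real int0 of_real_0)
      finally show ?thesis .
    qed
    have n0: "(\<integral>t. (cmod (F 0 t))\<^sup>2 \<partial>?I) = \<rho>"
      using int2 by (simp only: F_def refl if_True norm_of_real power2_abs)
    show "(\<integral>t. (cmod (F 0 t))\<^sup>2 \<partial>?I) = \<rho>" by (rule n0)
    have nl: "(\<integral>t. (cmod (F l t))\<^sup>2 \<partial>?I) = (if l = 0 then \<rho> else if l = 1 then b - a else 0)" for l
      using n0 meas by (auto simp: F_def)
    \<comment> \<open>As s \<ge> 1, the orders 0 and 1 both occur in the sum, and only they
      contribute.\<close>
    have "(\<Sum>l\<le>s d. \<integral>t. (cmod (F l t))\<^sup>2 \<partial>?I) = (\<Sum>l\<in>{0, 1::nat}. if l = 0 then \<rho> else if l = 1 then b - a else 0)"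
      unfolding nl using s[OF \<open>d \<ge> 1\<close>] by (intro sum.mono_neutral_right) auto
    also have "\<dots> = A * \<rho>" using \<rho> by (simp add: A_def distrib_right)
    finally show "(\<Sum>l\<le>s d. \<integral>t. (cmod (F l t))\<^sup>2 \<partial>?I) = A * \<rho>" .
    show "A > 0" using A by simp
  qed
  then show ?thesis
    by (rule not_polynomially_tractable_bounded[where A = "\<lambda>_. A" and K = A]) (use A in auto)
qed

section \<open>Fourier functions and the lower bounds on the torus\<close>

definition fourier :: "real \<Rightarrow> int \<Rightarrow> nat \<Rightarrow> real \<Rightarrow> complex" where
  "fourier \<omega> k l t = (\<i> * of_real (\<omega> * of_int k)) ^ l * cis (\<omega> * of_int k * t)"

lemma smooth_family_fourier: "smooth_family (fourier \<omega> k)"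
  unfolding smooth_family_def
proof (intro allI)
  fix l t
  let ?\<nu> = "\<omega> * of_int k"
  have "((\<lambda>t. \<i> * of_real (?\<nu> * t)) has_vector_derivative \<i> * of_real ?\<nu>) (at t)"
    by (intro has_vector_derivative_mult_right has_vector_derivative_of_real)
       (auto intro!: derivative_eq_intros)
  from field_vector_diff_chain_at[OF this DERIV_exp]
  have "((\<lambda>t. cis (?\<nu> * t)) has_vector_derivative (\<i> * of_real ?\<nu>) * cis (?\<nu> * t)) (at t)"
    by (simp add: o_def cis_conv_exp)
  from has_vector_derivative_mult_right[OF this, of "(\<i> * of_real ?\<nu>) ^ l"]
  show "(fourier \<omega> k l has_vector_derivative fourier \<omega> k (Suc l) t) (at t)"
    by (simp add: fourier_def[abs_def] mult_ac)
qed

lemma fourier_eq: "fourier \<omega> k l t = (\<i> * of_real (\<omega> * of_int k)) ^ l * fourier \<omega> k 0 t"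
  by (simp add: fourier_def)

lemma fourier_mult: "fourier \<omega> j 0 t * fourier \<omega> k 0 t = fourier \<omega> (j + k) 0 t"
  by (simp add: fourier_def cis_mult algebra_simps)

lemma cnj_fourier: "cnj (fourier \<omega> k 0 t) = fourier \<omega> (- k) 0 t"
  by (simp add: fourier_def cis_cnj)

lemma fourier_0: "fourier \<omega> 0 l t = (if l = 0 then 1 else 0)"
  by (simp add: fourier_def)

lemma norm_fourier: "(cmod (fourier \<omega> k l t))\<^sup>2 = (\<omega> * of_int k) ^ (2 * l)"
  by (simp add: fourier_def norm_mult norm_power power_mult[symmetric] mult.commute[of 2]
      power_mult_distrib power_even_abs abs_mult[symmetric])

context
  fixes a b \<omega> :: real
  assumes ab: "a < b" and \<omega>: "\<omega> = 2 * pi / (b - a)"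
begin

lemma fourier_periodic: "fourier \<omega> k l a = fourier \<omega> k l b"
proof -
  have "\<omega> * of_int k * b = \<omega> * of_int k * a + 2 * pi * of_int k"
    using ab by (simp add: \<omega> field_simps)
  then have "cis (\<omega> * of_int k * b) = cis (\<omega> * of_int k * a) * cis (2 * pi * of_int k)"
    by (simp only: cis_mult)
  also have "cis (2 * pi * of_int k) = 1" by (rule cis_multiple_2pi) simp
  finally show ?thesis by (simp add: fourier_def)
qed

lemma omega_pos: "\<omega> > 0"
  using ab by (simp add: \<omega>)

text \<open>For k \<noteq> 0 the integrand is, up to a nonzero factor, the derivative of a function
  with equal values at a and b.\<close>

lemma integral_fourier: "(\<integral>t. fourier \<omega> k 0 t \<partial>interval_measure_on a b) = (if k = 0 then of_real (b - a) else 0)"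
proof (cases "k = 0")
  case True
  have "measure (interval_measure_on a b) {a..b} = b - a"
    using ab by (simp add: interval_measure_on_def measure_restrict_space)
  then show ?thesis using True by (simp add: fourier_0 scaleR_conv_of_real)
next
  case False
  have "(\<integral>t. fourier \<omega> k 1 t \<partial>interval_measure_on a b) = fourier \<omega> k 0 b - fourier \<omega> k 0 a"
    using ab smooth_familyD[OF smooth_family_fourier, of \<omega> k 0]
    by (intro integral_interval_FTC smooth_family_continuous smooth_family_fourier) simp_all
  then have "(\<i> * of_real (\<omega> * of_int k)) * (\<integral>t. fourier \<omega> k 0 t \<partial>interval_measure_on a b) = 0"
    unfolding fourier_eq[of _ _ 1] fourier_periodic by simp
  then show ?thesis using False omega_pos by simp
qed

lemma sprod_fourier:
  "sprod (L2_space (interval_measure_on a b)) (fourier \<omega> j 0) (fourier \<omega> k 0) =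
    (if j = k then of_real (b - a) else 0)"
  by (simp add: sprod_L2 cnj_fourier fourier_mult integral_fourier)

lemma fourier_mem_torus: "fourier \<omega> k 0 \<in> vecs (sobolev_torus a b s)"
proof -
  have "has_weak_deriv a b l (fourier \<omega> k 0) (fourier \<omega> k l)" for l
    by (rule has_weak_deriv_smooth_family[OF ab smooth_family_fourier])
  moreover have "continuous_on {a..b} (fourier \<omega> k l)" for l
    by (rule smooth_family_continuous[OF smooth_family_fourier])
  ultimately show ?thesis
    using smooth_family_L2[OF smooth_family_fourier, of \<omega> k 0 a b] fourier_periodic[of k]
    unfolding sobolev_torus_def sobolev_interval_def by auto
qed

lemma info_complexity_torus_ge:
  "enat (d choose m) \<le> info_complexity (Hmix_torus a b s d) (L2_cube a b d) (\<lambda>f. f)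
    (1 / sqrt ((\<Sum>l\<le>s. \<omega> ^ (2 * l)) ^ m))"
  unfolding Hmix_torus_def
proof (rule info_complexity_ge_binomial[OF ab sobolev_torus_subset smooth_family_fourier[of \<omega> 1]])
  have meas: "measure (interval_measure_on a b) {a..b} = b - a"
    using ab by (simp add: interval_measure_on_def measure_restrict_space)
  show "fourier \<omega> 1 0 \<in> vecs (sobolev_torus a b s)" by (rule fourier_mem_torus)
  show "(\<lambda>t. 1) \<in> vecs (sobolev_torus a b s)" using fourier_mem_torus[of 0] by (simp add: fourier_0[abs_def])
  show "(\<integral>t. fourier \<omega> 1 0 t \<partial>interval_measure_on a b) = 0" by (simp add: integral_fourier)
  show "(\<integral>t. (cmod (fourier \<omega> 1 0 t))\<^sup>2 \<partial>interval_measure_on a b) = b - a"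
    by (simp add: norm_fourier meas)
  show "(\<Sum>l\<le>s. \<integral>t. (cmod (fourier \<omega> 1 l t))\<^sup>2 \<partial>interval_measure_on a b) = (\<Sum>l\<le>s. \<omega> ^ (2 * l)) * (b - a)"
    by (simp add: norm_fourier meas sum_distrib_left sum_distrib_right mult.commute)
  show "b - a > 0" using ab by simp
  have "0 < \<omega> ^ (2 * 0)" by simp
  also have "\<dots> \<le> (\<Sum>l\<le>s. \<omega> ^ (2 * l))" using omega_pos by (intro member_le_sum) auto
  finally show "0 < (\<Sum>l\<le>s. \<omega> ^ (2 * l))" .
qed

text \<open>The comparison of \<omega> with 1 decides the size of A = 1 + \<omega>^2 + ... +
  \<omega>^(2s): at most exponential in s for \<omega> > 1, exactly s + 1 for \<omega> = 1, and
  bounded by a geometric series for \<omega> < 1, where tractability is impossible.\<close>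

theorem growth_if_tractable_torus:
  assumes s: "\<And>d. d \<ge> 1 \<Longrightarrow> s d \<ge> 1"
    and tr: "polynomially_tractable (\<lambda>d. Hmix_torus a b (s d) d) (\<lambda>d. L2_cube a b d) (\<lambda>d f. f)"
  shows "(b - a < 2 * pi \<and> grows_at_least_logarithmically s) \<or>
    (b - a = 2 * pi \<and> grows_at_least_polynomially s)"
proof -
  define A where "A d = (\<Sum>l\<le>s d. \<omega> ^ (2 * l))" for d
  have lower: "enat (d choose m) \<le> info_complexity (Hmix_torus a b (s d) d) (L2_cube a b d) (\<lambda>f. f) (1 / sqrt (A d ^ m))"
    for d m unfolding A_def by (rule info_complexity_torus_ge)
  have A1: "A d \<ge> 1" for d
  proof -
    have "1 = \<omega> ^ (2 * 0)" by simp
    also have "\<dots> \<le> A d" unfolding A_def using omega_pos by (intro member_le_sum) auto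
    finally show ?thesis .
  qed
  consider "b - a < 2 * pi" | "b - a = 2 * pi" | "b - a > 2 * pi" by linarith
  then show ?thesis
  proof cases
    case 1
    then have \<omega>1: "\<omega> > 1" using ab by (simp add: \<omega>)
    \<comment> \<open>The number of terms is absorbed by 1 + s \<le> exp s, hence the constant 1 + 2
      ln \<omega>.\<close>
    have "A d \<le> exp ((1 + 2 * ln \<omega>) * real (s d))" for d
    proof -
      have "A d \<le> (\<Sum>l\<le>s d. \<omega> ^ (2 * s d))"
        unfolding A_def using \<omega>1 by (intro sum_mono power_increasing) auto
      also have "\<dots> = (1 + real (s d)) * \<omega> ^ (2 * s d)" by simp
      also have "\<dots> \<le> exp (real (s d)) * \<omega> ^ (2 * s d)"
        using \<omega>1 by (intro mult_right_mono exp_ge_add_one_self) auto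
      also have "\<omega> ^ (2 * s d) = exp (real (2 * s d) * ln \<omega>)"
        using \<omega>1 by (simp add: exp_of_nat_mult del: of_nat_mult)
      finally show ?thesis by (simp add: exp_add[symmetric] algebra_simps)
    qed
    moreover have "1 + 2 * ln \<omega> > 0" using ln_gt_zero[OF \<omega>1] by simp
    ultimately have "grows_at_least_logarithmically s"
      using lower A1 tr by (intro grows_logarithmically_if_tractable[where A = A]) auto
    with 1 show ?thesis by simp
  next
    case 2
    then have "\<omega> = 1" using ab by (simp add: \<omega>)
    then have "A d = real (s d) + 1" for d by (simp add: A_def)
    then have "grows_at_least_polynomially s"
      using lower s tr by (intro grows_polynomially_if_tractable[where A = A]) auto
    with 2 show ?thesis by simp
  next
    case 3
    then have "\<omega> < 1" using ab by (simp add: \<omega>)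
    then have \<omega>1: "\<omega>\<^sup>2 < 1" using omega_pos by (simp add: abs_square_less_1)
    have "A d \<le> 1 / (1 - \<omega>\<^sup>2)" for d
    proof -
      have "A d = (\<Sum>l<Suc (s d). (\<omega>\<^sup>2) ^ l)" by (simp add: A_def power_mult lessThan_Suc_atMost)
      also have "\<dots> \<le> (\<Sum>l. (\<omega>\<^sup>2) ^ l)"
        using \<omega>1 by (intro sum_le_suminf summable_geometric) auto
      also have "\<dots> = 1 / (1 - \<omega>\<^sup>2)" using \<omega>1 by (intro suminf_geometric) simp
      finally show ?thesis .
    qed
    then have "\<not> polynomially_tractable (\<lambda>d. Hmix_torus a b (s d) d) (\<lambda>d. L2_cube a b d) (\<lambda>d f. f)"
      by (intro not_polynomially_tractable_bounded[where A = A] lower A1)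
    then show ?thesis using tr by contradiction
  qed
qed

end

section \<open>Density of trigonometric polynomials\<close>

text \<open>An inductive span turns closure properties into short inductions;
  \<open>lin_span_form\<close> recovers explicit coefficients where an expansion is needed.\<close>

inductive_set lin_span :: "('k \<Rightarrow> 'a \<Rightarrow> complex) \<Rightarrow> 'k set \<Rightarrow> ('a \<Rightarrow> complex) set"
  for e :: "'k \<Rightarrow> 'a \<Rightarrow> complex" and K :: "'k set" where
  zero: "(\<lambda>x. 0) \<in> lin_span e K"
| step: "f \<in> lin_span e K \<Longrightarrow> k \<in> K \<Longrightarrow> (\<lambda>x. f x + c * e k x) \<in> lin_span e K"

lemma lin_span_base: "k \<in> K \<Longrightarrow> (\<lambda>x. c * e k x) \<in> lin_span e K"
  using lin_span.step[OF lin_span.zero, of k K c e] by simp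

lemma lin_span_add:
  assumes "f \<in> lin_span e K" "g \<in> lin_span e K"
  shows "(\<lambda>x. f x + g x) \<in> lin_span e K"
  using assms(2)
proof induction
  case zero
  then show ?case using assms(1) by simp
next
  case (step g k c)
  then show ?case using lin_span.step[OF step.IH step.hyps(2), of c] by (simp add: add.assoc)
qed

lemma lin_span_cmult:
  assumes "f \<in> lin_span e K"
  shows "(\<lambda>x. c * f x) \<in> lin_span e K"
  using assms
proof induction
  case zero
  then show ?case by (simp add: lin_span.zero)
next
  case (step f k c')
  then show ?case using lin_span.step[OF step.IH step.hyps(2), of "c * c'"]
    by (simp add: distrib_left mult.assoc)
qed

lemma lin_span_sum: "(\<And>i. i \<in> I \<Longrightarrow> f i \<in> lin_span e K) \<Longrightarrow> (\<lambda>x. \<Sum>i\<in>I. f i x) \<in> lin_span e K"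
  by (induction I rule: infinite_finite_induct) (simp_all add: lin_span.zero lin_span_add)

lemma lin_span_form:
  assumes "f \<in> lin_span e K"
  shows "\<exists>F c. finite F \<and> F \<subseteq> K \<and> f = (\<lambda>x. \<Sum>k\<in>F. c k * e k x)"
  using assms
proof induction
  case zero
  show ?case by (intro exI[of _ "{}"]) simp
next
  case (step f k c)
  obtain F c' where F: "finite F" "F \<subseteq> K" "f = (\<lambda>x. \<Sum>k\<in>F. c' k * e k x)"
    using step.IH by blast
  \<comment> \<open>k may already lie in F, in which case the coefficients add up.\<close>
  define c'' where "c'' = (\<lambda>l. (if l \<in> F then c' l else 0) + (if l = k then c else 0))"
  have "(\<Sum>l\<in>insert k F. c'' l * e l x) = f x + c * e k x" for x
  proof -
    have "(\<Sum>l\<in>insert k F. c'' l * e l x) =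
        (\<Sum>l\<in>insert k F. if l \<in> F then c' l * e l x else 0) + (\<Sum>l\<in>insert k F. if l = k then c * e l x else 0)"
      unfolding sum.distrib[symmetric] by (rule sum.cong) (auto simp: c''_def distrib_right)
    also have "(\<Sum>l\<in>insert k F. if l \<in> F then c' l * e l x else 0) = (\<Sum>l\<in>F. c' l * e l x)"
      using F(1) by (intro sum.mono_neutral_cong_right) auto
    also have "(\<Sum>l\<in>insert k F. if l = k then c * e l x else 0) = c * e k x"
      using F(1) by (simp add: sum.delta)
    finally show ?thesis by (simp add: F(3))
  qed
  then show ?case
    using F(1,2) step.hyps(2) by (intro exI[of _ "insert k F"] exI[of _ c'']) (auto simp: fun_eq_iff)
qed

text \<open>Frequencies add under multiplication, so trigonometric polynomials form an algebra, as
  the induction over polynomial functions requires.\<close>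

lemma trig_mult:
  assumes "f \<in> lin_span (\<lambda>k. fourier \<omega> k 0) UNIV" "g \<in> lin_span (\<lambda>k. fourier \<omega> k 0) UNIV"
  shows "(\<lambda>t. f t * g t) \<in> lin_span (\<lambda>k. fourier \<omega> k 0) UNIV"
  using assms(1)
proof induction
  case zero
  show ?case by (simp add: lin_span.zero)
next
  case (step f k c)
  have "(\<lambda>t. fourier \<omega> k 0 t * g t) \<in> lin_span (\<lambda>k. fourier \<omega> k 0) UNIV"
    using assms(2)
  proof induction
    case zero
    show ?case by (simp add: lin_span.zero)
  next
    case (step g j c)
    have "(\<lambda>t. fourier \<omega> k 0 t * g t + c * fourier \<omega> (k + j) 0 t) \<in> lin_span (\<lambda>k. fourier \<omega> k 0) UNIV"
      by (rule lin_span.step[OF step.IH]) simp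
    then show ?case by (simp add: distrib_left mult.left_commute[of _ c] fourier_mult)
  qed
  from lin_span_add[OF step.IH lin_span_cmult[OF this, of c]]
  show ?case by (simp add: distrib_right mult.assoc)
qed

lemma trig_const: "(\<lambda>t. c) \<in> lin_span (\<lambda>k. fourier \<omega> k 0) UNIV"
  using lin_span_base[of 0 UNIV c "\<lambda>k. fourier \<omega> k 0"] by (simp add: fourier_0)

text \<open>A real-linear function of cis x is a combination of cos x and sin x, hence by Euler's
  formulas of the frequencies 1 and -1; products and sums stay in the algebra.\<close>

lemma trig_real_polynomial:
  assumes "real_polynomial_function h"
  shows "(\<lambda>t. complex_of_real (h (cis (\<omega> * t)))) \<in> lin_span (\<lambda>k. fourier \<omega> k 0) UNIV"
  using assms
proof induction
  case (linear h)
  interpret bounded_linear h by fact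
  have "complex_of_real (h (cis (\<omega> * t))) =
      ((of_real (h 1) - \<i> * of_real (h \<i>)) / 2) * fourier \<omega> 1 0 t +
      ((of_real (h 1) + \<i> * of_real (h \<i>)) / 2) * fourier \<omega> (- 1) 0 t" for t
  proof -
    have "cis (\<omega> * t) = cos (\<omega> * t) *\<^sub>R 1 + sin (\<omega> * t) *\<^sub>R \<i>"
      by (simp add: complex_eq_iff)
    then have "h (cis (\<omega> * t)) = cos (\<omega> * t) * h 1 + sin (\<omega> * t) * h \<i>"
      by (simp only: add scaleR real_scaleR_def)
    then show ?thesis
      by (simp add: fourier_def complex_eq_iff) (simp add: field_simps)
  qed
  then show ?case
    by (simp only:) (intro lin_span_add lin_span_base UNIV_I)
next
  case (const c)
  show ?case by (rule trig_const)
next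
  case (add f g)
  then show ?case using lin_span_add by fastforce
next
  case (mult f g)
  then show ?case using trig_mult by fastforce
qed

lemma trig_polynomial:
  assumes "polynomial_function (g :: complex \<Rightarrow> complex)"
  shows "(\<lambda>t. g (cis (\<omega> * t))) \<in> lin_span (\<lambda>k. fourier \<omega> k 0) UNIV"
proof -
  have "real_polynomial_function (Re \<circ> g)" "real_polynomial_function (Im \<circ> g)"
    using assms bounded_linear_Re bounded_linear_Im unfolding polynomial_function_def by blast+
  note this[THEN trig_real_polynomial, of \<omega>]
  from lin_span_add[OF this(1) lin_span_cmult[OF this(2), of \<i>]]
  show ?thesis by (simp add: complex_eq[symmetric] mult.commute)
qed

lemma trig_L2:
  assumes "f \<in> lin_span (\<lambda>k. fourier \<omega> k 0) UNIV"
  shows "f \<in> vecs (L2_space (interval_measure_on a b))"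
  using assms
  by induction (simp_all add: L2_zero L2_add L2_cmult smooth_family_L2[OF smooth_family_fourier])

interpretation L2_interval: semi_inner_space "L2_space (interval_measure_on a b)" for a b
  by (rule semi_inner_space_L2)

lemma hnorm_L2_cube_prod:
  assumes "\<And>i. i < d \<Longrightarrow> u i \<in> vecs (L2_space (interval_measure_on a b))"
  shows "hnorm (L2_cube a b d) (\<lambda>x. \<Prod>i<d. u i (x i)) = (\<Prod>i<d. hnorm (L2_space (interval_measure_on a b)) (u i))"
proof -
  have "sprod (L2_cube a b d) (\<lambda>x. \<Prod>i<d. u i (x i)) (\<lambda>x. \<Prod>i<d. u i (x i)) =
      (\<Prod>i<d. of_real ((hnorm (L2_space (interval_measure_on a b)) (u i))\<^sup>2))"
    by (subst sprod_L2_cube_prod) (simp_all add: assms L2_interval.sprod_self)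
  also have "\<dots> = of_real ((\<Prod>i<d. hnorm (L2_space (interval_measure_on a b)) (u i))\<^sup>2)"
    by (simp only: of_real_prod prod_power_distrib)
  finally have "sprod (L2_cube a b d) (\<lambda>x. \<Prod>i<d. u i (x i)) (\<lambda>x. \<Prod>i<d. u i (x i)) =
      of_real ((\<Prod>i<d. hnorm (L2_space (interval_measure_on a b)) (u i))\<^sup>2)" .
  moreover have "0 \<le> (\<Prod>i<d. hnorm (L2_space (interval_measure_on a b)) (u i))"
    by (intro prod_nonneg L2_interval.hnorm_nonneg assms) simp
  ultimately show ?thesis by (simp add: hnorm_def[of "L2_cube a b d"] del: of_real_power)
qed

definition fourier_cube :: "real \<Rightarrow> nat \<Rightarrow> (nat \<Rightarrow> int) \<Rightarrow> (nat \<Rightarrow> real) \<Rightarrow> complex" where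
  "fourier_cube \<omega> d k = (\<lambda>x. \<Prod>i<d. fourier \<omega> (k i) 0 (x i))"

abbreviation freqs :: "nat \<Rightarrow> (nat \<Rightarrow> int) set" where
  "freqs d \<equiv> {..<d} \<rightarrow>\<^sub>E UNIV"

lemma fourier_cube_span_prod:
  assumes "\<And>i. i < d \<Longrightarrow> p i \<in> lin_span (\<lambda>k. fourier \<omega> k 0) UNIV"
  shows "(\<lambda>x. \<Prod>i<d. p i (x i)) \<in> lin_span (fourier_cube \<omega> d) (freqs d)"
proof -
  have "\<exists>F c. finite F \<and> p i = (\<lambda>t. \<Sum>k\<in>F. c k * fourier \<omega> k 0 t)" if "i < d" for i
    using lin_span_form[OF assms[OF that]] by blast
  then have "\<exists>G. \<forall>i<d. finite (fst (G i)) \<and> p i = (\<lambda>t. \<Sum>k\<in>fst (G i). snd (G i) k * fourier \<omega> k 0 t)"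
    by (intro choice) (simp add: split_paired_Ex)
  then obtain G where "\<And>i. i < d \<Longrightarrow> finite (fst (G i))"
    "\<And>i. i < d \<Longrightarrow> p i = (\<lambda>t. \<Sum>k\<in>fst (G i). snd (G i) k * fourier \<omega> k 0 t)" by blast
  moreover define F c where "F i = fst (G i)" and "c i = snd (G i)" for i
  ultimately have F: "\<And>i. i < d \<Longrightarrow> finite (F i)"
    and p: "\<And>i. i < d \<Longrightarrow> p i = (\<lambda>t. \<Sum>k\<in>F i. c i k * fourier \<omega> k 0 t)" by simp_all
  have "(\<Prod>i<d. p i (x i)) = (\<Sum>k\<in>PiE {..<d} F. (\<Prod>i<d. c i (k i)) * fourier_cube \<omega> d k x)" for x
  proof -
    have "(\<Prod>i<d. p i (x i)) = (\<Prod>i<d. \<Sum>k\<in>F i. c i k * fourier \<omega> k 0 (x i))"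
      by (intro prod.cong refl) (simp add: p)
    also have "\<dots> = (\<Sum>k\<in>PiE {..<d} F. \<Prod>i<d. c i (k i) * fourier \<omega> (k i) 0 (x i))"
      using F by (intro prod_sum_PiE) simp_all
    finally show ?thesis by (simp add: fourier_cube_def prod.distrib)
  qed
  moreover have "(\<lambda>x. \<Sum>k\<in>PiE {..<d} F. (\<Prod>i<d. c i (k i)) * fourier_cube \<omega> d k x) \<in> lin_span (fourier_cube \<omega> d) (freqs d)"
  proof (intro lin_span_sum lin_span_base)
    fix k assume "k \<in> PiE {..<d} F"
    then show "k \<in> freqs d" using PiE_mono[of "{..<d}" F "\<lambda>_. UNIV"] by blast
  qed
  ultimately show ?thesis by simp
qed

lemma fourier_cube_L2: "fourier_cube \<omega> d k \<in> vecs (L2_cube a b d)"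
  unfolding fourier_cube_def by (intro L2_cube_prod smooth_family_L2[OF smooth_family_fourier])

lemma span_L2: "P \<in> lin_span (fourier_cube \<omega> d) K \<Longrightarrow> P \<in> vecs (L2_cube a b d)"
  by (induction rule: lin_span.induct)
     (simp_all add: L2_cube.zero_mem L2_cube.add_mem L2_cube.cmult_mem fourier_cube_L2)

definition approximable :: "real \<Rightarrow> real \<Rightarrow> real \<Rightarrow> nat \<Rightarrow> ((nat \<Rightarrow> real) \<Rightarrow> complex) \<Rightarrow> bool" where
  "approximable a b \<omega> d f \<longleftrightarrow>
    (\<forall>\<epsilon>>0. \<exists>P\<in>lin_span (fourier_cube \<omega> d) (freqs d). hdist (L2_cube a b d) f P < \<epsilon>)"

context
  fixes a b \<omega> :: real
  assumes ab: "a < b" and \<omega>: "\<omega> = 2 * pi / (b - a)"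
begin

text \<open>Since \<omega> (b - a) = 2 pi, the curve winds around the circle exactly once, and only
  the two end points meet.\<close>

lemma cis_eq_on_interval:
  assumes "cis (\<omega> * t) = cis (\<omega> * t')" "t \<in> {a..b}" "t' \<in> {a..b}" "t < t'"
  shows "t = a \<and> t' = b"
proof -
  have "sin (\<omega> * t') = sin (\<omega> * t) \<and> cos (\<omega> * t') = cos (\<omega> * t)"
    using assms(1) by (simp add: complex_eq_iff)
  then obtain n :: int where "\<omega> * t' = \<omega> * t + 2 * pi * n" unfolding sin_cos_eq_iff by blast
  then have "\<omega> * (t' - t) = \<omega> * ((b - a) * n)" using ab by (simp add: \<omega> field_simps)
  then have n: "t' - t = (b - a) * n" using omega_pos[OF ab \<omega>] by simp
  then have "(b - a) * n > 0" using assms(4) by simp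
  then have "n > 0" using ab by (simp add: zero_less_mult_iff)
  then have "real_of_int n \<ge> 1" by simp
  then have "t' - t \<ge> b - a" unfolding n using ab by (simp add: mult_le_cancel_left1)
  then show ?thesis using assms(2,3) by auto
qed

text \<open>A periodic U factors through the circle, where the Stone-Weierstrass theorem applies;
  polynomials in the point of the circle pull back to trigonometric polynomials.\<close>

lemma trig_dense_periodic:
  assumes U: "continuous_on {a..b} U" "U a = U b" and "\<epsilon> > 0"
  shows "\<exists>p\<in>lin_span (\<lambda>k. fourier \<omega> k 0) UNIV. \<forall>t\<in>{a..b}. cmod (U t - p t) < \<epsilon>"
proof -
  let ?\<phi> = "\<lambda>t. cis (\<omega> * t)"
  define T where "T = ?\<phi> ` {a..b}"
  \<comment> \<open>An arbitrary preimage is chosen; the only ambiguity is between a and b, where U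
    agrees.\<close>
  define V where "V z = U (SOME t. t \<in> {a..b} \<and> ?\<phi> t = z)" for z
  have V: "V (?\<phi> t) = U t" if t: "t \<in> {a..b}" for t
  proof -
    define t' where "t' = (SOME t'. t' \<in> {a..b} \<and> ?\<phi> t' = ?\<phi> t)"
    have t': "t' \<in> {a..b} \<and> ?\<phi> t' = ?\<phi> t"
      unfolding t'_def by (rule someI[of _ t]) (use t in simp)
    have "U t' = U t"
    proof (rule linorder_cases[of t t'])
      assume "t < t'"
      then show ?thesis using cis_eq_on_interval[of t t'] t t' U(2) by simp
    next
      assume "t' < t"
      then show ?thesis using cis_eq_on_interval[of t' t] t t' U(2) by simp
    qed simp
    then show ?thesis by (simp add: V_def t'_def)
  qed
  have cont: "continuous_on {a..b} ?\<phi>" by (intro continuous_intros)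
  \<comment> \<open>The interval is compact, so the map onto the circle is a quotient map, and
    continuity of V follows from that of U.\<close>
  have "continuous_on T V"
    unfolding continuous_openin_preimage_eq
  proof (intro allI impI)
    fix W :: "complex set" assume "open W"
    have "{a..b} \<inter> ?\<phi> -` (T \<inter> V -` W) = {a..b} \<inter> U -` W"
    proof (rule set_eqI)
      fix t
      have "?\<phi> t \<in> T" if "t \<in> {a..b}" using that unfolding T_def by (rule imageI)
      then show "t \<in> {a..b} \<inter> ?\<phi> -` (T \<inter> V -` W) \<longleftrightarrow> t \<in> {a..b} \<inter> U -` W"
        using V[of t] by (simp only: Int_iff vimage_eq) metis
    qed
    moreover have "openin (top_of_set {a..b}) ({a..b} \<inter> U -` W)"
      using U(1) \<open>open W\<close> unfolding continuous_openin_preimage_eq by blast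
    ultimately have "openin (top_of_set {a..b}) ({a..b} \<inter> ?\<phi> -` (T \<inter> V -` W))" by simp
    then show "openin (top_of_set T) (T \<inter> V -` W)"
      using Abstract_Topology_2.continuous_imp_quotient_map[OF cont T_def[symmetric] compact_Icc, of "T \<inter> V -` W"]
      by simp
  qed
  moreover have "compact T" unfolding T_def by (rule compact_continuous_image[OF cont compact_Icc])
  ultimately obtain g where g: "polynomial_function g" "\<forall>z\<in>T. norm (V z - g z) < \<epsilon>"
    using Stone_Weierstrass_polynomial_function[of T V \<epsilon>] \<open>\<epsilon> > 0\<close> by blast
  show ?thesis
  proof (rule bexI[OF _ trig_polynomial[OF g(1)]], rule ballI)
    fix t assume t: "t \<in> {a..b}"
    then have "?\<phi> t \<in> T" by (simp add: T_def)
    then show "cmod (U t - g (?\<phi> t)) < \<epsilon>" using g(2) V[OF t] by auto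
  qed
qed

text \<open>As s \<ge> 1, u has a continuous representative with equal end values, to which uniform
  approximation applies.\<close>

lemma trig_dense_torus:
  assumes u: "u \<in> vecs (sobolev_torus a b s)" and "s \<ge> 1" and "\<epsilon> > 0"
  shows "\<exists>p\<in>lin_span (\<lambda>k. fourier \<omega> k 0) UNIV. hdist (L2_space (interval_measure_on a b)) u p < \<epsilon>"
proof -
  let ?I = "interval_measure_on a b"
  have u2: "u \<in> vecs (L2_space ?I)"
    using u by (simp add: sobolev_torus_def sobolev_interval_def)
  obtain U where U: "continuous_on {a..b} U" "has_weak_deriv a b 0 u U" "U a = U b"
    using u \<open>s \<ge> 1\<close> unfolding sobolev_torus_def by auto
  \<comment> \<open>A uniform error \<eta> costs at most \<eta> sqrt (b - a) = \<epsilon>/2 in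
    L2.\<close>
  define \<eta> where "\<eta> = \<epsilon> / (2 * sqrt (b - a))"
  have "\<eta> > 0" using ab \<open>\<epsilon> > 0\<close> by (simp add: \<eta>_def)
  then obtain p where p: "p \<in> lin_span (\<lambda>k. fourier \<omega> k 0) UNIV" "\<forall>t\<in>{a..b}. cmod (U t - p t) < \<eta>"
    using trig_dense_periodic[OF U(1,3)] by blast
  have p2: "p \<in> vecs (L2_space ?I)" by (rule trig_L2[OF p(1)])
  have U2: "U \<in> vecs (L2_space ?I)" by (rule L2_interval_continuous[OF U(1)])
  have "AE t in ?I. u t = U t" by (rule has_weak_deriv_0_AE[OF u2 U(2)])
  then have ae: "AE t in ?I. u t - p t = U t - p t" by eventually_elim simp
  have "(hdist (L2_space ?I) u p)\<^sup>2 = Re (sprod (L2_space ?I) (\<lambda>t. u t - p t) (\<lambda>t. u t - p t))"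
    unfolding hdist_def hnorm_def using L2_interval.sprod_nonneg[OF L2_diff[OF u2 p2]] by simp
  also have "sprod (L2_space ?I) (\<lambda>t. u t - p t) (\<lambda>t. u t - p t) =
      sprod (L2_space ?I) (\<lambda>t. U t - p t) (\<lambda>t. U t - p t)"
    by (rule sprod_L2_cong_AE[OF ae ae]) (intro L2_diff u2 U2 p2)+
  also have "Re \<dots> = (\<integral>t. (cmod (U t - p t))\<^sup>2 \<partial>?I)"
    by (simp only: sprod_L2 complex_norm_square[symmetric] integral_complex_of_real Re_complex_of_real)
  also have "\<dots> \<le> (\<integral>t. \<eta>\<^sup>2 \<partial>?I)"
  proof (rule integral_mono)
    show "integrable ?I (\<lambda>t. (cmod (U t - p t))\<^sup>2)" using L2_diff[OF U2 p2] by (simp add: L2_iff)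
    show "(cmod (U t - p t))\<^sup>2 \<le> \<eta>\<^sup>2" if "t \<in> space ?I" for t
      using p(2) that by (intro power_mono) (auto intro: less_imp_le)
  qed simp
  also have "\<dots> = \<eta>\<^sup>2 * (b - a)"
    using ab by (simp add: interval_measure_on_def measure_restrict_space)
  also have "\<dots> = (\<epsilon> / 2)\<^sup>2"
  proof -
    have "\<eta> * sqrt (b - a) = \<epsilon> / 2" using ab by (simp add: \<eta>_def)
    moreover have "(\<eta> * sqrt (b - a))\<^sup>2 = \<eta>\<^sup>2 * (b - a)" using ab by (simp add: power_mult_distrib)
    ultimately show ?thesis by (simp only:)
  qed
  finally have "hdist (L2_space ?I) u p \<le> \<epsilon> / 2"
    by (rule power2_le_imp_le) (use \<open>\<epsilon> > 0\<close> in simp)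
  then show ?thesis using p(1) \<open>\<epsilon> > 0\<close> by (intro bexI[of _ p]) auto
qed

lemma approximable_limit:
  assumes f: "f \<in> vecs (L2_cube a b d)"
    and lim: "\<And>\<epsilon>. \<epsilon> > 0 \<Longrightarrow> \<exists>g\<in>vecs (L2_cube a b d). approximable a b \<omega> d g \<and> hdist (L2_cube a b d) f g < \<epsilon>"
  shows "approximable a b \<omega> d f"
  unfolding approximable_def
proof (intro allI impI)
  fix \<epsilon> :: real assume "\<epsilon> > 0"
  then have "\<epsilon> / 2 > 0" by simp
  then obtain g where g: "g \<in> vecs (L2_cube a b d)" "approximable a b \<omega> d g" "hdist (L2_cube a b d) f g < \<epsilon> / 2"
    using lim by blast
  obtain P where P: "P \<in> lin_span (fourier_cube \<omega> d) (freqs d)" "hdist (L2_cube a b d) g P < \<epsilon> / 2"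
    using g(2) \<open>\<epsilon> / 2 > 0\<close> unfolding approximable_def by blast
  have "hdist (L2_cube a b d) f P < \<epsilon>"
    using L2_cube.hdist_triangle[OF f g(1) span_L2[OF P(1)]] g(3) P(2) by simp
  then show "\<exists>P\<in>lin_span (fourier_cube \<omega> d) (freqs d). hdist (L2_cube a b d) f P < \<epsilon>"
    using P(1) by (intro bexI[of _ P])
qed

lemma approximable_span: "P \<in> lin_span (fourier_cube \<omega> d) (freqs d) \<Longrightarrow> approximable a b \<omega> d P"
  unfolding approximable_def
  by (intro allI impI bexI[of _ P]) (simp_all add: hdist_def L2_cube.hnorm_zero)

lemma approximable_add:
  assumes "approximable a b \<omega> d f" "approximable a b \<omega> d g" "f \<in> vecs (L2_cube a b d)" "g \<in> vecs (L2_cube a b d)"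
  shows "approximable a b \<omega> d (\<lambda>x. f x + g x)"
  unfolding approximable_def
proof (intro allI impI)
  fix \<epsilon> :: real assume "\<epsilon> > 0"
  then have "\<epsilon> / 2 > 0" by simp
  obtain P where P: "P \<in> lin_span (fourier_cube \<omega> d) (freqs d)" "hdist (L2_cube a b d) f P < \<epsilon> / 2"
    using assms(1) \<open>\<epsilon> / 2 > 0\<close> unfolding approximable_def by blast
  obtain Q where Q: "Q \<in> lin_span (fourier_cube \<omega> d) (freqs d)" "hdist (L2_cube a b d) g Q < \<epsilon> / 2"
    using assms(2) \<open>\<epsilon> / 2 > 0\<close> unfolding approximable_def by blast
  have "hdist (L2_cube a b d) (\<lambda>x. f x + g x) (\<lambda>x. P x + Q x) =
      hnorm (L2_cube a b d) (\<lambda>x. (f x - P x) + (g x - Q x))"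
    by (simp add: hdist_def algebra_simps)
  also have "\<dots> \<le> hdist (L2_cube a b d) f P + hdist (L2_cube a b d) g Q"
    unfolding hdist_def
    by (intro L2_cube.hnorm_triangle L2_cube.diff_mem assms span_L2[OF P(1)] span_L2[OF Q(1)])
  finally have "hdist (L2_cube a b d) (\<lambda>x. f x + g x) (\<lambda>x. P x + Q x) < \<epsilon>" using P(2) Q(2) by simp
  then show "\<exists>P\<in>lin_span (fourier_cube \<omega> d) (freqs d). hdist (L2_cube a b d) (\<lambda>x. f x + g x) P < \<epsilon>"
    by (rule bexI[where x = "\<lambda>x. P x + Q x"]) (rule lin_span_add[OF P(1) Q(1)])
qed

lemma approximable_cmult:
  assumes "approximable a b \<omega> d f" "f \<in> vecs (L2_cube a b d)"
  shows "approximable a b \<omega> d (\<lambda>x. c * f x)"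
  unfolding approximable_def
proof (intro allI impI)
  fix \<epsilon> :: real assume "\<epsilon> > 0"
  have c: "0 < cmod c + 1" by (simp add: add_nonneg_pos)
  then have "\<epsilon> / (cmod c + 1) > 0" using \<open>\<epsilon> > 0\<close> by simp
  then obtain P where P: "P \<in> lin_span (fourier_cube \<omega> d) (freqs d)" "hdist (L2_cube a b d) f P < \<epsilon> / (cmod c + 1)"
    using assms(1) unfolding approximable_def by blast
  have "hdist (L2_cube a b d) (\<lambda>x. c * f x) (\<lambda>x. c * P x) = cmod c * hdist (L2_cube a b d) f P"
    unfolding hdist_def right_diff_distrib[symmetric]
    by (intro L2_cube.hnorm_cmult L2_cube.diff_mem assms span_L2[OF P(1)])
  also have "\<dots> \<le> cmod c * (\<epsilon> / (cmod c + 1))"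
    using P(2) by (intro mult_left_mono) simp_all
  also have "\<dots> < \<epsilon>"
    using c \<open>\<epsilon> > 0\<close> by (simp add: pos_divide_less_eq distrib_left mult.commute)
  finally show "\<exists>P\<in>lin_span (fourier_cube \<omega> d) (freqs d). hdist (L2_cube a b d) (\<lambda>x. c * f x) P < \<epsilon>"
    by (intro bexI[where x = "\<lambda>x. c * P x"] lin_span_cmult[OF P(1)])
qed

lemma approximable_sum:
  assumes "\<And>i. i \<in> I \<Longrightarrow> approximable a b \<omega> d (f i)" "\<And>i. i \<in> I \<Longrightarrow> f i \<in> vecs (L2_cube a b d)"
  shows "approximable a b \<omega> d (\<lambda>x. \<Sum>i\<in>I. f i x)"
  using assms
  by (induction I rule: infinite_finite_induct)
     (simp_all add: approximable_span lin_span.zero approximable_add L2_cube.sum_mem)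

text \<open>Replace the factors by trigonometric polynomials one coordinate at a time.\<close>

lemma approximable_prod:
  assumes "\<And>i. i < d \<Longrightarrow> u i \<in> vecs (L2_space (interval_measure_on a b))"
    and "\<And>i \<epsilon>. \<lbrakk>i < d; \<epsilon> > 0\<rbrakk> \<Longrightarrow>
      \<exists>p\<in>lin_span (\<lambda>k. fourier \<omega> k 0) UNIV. hdist (L2_space (interval_measure_on a b)) (u i) p < \<epsilon>"
  shows "approximable a b \<omega> d (\<lambda>x. \<Prod>i<d. u i (x i))"
proof -
  let ?I = "interval_measure_on a b" and ?T = "lin_span (\<lambda>k. fourier \<omega> k 0) UNIV"
  \<comment> \<open>Induction on j: the factors from j on are already trigonometric polynomials, and
    the step from j to j + 1 approximates factor j.\<close>
  have "approximable a b \<omega> d (\<lambda>x. \<Prod>i<d. u i (x i))"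
    if "j \<le> d" "\<forall>i<d. u i \<in> vecs (L2_space ?I)"
      "\<forall>i<d. \<forall>\<epsilon>>0. \<exists>p\<in>?T. hdist (L2_space ?I) (u i) p < \<epsilon>"
      "\<forall>i. j \<le> i \<and> i < d \<longrightarrow> u i \<in> ?T" for j u
    using that
  proof (induction j arbitrary: u)
    case 0
    then show ?case by (intro approximable_span fourier_cube_span_prod) simp
  next
    case (Suc j)
    then have "j < d" by simp
    \<comment> \<open>Replacing factor j changes the product by the error of that factor times
      \<open>?M\<close>; the 1 added to \<open>?M\<close> below guards against \<open>?M\<close> =
      0.\<close>
    let ?M = "\<Prod>i\<in>{..<d} - {j}. hnorm (L2_space ?I) (u i)"
    have u2: "u i \<in> vecs (L2_space ?I)" if "i < d" for i using Suc.prems(2) that by simp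
    have M: "?M \<ge> 0" by (intro prod_nonneg L2_interval.hnorm_nonneg u2) simp
    show ?case
    proof (rule approximable_limit)
      show "(\<lambda>x. \<Prod>i<d. u i (x i)) \<in> vecs (L2_cube a b d)" by (rule L2_cube_prod[OF u2])
      fix \<epsilon> :: real assume "\<epsilon> > 0"
      then have "\<epsilon> / (?M + 1) > 0" using M by simp
      then obtain p where p: "p \<in> ?T" "hdist (L2_space ?I) (u j) p < \<epsilon> / (?M + 1)"
        using Suc.prems(3) \<open>j < d\<close> by blast
      have p2: "p \<in> vecs (L2_space ?I)" by (rule trig_L2[OF p(1)])
      have up2: "(u(j := p)) i \<in> vecs (L2_space ?I)" if "i < d" for i using u2 p2 that by simp
      have diff2: "(u(j := \<lambda>t. u j t - p t)) i \<in> vecs (L2_space ?I)" if "i < d" for i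
        using u2 p2 that L2_diff[OF u2[OF \<open>j < d\<close>] p2] by simp
      have split: "(\<Prod>i<d. (u(j := v)) i (x i)) = v (x j) * (\<Prod>i\<in>{..<d} - {j}. u i (x i))" for v x
      proof -
        have "(\<Prod>i\<in>{..<d} - {j}. (u(j := v)) i (x i)) = (\<Prod>i\<in>{..<d} - {j}. u i (x i))"
          by (rule prod.cong) simp_all
        then show ?thesis
          using \<open>j < d\<close> prod.remove[of "{..<d}" j "\<lambda>i. (u(j := v)) i (x i)"] by simp
      qed
      have eq: "(\<Prod>i<d. u i (x i)) - (\<Prod>i<d. (u(j := p)) i (x i)) = (\<Prod>i<d. (u(j := \<lambda>t. u j t - p t)) i (x i))" for x
        using split[of "u j" x] unfolding split fun_upd_triv by (simp add: left_diff_distrib)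
      have "hdist (L2_cube a b d) (\<lambda>x. \<Prod>i<d. u i (x i)) (\<lambda>x. \<Prod>i<d. (u(j := p)) i (x i)) =
          (\<Prod>i<d. hnorm (L2_space ?I) ((u(j := \<lambda>t. u j t - p t)) i))"
        unfolding hdist_def eq by (rule hnorm_L2_cube_prod[OF diff2])
      also have "\<dots> = hdist (L2_space ?I) (u j) p * ?M"
      proof -
        have "(\<Prod>i\<in>{..<d} - {j}. hnorm (L2_space ?I) ((u(j := \<lambda>t. u j t - p t)) i)) = ?M"
          by (rule prod.cong) simp_all
        then show ?thesis
          using \<open>j < d\<close> prod.remove[of "{..<d}" j "\<lambda>i. hnorm (L2_space ?I) ((u(j := \<lambda>t. u j t - p t)) i)"]
          by (simp add: hdist_def)
      qed
      also have "\<dots> \<le> \<epsilon> / (?M + 1) * ?M"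
        using p(2) M by (intro mult_right_mono) simp_all
      also have "\<dots> < \<epsilon>"
      proof -
        have "0 < ?M + 1" using M by simp
        then show ?thesis using \<open>\<epsilon> > 0\<close> by (simp add: pos_divide_less_eq distrib_left)
      qed
      finally have d: "hdist (L2_cube a b d) (\<lambda>x. \<Prod>i<d. u i (x i)) (\<lambda>x. \<Prod>i<d. (u(j := p)) i (x i)) < \<epsilon>" .
      have "approximable a b \<omega> d (\<lambda>x. \<Prod>i<d. (u(j := p)) i (x i))"
      proof (rule Suc.IH)
        show "j \<le> d" using Suc.prems(1) by simp
        show "\<forall>i<d. (u(j := p)) i \<in> vecs (L2_space ?I)" using up2 by blast
        show "\<forall>i. j \<le> i \<and> i < d \<longrightarrow> (u(j := p)) i \<in> ?T"
        proof (intro allI impI)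
          fix i assume "j \<le> i \<and> i < d"
          then show "(u(j := p)) i \<in> ?T" using Suc.prems(4) p(1) by (cases "i = j") auto
        qed
        have "\<exists>q\<in>?T. hdist (L2_space ?I) p q < e" if "e > 0" for e
          using p(1) that by (intro bexI[of _ p]) (simp_all add: hdist_def L2_interval.hnorm_zero)
        then show "\<forall>i<d. \<forall>\<epsilon>>0. \<exists>q\<in>?T. hdist (L2_space ?I) ((u(j := p)) i) q < \<epsilon>"
          using Suc.prems(3) by simp
      qed
      then show "\<exists>g\<in>vecs (L2_cube a b d). approximable a b \<omega> d g \<and> hdist (L2_cube a b d) (\<lambda>x. \<Prod>i<d. u i (x i)) g < \<epsilon>"
        using d L2_cube_prod[OF up2] by (intro bexI[where x = "\<lambda>x. \<Prod>i<d. (u(j := p)) i (x i)"] conjI)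
    qed
  qed
  note claim = this[OF order_refl]
  show ?thesis
  proof (rule claim)
    show "\<forall>i. d \<le> i \<and> i < d \<longrightarrow> u i \<in> ?T" by (simp add: not_le[symmetric])
  qed (use assms in blast)+
qed

text \<open>The Sobolev norm dominates the L2 norm, so the closure of the algebraic tensors stays
  within the L2 limits of trigonometric polynomials.\<close>

lemma approximable_torus:
  assumes f: "f \<in> vecs (Hmix_torus a b s d)" and "s \<ge> 1"
  shows "approximable a b \<omega> d f"
proof (rule approximable_limit)
  have fM: "f \<in> vecs (mixed_sobolev a b s d)"
    using f by (simp add: Hmix_torus_def tensor_power_vecs)
  then show "f \<in> vecs (L2_cube a b d)" by (rule mixed_sobolev_L2)
  fix \<epsilon> :: real assume "\<epsilon> > 0"
  then obtain g where g: "g \<in> algebraic_tensor_power d (vecs (sobolev_torus a b s))"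
    "hdist (mixed_sobolev a b s d) f g < \<epsilon>"
    using f unfolding Hmix_torus_def tensor_power_vecs by blast
  have gM: "g \<in> vecs (mixed_sobolev a b s d)"
    by (rule algebraic_tensor_power_mixed_sobolev[OF sobolev_torus_subset g(1)])
  have "hdist (L2_cube a b d) f g \<le> hdist (mixed_sobolev a b s d) f g"
    unfolding hdist_def by (intro hnorm_L2_le_mixed mixed.diff_mem fM gM)
  then have "hdist (L2_cube a b d) f g < \<epsilon>" using g(2) by simp
  moreover have "approximable a b \<omega> d g"
  proof -
    obtain m :: nat and c u where g': "g = (\<lambda>x. \<Sum>j<m. c j * (\<Prod>i<d. u j i (x i)))"
      and u: "\<forall>j<m. \<forall>i<d. u j i \<in> vecs (sobolev_torus a b s)"
      using g(1) unfolding algebraic_tensor_power_def by blast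
    have u2: "u j i \<in> vecs (L2_space (interval_measure_on a b))" if "j \<in> {..<m}" "i < d" for i j
      using u that by (intro sobolev_interval_L2[where s = s] subsetD[OF sobolev_torus_subset]) simp
    show ?thesis
      unfolding g'
    proof (intro approximable_sum approximable_cmult approximable_prod L2_cube.cmult_mem L2_cube_prod u2)
      fix i j and e :: real assume "j \<in> {..<m}" "i < d" "e > 0"
      then show "\<exists>p\<in>lin_span (\<lambda>k. fourier \<omega> k 0) UNIV. hdist (L2_space (interval_measure_on a b)) (u j i) p < e"
        using u by (intro trig_dense_torus[OF _ \<open>s \<ge> 1\<close>]) auto
    qed
  qed
  ultimately show "\<exists>g\<in>vecs (L2_cube a b d). approximable a b \<omega> d g \<and> hdist (L2_cube a b d) f g < \<epsilon>"
    using mixed_sobolev_L2[OF gM] by blast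
qed

end

section \<open>Upper bounds on the torus\<close>

lemma sum_inverse_squares_le: "(\<Sum>k=1..N. 1 / (real k)\<^sup>2) \<le> 2"
proof -
  \<comment> \<open>The stronger bound makes the induction work, as 1/(n + 1)^2 is at most 1/n -
    1/(n + 1).\<close>
  have "(\<Sum>k=1..Suc N. 1 / (real k)\<^sup>2) \<le> 2 - 1 / real (Suc N)" for N
  proof (induction N)
    case (Suc N)
    have "1 / (real (Suc (Suc N)))\<^sup>2 \<le> 1 / (real (Suc N) * real (Suc (Suc N)))"
      unfolding power2_eq_square by (intro divide_left_mono mult_right_mono) simp_all
    also have "\<dots> = 1 / real (Suc N) - 1 / real (Suc (Suc N))" by (simp add: field_simps)
    finally show ?case using Suc.IH by simp
  qed simp
  from this[of N] have "(\<Sum>k=1..Suc N. 1 / (real k)\<^sup>2) \<le> 2" by (rule order_trans) simp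
  moreover have "(\<Sum>k=1..N. 1 / (real k)\<^sup>2) \<le> (\<Sum>k=1..Suc N. 1 / (real k)\<^sup>2)"
    by (intro sum_mono2) auto
  ultimately show ?thesis by linarith
qed

lemma sum_int_inverse_squares_le:
  "(\<Sum>k\<in>{- int N..int N} - {0}. 1 / (real_of_int k)\<^sup>2) \<le> 4"
proof -
  have set: "{- int N..int N} - {0} = int ` {1..N} \<union> (\<lambda>k. - int k) ` {1..N}" (is "?L = ?R")
  proof (intro equalityI subsetI)
    fix k assume k: "k \<in> ?L"
    show "k \<in> ?R"
    proof (cases "k > 0")
      case True
      then have "k = int (nat k)" "nat k \<in> {1..N}" using k by auto
      then show ?thesis by blast
    next
      case False
      then have "k = - int (nat (- k))" "nat (- k) \<in> {1..N}" using k by auto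
      then show ?thesis by blast
    qed
  qed auto
  have "(\<Sum>k\<in>{- int N..int N} - {0}. 1 / (real_of_int k)\<^sup>2) =
      (\<Sum>k\<in>int ` {1..N}. 1 / (real_of_int k)\<^sup>2) + (\<Sum>k\<in>(\<lambda>k. - int k) ` {1..N}. 1 / (real_of_int k)\<^sup>2)"
    unfolding set by (rule sum.union_disjoint) auto
  also have "\<dots> = (\<Sum>k=1..N. 1 / (real k)\<^sup>2) + (\<Sum>k=1..N. 1 / (real k)\<^sup>2)"
    by (subst (1 2) sum.reindex) (auto simp: inj_on_def)
  also have "\<dots> \<le> 4" using sum_inverse_squares_le[of N] by simp
  finally show ?thesis .
qed

context
  fixes a b \<omega> :: real
  assumes ab: "a < b" and \<omega>: "\<omega> = 2 * pi / (b - a)"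
begin

definition weight :: "nat \<Rightarrow> int \<Rightarrow> real" where
  "weight s k = (\<Sum>l\<le>s. (\<omega> * of_int k) ^ (2 * l))"

lemma weight_ge_term: "l \<le> s \<Longrightarrow> (\<omega> * of_int k) ^ (2 * l) \<le> weight s k"
  unfolding weight_def by (rule member_le_sum) (simp_all add: power_mult)

lemma weight_ge_1: "weight s k \<ge> 1"
  using weight_ge_term[of 0 s k] by simp

lemma weight_0: "weight s 0 = 1"
proof -
  have "weight s 0 = (\<Sum>l\<le>s. if l = 0 then 1 else 0)"
    unfolding weight_def by (intro sum.cong refl) simp
  then show ?thesis by simp
qed

text \<open>Induction on the order. For l < s the derivative of order l has a continuous periodic
  representative g, and h is the first weak derivative of g; periodic integration by parts moves it
  onto the conjugate exponential, which produces one factor i \<omega> k.\<close>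

lemma sprod_weak_deriv_fourier:
  assumes u: "u \<in> vecs (sobolev_torus a b s)"
  shows "l \<le> s \<Longrightarrow> has_weak_deriv a b l u h \<Longrightarrow>
    sprod (L2_space (interval_measure_on a b)) h (fourier \<omega> k 0) =
    (\<i> * of_real (\<omega> * of_int k)) ^ l * sprod (L2_space (interval_measure_on a b)) u (fourier \<omega> k 0)"
proof (induction l arbitrary: h)
  case 0
  let ?I = "interval_measure_on a b"
  have u2: "u \<in> vecs (L2_space ?I)"
    using u by (simp add: sobolev_torus_def sobolev_interval_def)
  have "AE t in ?I. h t = u t"
    using has_weak_deriv_0_AE[OF u2 0(2)] by eventually_elim simp
  then have "sprod (L2_space ?I) h (fourier \<omega> k 0) = sprod (L2_space ?I) u (fourier \<omega> k 0)"
    using 0(2) u2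
    by (intro sprod_L2_cong_AE) (simp_all add: has_weak_deriv_def smooth_family_L2[OF smooth_family_fourier])
  then show ?case by simp
next
  case (Suc l)
  let ?I = "interval_measure_on a b"
  obtain g where g: "continuous_on {a..b} g" "has_weak_deriv a b l u g" "g a = g b"
  proof -
    have "\<exists>g. continuous_on {a..b} g \<and> has_weak_deriv a b l u g \<and> g a = g b"
      using u Suc.prems(1) unfolding sobolev_torus_def by simp
    then show ?thesis using that by blast
  qed
  have h: "has_weak_deriv a b 1 g h"
    using has_weak_deriv_shift[OF g(2), of 1 h] Suc.prems(2) by simp
  have "(\<integral>t. h t * fourier \<omega> (- k) 0 t \<partial>?I) = - (\<integral>t. g t * fourier \<omega> (- k) 1 t \<partial>?I)"
    by (rule periodic_integration_by_parts[OF ab g(1,3) h smooth_family_fourier fourier_periodic[OF ab \<omega>]])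
  also have "\<dots> = (\<i> * of_real (\<omega> * of_int k)) * (\<integral>t. g t * fourier \<omega> (- k) 0 t \<partial>?I)"
    unfolding fourier_eq[of _ _ 1] by (simp add: mult.left_commute[of "g _"])
  finally have "sprod (L2_space ?I) h (fourier \<omega> k 0) =
      (\<i> * of_real (\<omega> * of_int k)) * sprod (L2_space ?I) g (fourier \<omega> k 0)"
    by (simp only: sprod_L2 cnj_fourier)
  then show ?case
    using Suc.IH[OF _ g(2)] Suc.prems(1) by simp
qed

lemma sprod_fourier_cube:
  assumes "j \<in> freqs d" "k \<in> freqs d" "j \<noteq> k"
  shows "sprod (L2_cube a b d) (fourier_cube \<omega> d j) (fourier_cube \<omega> d k) = 0"
proof -
  have "\<exists>i<d. j i \<noteq> k i"
  proof (rule ccontr)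
    assume "\<not> ?thesis"
    then have "j = k" using assms(1,2) by (intro PiE_ext[of j "{..<d}" "\<lambda>_. UNIV" k]) auto
    with assms(3) show False by simp
  qed
  then obtain i where i: "i < d" "j i \<noteq> k i" by blast
  have "sprod (L2_cube a b d) (fourier_cube \<omega> d j) (fourier_cube \<omega> d k) =
      (\<Prod>i<d. sprod (L2_space (interval_measure_on a b)) (fourier \<omega> (j i) 0) (fourier \<omega> (k i) 0))"
    unfolding fourier_cube_def
    by (rule sprod_L2_cube_prod) (rule smooth_family_L2[OF smooth_family_fourier])+
  also have "\<dots> = 0"
    by (rule prod_zero) (use i in \<open>auto simp: sprod_fourier[OF ab \<omega>]\<close>)
  finally show ?thesis .
qed

lemma hnorm_fourier_cube: "hnorm (L2_cube a b d) (fourier_cube \<omega> d k) = sqrt (b - a) ^ d"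
proof -
  have "hnorm (L2_space (interval_measure_on a b)) (fourier \<omega> j 0) = sqrt (b - a)" for j
    by (simp add: hnorm_def sprod_fourier[OF ab \<omega>])
  then show ?thesis
    unfolding fourier_cube_def
    by (subst hnorm_L2_cube_prod) (simp_all add: smooth_family_L2[OF smooth_family_fourier])
qed

lemma fourier_cube_mem: "fourier_cube \<omega> d k \<in> vecs (Hmix_torus a b s d)"
  unfolding Hmix_torus_def fourier_cube_def
  by (intro algebraic_tensor_power_subset[OF sobolev_torus_subset] algebraic_tensor_power_prod
      fourier_mem_torus[OF ab \<omega>])

text \<open>On products the identity holds coordinatewise by the one-dimensional case, and both
  sides are linear. The chosen derivative is first replaced by a sum of products of one-dimensional
  ones, which agrees with it almost everywhere.\<close>

lemma sprod_deriv_algebraic: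
  assumes g: "g \<in> algebraic_tensor_power d (vecs (sobolev_torus a b s))"
    and \<alpha>: "\<alpha> \<in> multi_indices d s"
  shows "sprod (L2_cube a b d) (mixed_weak_deriv a b d \<alpha> g) (fourier_cube \<omega> d k) =
    (\<Prod>i<d. (\<i> * of_real (\<omega> * of_int (k i))) ^ \<alpha> i) * sprod (L2_cube a b d) g (fourier_cube \<omega> d k)"
proof -
  let ?L2 = "L2_space (interval_measure_on a b)" and ?e = "\<lambda>i. fourier \<omega> (k i) 0"
  obtain m :: nat and c u where g': "g = (\<lambda>x. \<Sum>j<m. c j * (\<Prod>i<d. u j i (x i)))"
    and u: "\<forall>j<m. \<forall>i<d. u j i \<in> vecs (sobolev_torus a b s)"
    using g unfolding algebraic_tensor_power_def by blast
  have uS: "u j i \<in> vecs (sobolev_interval a b s)" if "j < m" "i < d" for i j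
    using u that by (intro subsetD[OF sobolev_torus_subset]) simp
  have u2: "u j i \<in> vecs ?L2" if "j < m" "i < d" for i j
    by (rule sobolev_interval_L2[OF uS[OF that]])
  define U where "U j i = (SOME h. has_weak_deriv a b (\<alpha> i) (u j i) h)" for j i
  have U: "has_weak_deriv a b (\<alpha> i) (u j i) (U j i)" if "j < m" "i < d" for i j
    unfolding U_def
    using sobolev_interval_weak_deriv[OF uS[OF that] multi_indicesD(1)[OF \<alpha> that(2)]] by (rule someI_ex)
  have U2: "U j i \<in> vecs ?L2" if "j < m" "i < d" for i j
    using U[OF that] by (simp add: has_weak_deriv_def)
  have e2: "?e i \<in> vecs ?L2" for i by (rule smooth_family_L2[OF smooth_family_fourier])
  have "has_mixed_weak_deriv a b d \<alpha> g (\<lambda>x. \<Sum>j<m. c j * (\<Prod>i<d. U j i (x i)))"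
    unfolding g'
    by (intro has_mixed_weak_deriv_sum has_mixed_weak_deriv_cmult has_mixed_weak_deriv_prod
        L2_cube.cmult_mem L2_cube_prod u2 U) (simp_all add: multi_indicesD(2)[OF \<alpha>])
  note D = mixed_weak_deriv_AE[OF this] and D' = this
  have "sprod (L2_cube a b d) (mixed_weak_deriv a b d \<alpha> g) (fourier_cube \<omega> d k) =
      sprod (L2_cube a b d) (\<lambda>x. \<Sum>j<m. c j * (\<Prod>i<d. U j i (x i))) (fourier_cube \<omega> d k)"
    unfolding L2_cube_def
    by (rule sprod_L2_cong_AE[OF D(1)])
       (use has_mixed_weak_deriv_L2[OF D(2)] has_mixed_weak_deriv_L2[OF D'] fourier_cube_L2 in
         \<open>simp_all add: L2_cube_vecs\<close>)
  also have "\<dots> = (\<Sum>j<m. c j * (\<Prod>i<d. sprod ?L2 (U j i) (?e i)))"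
  proof -
    have "sprod (L2_cube a b d) (\<lambda>x. \<Sum>j<m. c j * (\<Prod>i<d. U j i (x i))) (fourier_cube \<omega> d k) =
        (\<Sum>j<m. sprod (L2_cube a b d) (\<lambda>x. c j * (\<Prod>i<d. U j i (x i))) (fourier_cube \<omega> d k))"
      by (intro L2_cube.sprod_sum_left L2_cube.cmult_mem L2_cube_prod fourier_cube_L2 U2) simp_all
    also have "\<dots> = (\<Sum>j<m. c j * sprod (L2_cube a b d) (\<lambda>x. \<Prod>i<d. U j i (x i)) (fourier_cube \<omega> d k))"
      by (intro sum.cong refl L2_cube.sprod_cmult_left L2_cube_prod fourier_cube_L2 U2) simp_all
    also have "\<dots> = (\<Sum>j<m. c j * (\<Prod>i<d. sprod ?L2 (U j i) (?e i)))"
      unfolding fourier_cube_def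
      by (intro sum.cong refl arg_cong2[of _ _ _ _ "(*)"] sprod_L2_cube_prod U2 e2) simp_all
    finally show ?thesis .
  qed
  also have "\<dots> = (\<Sum>j<m. c j * (\<Prod>i<d. (\<i> * of_real (\<omega> * of_int (k i))) ^ \<alpha> i * sprod ?L2 (u j i) (?e i)))"
  proof -
    have "sprod ?L2 (U j i) (?e i) = (\<i> * of_real (\<omega> * of_int (k i))) ^ \<alpha> i * sprod ?L2 (u j i) (?e i)"
      if "j < m" "i < d" for i j
    proof (rule sprod_weak_deriv_fourier[OF _ multi_indicesD(1)[OF \<alpha> that(2)] U[OF that]])
      show "u j i \<in> vecs (sobolev_torus a b s)" using u that by blast
    qed
    then show ?thesis by (intro sum.cong prod.cong refl arg_cong2[of _ _ _ _ "(*)"]) simp_all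
  qed
  also have "\<dots> = (\<Prod>i<d. (\<i> * of_real (\<omega> * of_int (k i))) ^ \<alpha> i) * (\<Sum>j<m. c j * (\<Prod>i<d. sprod ?L2 (u j i) (?e i)))"
    unfolding prod.distrib sum_distrib_left by (intro sum.cong refl mult.left_commute)
  also have "(\<Sum>j<m. c j * (\<Prod>i<d. sprod ?L2 (u j i) (?e i))) = sprod (L2_cube a b d) g (fourier_cube \<omega> d k)"
  proof -
    have "sprod (L2_cube a b d) g (fourier_cube \<omega> d k) =
        (\<Sum>j<m. sprod (L2_cube a b d) (\<lambda>x. c j * (\<Prod>i<d. u j i (x i))) (fourier_cube \<omega> d k))"
      unfolding g' by (intro L2_cube.sprod_sum_left L2_cube.cmult_mem L2_cube_prod fourier_cube_L2 u2) simp_all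
    also have "\<dots> = (\<Sum>j<m. c j * sprod (L2_cube a b d) (\<lambda>x. \<Prod>i<d. u j i (x i)) (fourier_cube \<omega> d k))"
      by (intro sum.cong refl L2_cube.sprod_cmult_left L2_cube_prod fourier_cube_L2 u2) simp_all
    also have "\<dots> = (\<Sum>j<m. c j * (\<Prod>i<d. sprod ?L2 (u j i) (?e i)))"
      unfolding fourier_cube_def
      by (intro sum.cong refl arg_cong2[of _ _ _ _ "(*)"] sprod_L2_cube_prod u2 e2) simp_all
    finally show ?thesis by (rule sym)
  qed
  finally show ?thesis .
qed

text \<open>Both sides are continuous in \<open>f\<close> with respect to the mixed Sobolev norm.\<close>

lemma sprod_deriv_torus:
  assumes f: "f \<in> vecs (Hmix_torus a b s d)" and \<alpha>: "\<alpha> \<in> multi_indices d s"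
  shows "sprod (L2_cube a b d) (mixed_weak_deriv a b d \<alpha> f) (fourier_cube \<omega> d k) =
    (\<Prod>i<d. (\<i> * of_real (\<omega> * of_int (k i))) ^ \<alpha> i) * sprod (L2_cube a b d) f (fourier_cube \<omega> d k)"
    (is "?l = ?c * ?r")
proof -
  let ?Y = "L2_cube a b d" and ?X = "mixed_sobolev a b s d" and ?e = "fourier_cube \<omega> d k"
    and ?D = "mixed_weak_deriv a b d \<alpha>"
  define R where "R = hnorm ?Y ?e"
  have R: "R \<ge> 0" unfolding R_def by (rule L2_cube.hnorm_nonneg[OF fourier_cube_L2])
  have fX: "f \<in> vecs ?X" using f by (simp add: Hmix_torus_def tensor_power_vecs)
  have "cmod (?l - ?c * ?r) \<le> \<epsilon>" if "\<epsilon> > 0" for \<epsilon>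
  proof -
    \<comment> \<open>An approximation within \<delta> contributes at most \<delta> (R + 1) through
      the left side and that times the modulus of the factor through the right side, in total
      \<epsilon>. The added ones keep the denominator positive.\<close>
    define \<delta> where "\<delta> = \<epsilon> / ((1 + cmod ?c) * (R + 1))"
    have pos: "(1 + cmod ?c) * (R + 1) > 0" using R by (intro mult_pos_pos) (simp_all add: add_pos_nonneg)
    then have "\<delta> > 0" using that by (simp add: \<delta>_def)
    then obtain g where g: "g \<in> algebraic_tensor_power d (vecs (sobolev_torus a b s))" "hdist ?X f g < \<delta>"
      using f unfolding Hmix_torus_def tensor_power_vecs by blast
    have gX: "g \<in> vecs ?X"
      by (rule algebraic_tensor_power_mixed_sobolev[OF sobolev_torus_subset g(1)])
    note Df = mixed_sobolev_derivs[OF fX \<alpha>] and Dg = mixed_sobolev_derivs[OF gX \<alpha>]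
    note Df2 = has_mixed_weak_deriv_L2[OF Df] and Dg2 = has_mixed_weak_deriv_L2[OF Dg]
    have "has_mixed_weak_deriv a b d \<alpha> (\<lambda>x. f x + (- 1) * g x) (\<lambda>x. ?D f x + (- 1) * ?D g x)"
      by (intro has_mixed_weak_deriv_add has_mixed_weak_deriv_cmult Df Dg L2_cube.cmult_mem
          mixed_sobolev_L2[OF fX] mixed_sobolev_L2[OF gX])
    then have "has_mixed_weak_deriv a b d \<alpha> (\<lambda>x. f x - g x) (\<lambda>x. ?D f x - ?D g x)" by simp
    from hnorm_deriv_le[OF mixed.diff_mem[OF fX gX] \<alpha> this]
    have D: "hnorm ?Y (\<lambda>x. ?D f x - ?D g x) \<le> \<delta>" using g(2) by (simp add: hdist_def)
    have L: "hnorm ?Y (\<lambda>x. f x - g x) \<le> \<delta>"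
      using hnorm_L2_le_mixed[OF mixed.diff_mem[OF fX gX]] g(2) by (simp add: hdist_def)
    have diff: "sprod ?Y (\<lambda>x. u x - v x) ?e = sprod ?Y u ?e - sprod ?Y v ?e"
      if "u \<in> vecs ?Y" "v \<in> vecs ?Y" for u v
      using L2_cube.sprod_add_left[OF that(1) L2_cube.cmult_mem[OF that(2), of "-1"] fourier_cube_L2]
        L2_cube.sprod_cmult_left[OF that(2) fourier_cube_L2, of "-1"] by simp
    have CS: "cmod (sprod ?Y u ?e) \<le> \<delta> * (R + 1)" if "u \<in> vecs ?Y" "hnorm ?Y u \<le> \<delta>" for u
    proof -
      have "cmod (sprod ?Y u ?e) \<le> hnorm ?Y u * R"
        unfolding R_def by (rule L2_cube.Cauchy_Schwarz[OF that(1) fourier_cube_L2])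
      also have "\<dots> \<le> \<delta> * (R + 1)"
        using that R L2_cube.hnorm_nonneg[OF that(1)] by (intro mult_mono) simp_all
      finally show ?thesis .
    qed
    have eq: "?l - ?c * ?r = sprod ?Y (\<lambda>x. ?D f x - ?D g x) ?e - ?c * sprod ?Y (\<lambda>x. f x - g x) ?e"
      unfolding diff[OF Df2 Dg2] diff[OF mixed_sobolev_L2[OF fX] mixed_sobolev_L2[OF gX]]
        sprod_deriv_algebraic[OF g(1) \<alpha>] by (simp add: algebra_simps)
    have "cmod (?l - ?c * ?r) \<le> cmod (sprod ?Y (\<lambda>x. ?D f x - ?D g x) ?e) + cmod ?c * cmod (sprod ?Y (\<lambda>x. f x - g x) ?e)"
      unfolding eq norm_mult[symmetric] by (rule norm_triangle_ineq4)
    also have "\<dots> \<le> \<delta> * (R + 1) + cmod ?c * (\<delta> * (R + 1))"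
      by (rule add_mono[OF CS[OF L2_cube.diff_mem[OF Df2 Dg2] D] mult_left_mono[OF
          CS[OF L2_cube.diff_mem[OF mixed_sobolev_L2[OF fX] mixed_sobolev_L2[OF gX]] L] norm_ge_zero]])
    also have "\<dots> = \<delta> * ((1 + cmod ?c) * (R + 1))" by (simp only: distrib_right distrib_left mult_ac mult_1)
    also have "\<dots> = \<epsilon>"
      unfolding \<delta>_def
      by (rule nonzero_divide_eq_eq[THEN iffD1, OF less_imp_neq[OF pos, symmetric] refl, symmetric])
    finally show ?thesis .
  qed
  then have "cmod (?l - ?c * ?r) \<le> 0" by (rule field_le_epsilon) simp
  then show ?thesis by simp
qed

text \<open>Bessel's inequalities for all D^\<alpha> f together bound the weighted squares of the
  coefficients of f, and outside K the weight is at least 1/\<epsilon>^2. Density of the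
  trigonometric polynomials shows that the discarded coefficients account for the whole
  error.\<close>

lemma projection_error:
  assumes f: "f \<in> vecs (Hmix_torus a b s d)" and "s \<ge> 1"
    and K: "finite K" "K \<subseteq> freqs d" and \<epsilon>: "\<epsilon> > 0"
    and large: "\<And>k. k \<in> freqs d - K \<Longrightarrow> 1 / \<epsilon>\<^sup>2 \<le> (\<Prod>i<d. weight s (k i))"
  shows "hnorm (L2_cube a b d) (\<lambda>x. f x - L2_cube.projection a b d (sqrt (b - a) ^ d) (fourier_cube \<omega> d) K f x)
    \<le> \<epsilon> * hnorm (Hmix_torus a b s d) f"
proof -
  let ?Y = "L2_cube a b d" and ?X = "mixed_sobolev a b s d" and ?e = "fourier_cube \<omega> d"
  define r where "r = sqrt (b - a) ^ d"
  have r: "r > 0" using ab by (simp add: r_def)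
  have fX: "f \<in> vecs ?X" using f by (simp add: Hmix_torus_def tensor_power_vecs)
  have f2: "f \<in> vecs ?Y" by (rule mixed_sobolev_L2[OF fX])
  have err2: "f \<in> vecs ?Y \<Longrightarrow> (\<lambda>x. f x - L2_cube.projection a b d r ?e G f x) \<in> vecs ?Y" for G
    unfolding L2_cube.projection_def
    by (intro L2_cube.diff_mem L2_cube.sum_mem L2_cube.cmult_mem fourier_cube_L2)
  have norm_sq: "(cmod ((\<i> * of_real x) ^ n))\<^sup>2 = x ^ (2 * n)" for x :: real and n
  proof -
    have "(cmod ((\<i> * of_real x) ^ n))\<^sup>2 = (\<bar>x\<bar> ^ n)\<^sup>2" by (simp add: norm_power norm_mult)
    also have "\<dots> = (\<bar>x\<bar>\<^sup>2) ^ n" by (simp only: power_mult[symmetric] mult.commute)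
    also have "\<dots> = x ^ (2 * n)" by (simp add: power_mult)
    finally show ?thesis .
  qed
  let ?err = "\<lambda>G. hnorm ?Y (\<lambda>x. f x - L2_cube.projection a b d r ?e G f x)"
  have coeffs: "(\<Sum>k\<in>G. (\<Prod>i<d. weight s (k i)) * (cmod (sprod ?Y f (?e k)))\<^sup>2) \<le> r\<^sup>2 * (hnorm ?X f)\<^sup>2"
    if G: "finite G" "G \<subseteq> freqs d" for G
  proof -
    \<comment> \<open>Multiplying out the product of the weights gives one term per multi-index, the
      squared modulus of the factor that D^\<alpha> puts on the coefficient.\<close>
    have "(\<Prod>i<d. weight s (k i)) * (cmod (sprod ?Y f (?e k)))\<^sup>2 =
        (\<Sum>\<alpha>\<in>multi_indices d s. (cmod (sprod ?Y (mixed_weak_deriv a b d \<alpha> f) (?e k)))\<^sup>2)" for k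
    proof -
      have "(\<Sum>\<alpha>\<in>multi_indices d s. (cmod (sprod ?Y (mixed_weak_deriv a b d \<alpha> f) (?e k)))\<^sup>2) =
          (\<Sum>\<alpha>\<in>multi_indices d s. (\<Prod>i<d. (\<omega> * of_int (k i)) ^ (2 * \<alpha> i)) * (cmod (sprod ?Y f (?e k)))\<^sup>2)"
      proof (rule sum.cong[OF refl])
        fix \<alpha> assume \<alpha>: "\<alpha> \<in> multi_indices d s"
        have "(cmod (\<Prod>i<d. (\<i> * of_real (\<omega> * of_int (k i))) ^ \<alpha> i))\<^sup>2 = (\<Prod>i<d. (\<omega> * of_int (k i)) ^ (2 * \<alpha> i))"
          unfolding prod_norm[symmetric] prod_power_distrib by (intro prod.cong refl norm_sq)
        then show "(cmod (sprod ?Y (mixed_weak_deriv a b d \<alpha> f) (?e k)))\<^sup>2 =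
            (\<Prod>i<d. (\<omega> * of_int (k i)) ^ (2 * \<alpha> i)) * (cmod (sprod ?Y f (?e k)))\<^sup>2"
          unfolding sprod_deriv_torus[OF f \<alpha>] norm_mult power_mult_distrib by simp
      qed
      also have "\<dots> = (\<Prod>i<d. weight s (k i)) * (cmod (sprod ?Y f (?e k)))\<^sup>2"
        unfolding sum_distrib_right[symmetric] weight_def
        using sum_prod_multi_indices[of "\<lambda>i l. (\<omega> * of_int (k i)) ^ (2 * l)" d s] by simp
      finally show ?thesis by (rule sym)
    qed
    then have "(\<Sum>k\<in>G. (\<Prod>i<d. weight s (k i)) * (cmod (sprod ?Y f (?e k)))\<^sup>2) =
        (\<Sum>k\<in>G. \<Sum>\<alpha>\<in>multi_indices d s. (cmod (sprod ?Y (mixed_weak_deriv a b d \<alpha> f) (?e k)))\<^sup>2)" by simp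
    also have "\<dots> = (\<Sum>\<alpha>\<in>multi_indices d s. \<Sum>k\<in>G. (cmod (sprod ?Y (mixed_weak_deriv a b d \<alpha> f) (?e k)))\<^sup>2)"
      by (rule sum.swap)
    also have "\<dots> \<le> (\<Sum>\<alpha>\<in>multi_indices d s. r\<^sup>2 * (hnorm ?Y (mixed_weak_deriv a b d \<alpha> f))\<^sup>2)"
    proof (rule sum_mono)
      fix \<alpha> assume \<alpha>: "\<alpha> \<in> multi_indices d s"
      show "(\<Sum>k\<in>G. (cmod (sprod ?Y (mixed_weak_deriv a b d \<alpha> f) (?e k)))\<^sup>2) \<le>
          r\<^sup>2 * (hnorm ?Y (mixed_weak_deriv a b d \<alpha> f))\<^sup>2"
      proof (rule L2_cube.Bessel[OF G(1) fourier_cube_L2 r])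
        show "hnorm ?Y (?e k) = r" for k by (simp only: hnorm_fourier_cube r_def)
        show "sprod ?Y (?e k) (?e l) = 0" if "k \<in> G" "l \<in> G" "k \<noteq> l" for k l
          using sprod_fourier_cube[of k d l] G(2) that by blast
        show "mixed_weak_deriv a b d \<alpha> f \<in> vecs ?Y"
          by (rule has_mixed_weak_deriv_L2[OF mixed_sobolev_derivs[OF fX \<alpha>]])
      qed
    qed
    also have "\<dots> = r\<^sup>2 * (hnorm ?X f)\<^sup>2"
      unfolding hnorm_mixed_sobolev[OF fX mixed_sobolev_derivs_all[OF fX]] by (simp only: sum_distrib_left)
    finally show ?thesis .
  qed
  have "(?err K)\<^sup>2 \<le> (\<epsilon> * hnorm ?X f)\<^sup>2"
  proof (rule field_le_epsilon)
    fix \<delta> :: real assume "\<delta> > 0"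
    then have "sqrt \<delta> > 0" by simp
    then obtain P where P: "P \<in> lin_span ?e (freqs d)" "hdist ?Y f P < sqrt \<delta>"
      using approximable_torus[OF ab \<omega> f \<open>s \<ge> 1\<close>] unfolding approximable_def by blast
    obtain F c where F: "finite F" "F \<subseteq> freqs d" and PF: "P = (\<lambda>x. \<Sum>k\<in>F. c k * ?e k x)"
      using lin_span_form[OF P(1)] by blast
    \<comment> \<open>G contains the frequencies of the approximant P, so projecting onto G errs no
      more than P; it also contains K, so both projections can be compared inside one span.\<close>
    define G where "G = F \<union> K"
    have G: "finite G" "G \<subseteq> freqs d" using F K by (auto simp: G_def)
    have orth: "sprod ?Y (?e k) (?e l) = 0" if "k \<in> G" "l \<in> G" "k \<noteq> l" for k l
      using sprod_fourier_cube[of k d l] G(2) that by blast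
    have best: "(hnorm ?Y (\<lambda>x. f x - (\<Sum>l\<in>G. w l * ?e l x)))\<^sup>2 = (?err G)\<^sup>2 +
        r\<^sup>2 * (\<Sum>l\<in>G. (cmod (sprod ?Y f (?e l) / of_real (r\<^sup>2) - w l))\<^sup>2)" for w
      by (rule L2_cube.hnorm_minus_combination_sq[OF G(1) fourier_cube_L2 r _ orth f2])
         (simp_all add: hnorm_fourier_cube r_def)
    have "P = (\<lambda>x. \<Sum>k\<in>G. (if k \<in> F then c k else 0) * ?e k x)"
      unfolding PF by (intro ext sum.mono_neutral_cong_left) (use G(1) in \<open>auto simp: G_def\<close>)
    then have "(?err G)\<^sup>2 \<le> (hdist ?Y f P)\<^sup>2"
      using best[of "\<lambda>k. if k \<in> F then c k else 0"] by (simp add: hdist_def sum_nonneg)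
    also have "\<dots> \<le> (sqrt \<delta>)\<^sup>2"
      using P(2) L2_cube.hdist_nonneg[OF f2 span_L2[OF P(1)]] by (intro power_mono) simp_all
    finally have errG: "(?err G)\<^sup>2 \<le> \<delta>" using \<open>\<delta> > 0\<close> by simp
    \<comment> \<open>The projection onto K as a combination over G: its coefficients can differ
      from the optimal ones only on G - K.\<close>
    define w where "w k = (if k \<in> K then sprod ?Y f (?e k) / of_real (r\<^sup>2) else 0)" for k
    have proj: "L2_cube.projection a b d r ?e K f = (\<lambda>x. \<Sum>k\<in>G. w k * ?e k x)"
      unfolding L2_cube.projection_def
      by (intro ext sum.mono_neutral_cong_left) (use G(1) in \<open>auto simp: G_def w_def\<close>)
    have "r\<^sup>2 * (\<Sum>l\<in>G. (cmod (sprod ?Y f (?e l) / of_real (r\<^sup>2) - w l))\<^sup>2) =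
        (\<Sum>l\<in>G - K. (cmod (sprod ?Y f (?e l)))\<^sup>2) / r\<^sup>2"
    proof -
      have "(\<Sum>l\<in>G. (cmod (sprod ?Y f (?e l) / of_real (r\<^sup>2) - w l))\<^sup>2) =
          (\<Sum>l\<in>G - K. (cmod (sprod ?Y f (?e l) / of_real (r\<^sup>2)))\<^sup>2)"
        by (rule sum.mono_neutral_cong_right) (use G(1) in \<open>auto simp: w_def\<close>)
      also have "\<dots> = (\<Sum>l\<in>G - K. (cmod (sprod ?Y f (?e l)))\<^sup>2) / (r\<^sup>2)\<^sup>2"
        unfolding sum_divide_distrib norm_divide norm_of_real power_divide by simp
      finally show ?thesis using r by (simp add: power2_eq_square)
    qed
    also have "\<dots> \<le> \<epsilon>\<^sup>2 * (hnorm ?X f)\<^sup>2"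
    proof -
      have "(\<Sum>l\<in>G - K. (cmod (sprod ?Y f (?e l)))\<^sup>2) \<le>
          (\<Sum>l\<in>G - K. \<epsilon>\<^sup>2 * ((\<Prod>i<d. weight s (l i)) * (cmod (sprod ?Y f (?e l)))\<^sup>2))"
      proof (rule sum_mono)
        fix l assume "l \<in> G - K"
        then have "1 / \<epsilon>\<^sup>2 \<le> (\<Prod>i<d. weight s (l i))" using G(2) by (intro large) auto
        then have "1 \<le> \<epsilon>\<^sup>2 * (\<Prod>i<d. weight s (l i))" using \<epsilon> by (simp add: field_simps)
        then have "1 * (cmod (sprod ?Y f (?e l)))\<^sup>2 \<le> \<epsilon>\<^sup>2 * (\<Prod>i<d. weight s (l i)) * (cmod (sprod ?Y f (?e l)))\<^sup>2"
          by (intro mult_right_mono) simp_all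
        then show "(cmod (sprod ?Y f (?e l)))\<^sup>2 \<le> \<epsilon>\<^sup>2 * ((\<Prod>i<d. weight s (l i)) * (cmod (sprod ?Y f (?e l)))\<^sup>2)"
          by (simp add: mult.assoc)
      qed
      also have "\<dots> = \<epsilon>\<^sup>2 * (\<Sum>l\<in>G - K. (\<Prod>i<d. weight s (l i)) * (cmod (sprod ?Y f (?e l)))\<^sup>2)"
        by (simp only: sum_distrib_left)
      also have "\<dots> \<le> \<epsilon>\<^sup>2 * (r\<^sup>2 * (hnorm ?X f)\<^sup>2)"
        using G by (intro mult_left_mono coeffs) auto
      finally show ?thesis using r by (simp add: field_simps)
    qed
    finally have "r\<^sup>2 * (\<Sum>l\<in>G. (cmod (sprod ?Y f (?e l) / of_real (r\<^sup>2) - w l))\<^sup>2) \<le> \<epsilon>\<^sup>2 * (hnorm ?X f)\<^sup>2" .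
    then show "(?err K)\<^sup>2 \<le> (\<epsilon> * hnorm ?X f)\<^sup>2 + \<delta>"
      unfolding proj best[of w] power_mult_distrib using errG by linarith
  qed
  then have "?err K \<le> \<epsilon> * hnorm ?X f"
    by (rule power2_le_imp_le) (use \<epsilon> mixed.hnorm_nonneg[OF fX] in simp)
  then show ?thesis by (simp only: r_def Hmix_torus_def tensor_power_simps)
qed

text \<open>Stated for finite sets G of small frequencies, because the finiteness of the set of all
  of them is drawn from this uniform bound. Over a box of frequencies the sum factors into a d-th
  power, and (1 + 4 D / d)^d \<le> exp (4 D).\<close>

lemma card_small_frequencies:
  assumes "q \<ge> 0" "D \<ge> 0" "d \<ge> 1" "\<epsilon> > 0"
    and decay: "\<And>k. k \<noteq> 0 \<Longrightarrow> weight s k powr (- q / 2) \<le> D / (real d * (real_of_int k)\<^sup>2)"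
    and G: "G \<subseteq> {k \<in> freqs d. (\<Prod>i<d. weight s (k i)) < 1 / \<epsilon>\<^sup>2}" "finite G"
  shows "real (card G) \<le> \<epsilon> powr (- q) * exp (4 * D)"
proof -
  obtain N where N: "\<And>k i. k \<in> G \<Longrightarrow> i < d \<Longrightarrow> k i \<in> {- int N..int N}"
  proof -
    \<comment> \<open>0 is inserted so that the maximum exists also for empty G. The box with bound
      M encloses G and keeps the sums over frequencies finite.\<close>
    define M where "M = Max (insert 0 ((\<lambda>(k, i). nat \<bar>k i\<bar>) ` (G \<times> {..<d})))"
    have "nat \<bar>k i\<bar> \<le> M" if "k \<in> G" "i < d" for k i
      unfolding M_def using that G(2) by (intro Max_ge) auto
    then have "k i \<in> {- int M..int M}" if "k \<in> G" "i < d" for k i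
      using that by (fastforce simp: nat_le_iff abs_le_iff)
    then show thesis by (rule that)
  qed
  let ?S = "{- int N..int N}" and ?h = "\<lambda>k. weight s k powr (- q / 2)"
  have GS: "G \<subseteq> {..<d} \<rightarrow>\<^sub>E ?S"
  proof
    fix k assume k: "k \<in> G"
    then have "k \<in> freqs d" using G(1) by blast
    then show "k \<in> {..<d} \<rightarrow>\<^sub>E ?S" using N[OF k] PiE_arb[of k "{..<d}" "\<lambda>_. UNIV"] by (intro PiE_I) auto
  qed
  have one: "1 \<le> \<epsilon> powr (- q) * (\<Prod>i<d. ?h (k i))" if "k \<in> G" for k
  proof -
    have W: "0 < (\<Prod>i<d. weight s (k i))"
      by (intro prod_pos ballI) (use weight_ge_1 in \<open>smt (verit)\<close>)
    have "(\<Prod>i<d. weight s (k i)) \<le> 1 / \<epsilon>\<^sup>2" using that G(1) by auto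
    then have "(1 / \<epsilon>\<^sup>2) powr (- q / 2) \<le> (\<Prod>i<d. weight s (k i)) powr (- q / 2)"
      using W assms(1) by (intro powr_mono2') simp_all
    also have "(1 / \<epsilon>\<^sup>2) powr (- q / 2) = \<epsilon> powr q"
    proof -
      have "1 / \<epsilon>\<^sup>2 = \<epsilon> powr (- 2)" using \<open>\<epsilon> > 0\<close> by (simp add: powr_minus_divide)
      then show ?thesis by (simp only: powr_powr) simp
    qed
    also have "(\<Prod>i<d. weight s (k i)) powr (- q / 2) = (\<Prod>i<d. ?h (k i))"
      by (rule prod_powr_distrib)
    finally have "\<epsilon> powr (- q) * \<epsilon> powr q \<le> \<epsilon> powr (- q) * (\<Prod>i<d. ?h (k i))"
      by (intro mult_left_mono) simp_all
    then show ?thesis using \<open>\<epsilon> > 0\<close> by (simp add: powr_add[symmetric])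
  qed
  have "real (card G) = (\<Sum>k\<in>G. 1)" by simp
  also have "\<dots> \<le> (\<Sum>k\<in>G. \<epsilon> powr (- q) * (\<Prod>i<d. ?h (k i)))" by (intro sum_mono one)
  also have "\<dots> \<le> (\<Sum>k\<in>{..<d} \<rightarrow>\<^sub>E ?S. \<epsilon> powr (- q) * (\<Prod>i<d. ?h (k i)))"
    by (intro sum_mono2 GS finite_PiE mult_nonneg_nonneg prod_nonneg) simp_all
  also have "\<dots> = \<epsilon> powr (- q) * (\<Prod>i<d. \<Sum>k\<in>?S. ?h k)"
    by (subst prod_sum_PiE) (simp_all add: sum_distrib_left)
  also have "(\<Prod>i<d. \<Sum>k\<in>?S. ?h k) = (\<Sum>k\<in>?S. ?h k) ^ d" by simp
  also have "(\<Sum>k\<in>?S. ?h k) ^ d \<le> exp (4 * D)"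
  proof -
    have "(\<Sum>k\<in>?S. ?h k) = ?h 0 + (\<Sum>k\<in>?S - {0}. ?h k)"
      by (rule sum.remove) simp_all
    also have "?h 0 = 1" by (simp add: weight_0)
    also have "(\<Sum>k\<in>?S - {0}. ?h k) \<le> (\<Sum>k\<in>?S - {0}. D / real d * (1 / (real_of_int k)\<^sup>2))"
      by (intro sum_mono) (use decay in simp)
    also have "\<dots> = D / real d * (\<Sum>k\<in>?S - {0}. 1 / (real_of_int k)\<^sup>2)" by (simp only: sum_distrib_left)
    also have "\<dots> \<le> D / real d * 4"
      using assms(2) by (intro mult_left_mono sum_int_inverse_squares_le) simp
    also have "1 + D / real d * 4 \<le> exp (D / real d * 4)" by (rule exp_ge_add_one_self)
    finally have "(\<Sum>k\<in>?S. ?h k) ^ d \<le> exp (D / real d * 4) ^ d"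
      by (intro power_mono sum_nonneg) simp_all
    also have "\<dots> = exp (4 * D)" using \<open>d \<ge> 1\<close> by (simp add: exp_of_nat_mult[symmetric])
    finally show ?thesis .
  qed
  finally show ?thesis by (simp add: mult_left_mono)
qed

lemma strongly_tractable_if_decay:
  assumes s: "\<And>d. d \<ge> 1 \<Longrightarrow> s d \<ge> 1" and qD: "q \<ge> 0" "D \<ge> 0"
    and decay: "\<And>d k. d \<ge> 1 \<Longrightarrow> k \<noteq> 0 \<Longrightarrow> weight (s d) k powr (- q / 2) \<le> D / (real d * (real_of_int k)\<^sup>2)"
  shows "strongly_polynomially_tractable (\<lambda>d. Hmix_torus a b (s d) d) (\<lambda>d. L2_cube a b d) (\<lambda>d f. f)"
proof -
  define C where "C = 2 powr q * exp (4 * D)"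
  have "ereal_of_enat (info_complexity (Hmix_torus a b (s d) d) (L2_cube a b d) (\<lambda>f. f) \<epsilon>)
      \<le> ereal (C * \<epsilon> powr (- q) * real d powr 0)" if "d \<ge> 1" "\<epsilon> > 0" for d \<epsilon>
  proof -
    \<comment> \<open>The threshold belongs to \<epsilon>/2, since the approximation numbers have to
      be strictly below \<epsilon>; this costs the factor 2^q in C.\<close>
    define K where "K = {k \<in> freqs d. (\<Prod>i<d. weight (s d) (k i)) < 1 / (\<epsilon> / 2)\<^sup>2}"
    define B where "B = (\<epsilon> / 2) powr (- q) * exp (4 * D)"
    have bound: "real (card G) \<le> B" if "G \<subseteq> K" "finite G" for G
      unfolding B_def
      by (rule card_small_frequencies[OF qD \<open>d \<ge> 1\<close> _ decay that[unfolded K_def]])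
         (use \<open>\<epsilon> > 0\<close> \<open>d \<ge> 1\<close> in simp_all)
    \<comment> \<open>A uniform bound on the cardinality of all finite subsets yields the finiteness
      of K.\<close>
    have "finite K \<and> card K \<le> nat \<lfloor>B\<rfloor>"
    proof (rule finite_if_finite_subsets_card_bdd)
      show "card G \<le> nat \<lfloor>B\<rfloor>" if "G \<subseteq> K" "finite G" for G
        using bound[OF that] by (simp add: le_nat_floor)
    qed
    then have K: "finite K" by blast
    interpret contractive_embedding "Hmix_torus a b (s d) d" "L2_cube a b d"
      unfolding Hmix_torus_def by (rule tensor_power_contractive_embedding[OF sobolev_torus_subset])
    have "info_complexity (Hmix_torus a b (s d) d) (L2_cube a b d) (\<lambda>f. f) \<epsilon> \<le> enat (card K)"
    proof (rule info_complexity_le)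
      fix n assume n: "n > card K"
      have "approx_number (Hmix_torus a b (s d) d) (L2_cube a b d) (\<lambda>f. f) n \<le> \<epsilon> / 2"
      proof (rule approx_number_le_projection[OF K n fourier_cube_mem hnorm_fourier_cube])
        show "0 < sqrt (b - a) ^ d" using ab by simp
        show "sprod (L2_cube a b d) (fourier_cube \<omega> d k) (fourier_cube \<omega> d l) = 0"
          if "k \<in> K" "l \<in> K" "k \<noteq> l" for k l
          using that by (intro sprod_fourier_cube) (simp_all add: K_def)
        fix f assume f: "f \<in> vecs (Hmix_torus a b (s d) d)" "hnorm (Hmix_torus a b (s d) d) f \<le> 1"
        have "hnorm (L2_cube a b d) (\<lambda>x. f x - L2_cube.projection a b d (sqrt (b - a) ^ d) (fourier_cube \<omega> d) K f x)
            \<le> \<epsilon> / 2 * hnorm (Hmix_torus a b (s d) d) f"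
        proof (rule projection_error[OF f(1) s[OF \<open>d \<ge> 1\<close>] K])
          show "K \<subseteq> freqs d" by (auto simp: K_def)
          show "1 / (\<epsilon> / 2)\<^sup>2 \<le> (\<Prod>i<d. weight (s d) (k i))" if "k \<in> freqs d - K" for k
            using that by (simp add: K_def not_less)
        qed (use \<open>\<epsilon> > 0\<close> in simp)
        also have "\<dots> \<le> \<epsilon> / 2 * 1" using f(2) \<open>\<epsilon> > 0\<close> by (intro mult_left_mono) simp_all
        finally show "hnorm (L2_cube a b d) (\<lambda>x. f x - L2_cube.projection a b d (sqrt (b - a) ^ d) (fourier_cube \<omega> d) K f x)
            \<le> \<epsilon> / 2" by simp
      qed
      then show "approx_number (Hmix_torus a b (s d) d) (L2_cube a b d) (\<lambda>f. f) n < \<epsilon>"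
        using \<open>\<epsilon> > 0\<close> by simp
    qed
    then have "ereal_of_enat (info_complexity (Hmix_torus a b (s d) d) (L2_cube a b d) (\<lambda>f. f) \<epsilon>)
        \<le> ereal_of_enat (enat (card K))" by (simp only: ereal_of_enat_le_iff)
    also have "\<dots> = ereal (real (card K))" by simp
    also have "\<dots> \<le> ereal B" using bound[OF subset_refl K] by simp
    also have "B = C * \<epsilon> powr (- q) * real d powr 0"
      using \<open>d \<ge> 1\<close> \<open>\<epsilon> > 0\<close> by (simp add: B_def C_def powr_divide powr_minus field_simps)
    finally show ?thesis .
  qed
  then have "tractable_with C 0 q (\<lambda>d. Hmix_torus a b (s d) d) (\<lambda>d. L2_cube a b d) (\<lambda>d f. f)"
    unfolding tractable_with_def by blast
  moreover have "C \<ge> 0" by (simp add: C_def)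
  ultimately show ?thesis
    unfolding strongly_polynomially_tractable_def using qD(1) by blast
qed

text \<open>The top term of the weight is enough: its power is \<omega>^(-sq) |k|^(-sq), where the
  first factor supplies the decay 1/d through s \<ge> c ln d and the second the decay 1/k^2.\<close>

lemma strongly_tractable_if_logarithmic:
  assumes "b - a < 2 * pi" and s: "\<And>d. d \<ge> 1 \<Longrightarrow> s d \<ge> 1" and "grows_at_least_logarithmically s"
  shows "strongly_polynomially_tractable (\<lambda>d. Hmix_torus a b (s d) d) (\<lambda>d. L2_cube a b d) (\<lambda>d f. f)"
proof -
  have \<omega>1: "\<omega> > 1" using ab assms(1) by (simp add: \<omega>)
  then have ln: "ln \<omega> > 0" by (rule ln_gt_zero)
  obtain c d0 where c: "c > 0" "d0 \<ge> 1" "\<forall>d\<ge>d0. real (s d) \<ge> c * ln (real d)"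
    using assms(3) unfolding grows_at_least_logarithmically_def by blast
  \<comment> \<open>The first entry gives s q \<ge> 2, the second c q ln \<omega> \<ge> 1 and hence
    \<omega>^(-sq) \<le> 1/d from d0 on.\<close>
  define q where "q = max 2 (1 / (c * ln \<omega>))"
  \<comment> \<open>The dimensions below d0 are covered by D / d \<ge> 1.\<close>
  define D where "D = real d0"
  show ?thesis
  proof (rule strongly_tractable_if_decay[OF s])
    show "q \<ge> 0" "D \<ge> 0" by (simp_all add: q_def D_def)
    fix d k assume d: "(d::nat) \<ge> 1" and k: "(k::int) \<noteq> 0"
    let ?s = "real (s d)" and ?k = "\<bar>real_of_int k\<bar>"
    have k1: "?k \<ge> 1" using k by linarith
    have s1: "?s \<ge> 1" using s[OF d] by simp
    have sq: "?s * q \<ge> 2"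
    proof -
      have "1 * 2 \<le> ?s * q" using s1 by (intro mult_mono) (simp_all add: q_def)
      then show ?thesis by simp
    qed
    have base: "(\<omega> * of_int k) ^ (2 * s d) = (\<omega> * ?k) powr (2 * ?s)"
    proof -
      have "(\<omega> * of_int k) ^ (2 * s d) = (\<omega> * ?k) ^ (2 * s d)"
        by (simp add: power_mult power_mult_distrib)
      also have "\<dots> = (\<omega> * ?k) powr real (2 * s d)"
        by (rule powr_realpow[symmetric]) (use \<omega>1 k1 in \<open>simp add: mult_pos_pos\<close>)
      finally show ?thesis by simp
    qed
    have "weight (s d) k powr (- q / 2) \<le> ((\<omega> * of_int k) ^ (2 * s d)) powr (- q / 2)"
      using weight_ge_term[of "s d" "s d" k] \<omega>1 k
      by (intro powr_mono2') (simp_all add: q_def power_mult zero_less_power2)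
    also have "\<dots> = (\<omega> * ?k) powr (- (?s * q))"
      unfolding base powr_powr by simp
    also have "\<dots> = \<omega> powr (- (?s * q)) * ?k powr (- (?s * q))"
      by (rule powr_mult)
    also have "\<dots> \<le> D / real d * (1 / ?k\<^sup>2)"
    proof (rule mult_mono)
      have "?k powr (- (?s * q)) \<le> ?k powr (- 2)" using sq k1 by (intro powr_mono) simp_all
      also have "\<dots> = 1 / ?k\<^sup>2" using k1 by (simp add: powr_minus_divide)
      finally show "?k powr (- (?s * q)) \<le> 1 / ?k\<^sup>2" .
      show "\<omega> powr (- (?s * q)) \<le> D / real d"
      proof (cases "d \<ge> d0")
        case True
        have "ln (real d) = c * ln (real d) * (1 / (c * ln \<omega>)) * ln \<omega>" using c(1) ln by simp
        also have "\<dots> \<le> ?s * q * ln \<omega>"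
          using c True ln d by (intro mult_right_mono mult_mono) (simp_all add: q_def)
        finally have "exp (- (?s * q) * ln \<omega>) \<le> exp (- ln (real d))" by simp
        also have "\<dots> = 1 / real d" using d by (simp add: exp_minus inverse_eq_divide)
        also have "\<dots> \<le> D / real d" using c(2) by (intro divide_right_mono) (simp_all add: D_def)
        finally show ?thesis using \<omega>1 by (simp add: powr_def)
      next
        case False
        have "\<omega> powr (- (?s * q)) \<le> \<omega> powr 0" using sq \<omega>1 by (intro powr_mono) simp_all
        also have "\<dots> = 1" using \<omega>1 by simp
        also have "1 \<le> D / real d" using False d by (simp add: D_def)
        finally show ?thesis .
      qed
    qed (simp_all add: D_def)
    also have "\<dots> = D / (real d * (real_of_int k)\<^sup>2)" by simp
    finally show "weight (s d) k powr (- q / 2) \<le> D / (real d * (real_of_int k)\<^sup>2)" .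
  qed
qed

text \<open>The weight dominates the geometric mean of \<open>s + 1\<close> and \<open>k\<^sup>2\<^sup>s\<close>.\<close>

lemma strongly_tractable_if_polynomial:
  assumes "b - a = 2 * pi" and s: "\<And>d. d \<ge> 1 \<Longrightarrow> s d \<ge> 1" and "grows_at_least_polynomially s"
  shows "strongly_polynomially_tractable (\<lambda>d. Hmix_torus a b (s d) d) (\<lambda>d. L2_cube a b d) (\<lambda>d f. f)"
proof -
  have \<omega>1: "\<omega> = 1" using ab assms(1) by (simp add: \<omega>)
  obtain c p d0 where c: "c > 0" "p > 0" "d0 \<ge> 1" "\<forall>d\<ge>d0. real (s d) \<ge> c * real d powr p"
    using assms(3) unfolding grows_at_least_polynomially_def by blast
  \<comment> \<open>Each factor of the geometric mean carries the exponent q/4: the entry 4 ensures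
    s q / 2 \<ge> 2 for the decay in k, and 4 / p ensures p q / 4 \<ge> 1 for the decay in
    d.\<close>
  define q where "q = max 4 (4 / p)"
  \<comment> \<open>d0 serves the dimensions below d0, the power of c those from d0 on.\<close>
  define D where "D = max (real d0) (c powr (- q / 4))"
  show ?thesis
  proof (rule strongly_tractable_if_decay[OF s])
    show "q \<ge> 0" "D \<ge> 0" by (simp_all add: q_def D_def)
    fix d k assume d: "(d::nat) \<ge> 1" and k: "(k::int) \<noteq> 0"
    let ?s = "real (s d)" and ?k = "\<bar>real_of_int k\<bar>"
    have k1: "?k \<ge> 1" using k by linarith
    have s1: "?s \<ge> 1" using s[OF d] by simp
    have sq: "?s * q / 2 \<ge> 2"
    proof -
      have "1 * 4 \<le> ?s * q" using s1 by (intro mult_mono) (simp_all add: q_def)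
      then show ?thesis by simp
    qed
    let ?w = "weight (s d) k"
    have w0: "?w > 0" using weight_ge_1[of "s d" k] by linarith
    \<comment> \<open>With \<omega> = 1 and |k| \<ge> 1 each of the s + 1 terms is at least
      1.\<close>
    have w1: "?s + 1 \<le> ?w"
    proof -
      have "(\<Sum>l\<le>s d. 1) \<le> ?w"
        unfolding weight_def
      proof (rule sum_mono)
        fix l
        have "1 \<le> ?k ^ (2 * l)" using k1 by (rule one_le_power)
        then show "1 \<le> (\<omega> * of_int k) ^ (2 * l)" by (simp add: \<omega>1 power_mult)
      qed
      then show ?thesis by simp
    qed
    have w2: "?k powr (2 * ?s) \<le> ?w"
    proof -
      have "?k powr (2 * ?s) = ?k powr real (2 * s d)" by simp
      also have "\<dots> = ?k ^ (2 * s d)" by (rule powr_realpow) (use k1 in simp)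
      also have "\<dots> = (\<omega> * of_int k) ^ (2 * s d)" by (simp add: \<omega>1 power_mult)
      also have "\<dots> \<le> ?w" by (rule weight_ge_term) simp
      finally show ?thesis .
    qed
    have "?w powr (- q / 2) = ?w powr (- q / 4) * ?w powr (- q / 4)"
      by (simp add: powr_add[symmetric])
    also have "\<dots> \<le> D / real d * (1 / ?k\<^sup>2)"
    proof (rule mult_mono)
      have "?w powr (- q / 4) \<le> (?k powr (2 * ?s)) powr (- q / 4)"
        using k1 w2 by (intro powr_mono2') (simp_all add: q_def)
      also have "\<dots> = ?k powr (- (?s * q / 2))" by (simp add: powr_powr mult.commute)
      also have "\<dots> \<le> ?k powr (- 2)" using sq k1 by (intro powr_mono) simp_all
      also have "\<dots> = 1 / ?k\<^sup>2" using k1 by (simp add: powr_minus_divide)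
      finally show "?w powr (- q / 4) \<le> 1 / ?k\<^sup>2" .
      show "?w powr (- q / 4) \<le> D / real d"
      proof (cases "d \<ge> d0")
        case True
        have "c * real d powr p \<le> ?s" using c(4) True by blast
        then have "c * real d powr p \<le> ?w" using w1 by linarith
        then have "?w powr (- q / 4) \<le> (c * real d powr p) powr (- q / 4)"
          using c(1) d by (intro powr_mono2') (simp_all add: q_def)
        also have "\<dots> = c powr (- q / 4) * real d powr (- (p * q / 4))"
          using c(1) by (simp add: powr_mult powr_powr)
        also have "\<dots> \<le> D * real d powr (- 1)"
        proof (rule mult_mono)
          have "p * (4 / p) \<le> p * q" using c(2) by (intro mult_left_mono) (simp_all add: q_def)
          then have "1 \<le> p * q / 4" using c(2) by simp
          then show "real d powr (- (p * q / 4)) \<le> real d powr (- 1)" using d by (intro powr_mono) simp_all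
        qed (simp_all add: D_def)
        also have "\<dots> = D / real d" using d by (simp add: powr_minus_divide)
        finally show ?thesis .
      next
        case False
        have "?w powr (- q / 4) \<le> ?w powr 0"
          using weight_ge_1[of "s d" k] by (intro powr_mono) (simp_all add: q_def)
        also have "\<dots> = 1" using w0 by simp
        also have "1 \<le> D / real d" using False d by (simp add: D_def le_divide_eq)
        finally show ?thesis .
      qed
    qed (simp_all add: D_def)
    also have "\<dots> = D / (real d * (real_of_int k)\<^sup>2)" by simp
    finally show "weight (s d) k powr (- q / 2) \<le> D / (real d * (real_of_int k)\<^sup>2)" .
  qed
qed

end

section \<open>Assembly of the characterisation\<close>

lemma polynomially_tractable_if_strongly:
  "strongly_polynomially_tractable X Y T \<Longrightarrow> polynomially_tractable X Y T"
  unfolding strongly_polynomially_tractable_def polynomially_tractable_def by (meson order_refl)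

theorem corollary9:
  fixes a b :: real
  assumes "a < b"
  shows "(\<forall>s :: nat \<Rightarrow> nat. (\<forall>d\<ge>1. s d \<ge> 1) \<longrightarrow>
            \<not> polynomially_tractable (\<lambda>d. Hmix_interval a b (s d) d) (\<lambda>d. L2_cube a b d) (\<lambda>d f. f))
       \<and> (\<forall>s :: nat \<Rightarrow> nat. (\<forall>d\<ge>1. s d \<ge> 1) \<longrightarrow>
            (strongly_polynomially_tractable
                (\<lambda>d. Hmix_torus a b (s d) d) (\<lambda>d. L2_cube a b d) (\<lambda>d f. f)
              \<longleftrightarrow> polynomially_tractable
                (\<lambda>d. Hmix_torus a b (s d) d) (\<lambda>d. L2_cube a b d) (\<lambda>d f. f)) \<and>
            (polynomially_tractable
                (\<lambda>d. Hmix_torus a b (s d) d) (\<lambda>d. L2_cube a b d) (\<lambda>d f. f)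
              \<longleftrightarrow> (b - a < 2 * pi \<and> grows_at_least_logarithmically s) \<or>
                  (b - a = 2 * pi \<and> grows_at_least_polynomially s)))"
proof (intro conjI allI impI)
  fix s :: "nat \<Rightarrow> nat" assume "\<forall>d\<ge>1. s d \<ge> 1"
  then have s: "s d \<ge> 1" if "d \<ge> 1" for d using that by blast
  show "\<not> polynomially_tractable (\<lambda>d. Hmix_interval a b (s d) d) (\<lambda>d. L2_cube a b d) (\<lambda>d f. f)"
    by (rule not_tractable_interval[OF assms s])
  let ?strong = "strongly_polynomially_tractable (\<lambda>d. Hmix_torus a b (s d) d) (\<lambda>d. L2_cube a b d) (\<lambda>d f. f)"
    and ?poly = "polynomially_tractable (\<lambda>d. Hmix_torus a b (s d) d) (\<lambda>d. L2_cube a b d) (\<lambda>d f. f)"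
    and ?growth = "(b - a < 2 * pi \<and> grows_at_least_logarithmically s) \<or>
      (b - a = 2 * pi \<and> grows_at_least_polynomially s)"
  have 1: "?strong \<Longrightarrow> ?poly" by (rule polynomially_tractable_if_strongly)
  \<comment> \<open>\<open>refl\<close> fixes \<omega> as 2 pi / (b - a).\<close>
  have 2: "?poly \<Longrightarrow> ?growth" by (rule growth_if_tractable_torus[OF assms refl s])
  have 3: ?strong if ?growth
    using that
  proof (elim disjE conjE)
    assume "b - a < 2 * pi" "grows_at_least_logarithmically s"
    then show ?strong by (intro strongly_tractable_if_logarithmic[OF assms refl] s)
  next
    assume "b - a = 2 * pi" "grows_at_least_polynomially s"
    then show ?strong by (intro strongly_tractable_if_polynomial[OF assms refl] s)
  qed
  show "?strong = ?poly" using 1 2 3 by blast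
  show "?poly = ?growth" using 1 2 3 by blast
qed

end
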